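(* Let $k$ be an algebraically closed field of characteristic not dividing $6$ and $a_0,\dots,a_3\in k$ such that $X: y^2=x(x^4+a_3x^3+a_2x^2+a_1x+a_0)$ is a curve of genus two. Let $W: v^2=u^8+a_3u^6+a_2u^4+a_1u^2+a_0$, with étale double cover $W\to X$, $(u,v)\mapsto(u^2,uv)$, the quotient by $i(u,v)=(-u,-v)$. Let $\widetilde Q$ be a point of $W$, let $\widetilde P$ be a point of $W$ with $3(\widetilde Q-i(\widetilde Q))\sim i(\widetilde P)-\widetilde P$, and let $P$ be the image of $\widetilde P$ on $X$. Let $f\in k(W)$ be a rational function with $\mathrm{div}(f)=i(\widetilde P)+3i(\widetilde Q)-\widetilde P-3\widetilde Q$, let $\lambda\in k$ with $f\cdot i^*(f)=\lambda$, and let $g=\lambda f$. Then the cover of $X$ defined by $$z^3=3\lambda z+\alpha,\qquad \alpha=g+i^*(g)=g+\lambda^3g^{-1}=\lambda(f+\lambda f^{-1})\in k(X),$$ is a Parshin cover of $X$ that ramifies over $P$.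
   Context: A Parshin cover of a smooth curve $X$ is a degree-three cover $Y\to X$ that ramifies fully over one point of $X$ and has no further branch points. *)

theory Defs
  imports "Subresultants.More_Homomorphisms" "HOL-Library.Poly_Mapping"
begin

text \<open>
  A smooth projective curve over an algebraically closed field \<open>'k\<close> is represented by its
  function field: a field type \<open>'f\<close> together with the inclusion \<open>c :: 'k \<Rightarrow> 'f\<close> of the constants.
  A dominant morphism of curves is represented by its comorphism, a homomorphism of
  function fields over \<open>'k\<close> in the opposite direction.
\<close>

definition is_subfield :: "'f::field set \<Rightarrow> bool" where
  "is_subfield S \<longleftrightarrow> 0 \<in> S \<and> 1 \<in> S \<and> (\<forall>a\<in>S. - a \<in> S) \<and> (\<forall>a\<in>S. inverse a \<in> S) \<and>
     (\<forall>a\<in>S. \<forall>b\<in>S. a + b \<in> S \<and> a * b \<in> S)"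

definition generated_subfield :: "'f::field set \<Rightarrow> 'f set" where
  "generated_subfield A = \<Inter> {S. is_subfield S \<and> A \<subseteq> S}"

definition transcendental_over :: "('k::field \<Rightarrow> 'f::field) \<Rightarrow> 'f \<Rightarrow> bool" where
  "transcendental_over c t \<longleftrightarrow> (\<forall>p. poly (map_poly c p) t = 0 \<longrightarrow> p = 0)"

definition finite_over :: "'f::field set \<Rightarrow> bool" where
  "finite_over S \<longleftrightarrow> (\<exists>B. finite B \<and>
     (\<forall>a. \<exists>r. (\<forall>b\<in>B. r b \<in> S) \<and> a = (\<Sum>b\<in>B. r b * b)))"

definition is_curve :: "('k::alg_closed_field \<Rightarrow> 'f::field) \<Rightarrow> bool" where
  "is_curve c \<longleftrightarrow> field_hom c \<and>
     (\<exists>t. transcendental_over c t \<and> finite_over (generated_subfield (insert t (range c))))"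

text \<open>
  \<open>'f\<close> is the fraction field of the coordinate ring \<open>k[x,y]/(G)\<close>. The outer variable of
  \<open>G\<close> is \<open>y\<close>, the inner one is \<open>x\<close>.
\<close>
definition is_plane_curve_model ::
    "('k::alg_closed_field \<Rightarrow> 'f::field) \<Rightarrow> 'k poly poly \<Rightarrow> 'f \<Rightarrow> 'f \<Rightarrow> bool" where
  "is_plane_curve_model c G x y \<longleftrightarrow> field_hom c \<and>
     (\<forall>H. poly (map_poly (\<lambda>p. poly (map_poly c p) x) H) y = 0 \<longleftrightarrow> G dvd H) \<and>
     generated_subfield (insert x (insert y (range c))) = UNIV"

text \<open>
  The points of the curve, each identified with its order-of-vanishing function: the normalised
  discrete valuations of the function field that are trivial on the constants. The order of
  \<open>0\<close> carries no information and is set to \<open>0\<close>, so that distinct points are distinct functions.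
\<close>
definition points :: "('k::alg_closed_field \<Rightarrow> 'f::field) \<Rightarrow> ('f \<Rightarrow> int) set" where
  "points c = {P. P 0 = 0 \<and>
     (\<forall>a b. a \<noteq> 0 \<longrightarrow> b \<noteq> 0 \<longrightarrow> P (a * b) = P a + P b) \<and>
     (\<forall>a b. a \<noteq> 0 \<longrightarrow> b \<noteq> 0 \<longrightarrow> a + b \<noteq> 0 \<longrightarrow> min (P a) (P b) \<le> P (a + b)) \<and>
     (\<forall>a. P (c a) = 0) \<and>
     (\<exists>t. P t = 1)}"

type_synonym 'f divisor = "('f \<Rightarrow> int) \<Rightarrow>\<^sub>0 int"

definition is_divisor :: "('k::alg_closed_field \<Rightarrow> 'f::field) \<Rightarrow> 'f divisor \<Rightarrow> bool" where
  "is_divisor c D \<longleftrightarrow> Poly_Mapping.keys D \<subseteq> points c"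

text \<open>All residue fields are \<open>'k\<close>, so every point has degree one.\<close>
definition divisor_degree :: "'f divisor \<Rightarrow> int" where
  "divisor_degree D = (\<Sum>P\<in>Poly_Mapping.keys D. Poly_Mapping.lookup D P)"

definition has_divisor :: "('k::alg_closed_field \<Rightarrow> 'f::field) \<Rightarrow> 'f \<Rightarrow> 'f divisor \<Rightarrow> bool" where
  "has_divisor c f D \<longleftrightarrow> f \<noteq> 0 \<and> is_divisor c D \<and>
     (\<forall>P\<in>points c. Poly_Mapping.lookup D P = P f)"

definition lin_equiv :: "('k::alg_closed_field \<Rightarrow> 'f::field) \<Rightarrow> 'f divisor \<Rightarrow> 'f divisor \<Rightarrow> bool" where
  "lin_equiv c D E \<longleftrightarrow> (\<exists>f. has_divisor c f (D - E))"

definition riemann_roch_space :: "('k::alg_closed_field \<Rightarrow> 'f::field) \<Rightarrow> 'f divisor \<Rightarrow> 'f set" where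
  "riemann_roch_space c D =
     {f. f = 0 \<or> (\<forall>P\<in>points c. 0 \<le> P f + Poly_Mapping.lookup D P)}"

definition ell :: "('k::alg_closed_field \<Rightarrow> 'f::field) \<Rightarrow> 'f divisor \<Rightarrow> nat" where
  "ell c D = vector_space.dim (\<lambda>a f. c a * f) (riemann_roch_space c D)"

text \<open>The genus of a function field is the maximum of \<open>deg D - \<ell>(D) + 1\<close> over all divisors \<open>D\<close>.\<close>
definition has_genus :: "('k::alg_closed_field \<Rightarrow> 'f::field) \<Rightarrow> nat \<Rightarrow> bool" where
  "has_genus c n \<longleftrightarrow>
     (\<exists>D. is_divisor c D \<and> divisor_degree D - int (ell c D) + 1 = int n) \<and>
     (\<forall>D. is_divisor c D \<longrightarrow> divisor_degree D - int (ell c D) + 1 \<le> int n)"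

definition comorphism ::
    "('k::alg_closed_field \<Rightarrow> 'x::field) \<Rightarrow> ('k \<Rightarrow> 'y::field) \<Rightarrow> ('x \<Rightarrow> 'y) \<Rightarrow> bool" where
  "comorphism cX cY \<phi> \<longleftrightarrow> field_hom \<phi> \<and> (\<forall>a. \<phi> (cX a) = cY a)"

text \<open>
  The order at \<open>i(P)\<close> of a function \<open>h\<close> is the order at \<open>P\<close> of the pullback \<open>h \<circ> i\<close>, for an
  automorphism \<open>i\<close> of a curve with comorphism \<open>\<sigma>\<close>.
\<close>
definition aut_point :: "('f::field \<Rightarrow> 'f) \<Rightarrow> ('f \<Rightarrow> int) \<Rightarrow> 'f \<Rightarrow> int" where
  "aut_point \<sigma> P = P \<circ> \<sigma>"

text \<open>
  \<open>R\<close> maps to \<open>P\<close> if the valuation \<open>R\<close>, restricted along the comorphism, is a positive multiple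
  of \<open>P\<close>; the multiple is the ramification index.
\<close>
definition lies_over :: "('x::field \<Rightarrow> 'y::field) \<Rightarrow> ('y \<Rightarrow> int) \<Rightarrow> ('x \<Rightarrow> int) \<Rightarrow> bool" where
  "lies_over \<phi> R P \<longleftrightarrow> (\<exists>e>0. \<forall>a. R (\<phi> a) = int e * P a)"

definition ram_index :: "('x::field \<Rightarrow> 'y::field) \<Rightarrow> ('y \<Rightarrow> int) \<Rightarrow> ('x \<Rightarrow> int) \<Rightarrow> nat" where
  "ram_index \<phi> R P = (THE e. \<forall>a. R (\<phi> a) = int e * P a)"

text \<open>The library dimension is \<open>0\<close> in the infinite-dimensional case.\<close>
definition cover_degree :: "('x::field \<Rightarrow> 'y::field) \<Rightarrow> nat" where
  "cover_degree \<phi> = vector_space.dim (\<lambda>a b. \<phi> a * b) UNIV"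

definition is_cover ::
    "('k::alg_closed_field \<Rightarrow> 'x::field) \<Rightarrow> ('k \<Rightarrow> 'y::field) \<Rightarrow> ('x \<Rightarrow> 'y) \<Rightarrow> bool" where
  "is_cover cX cY \<phi> \<longleftrightarrow> is_curve cX \<and> is_curve cY \<and> comorphism cX cY \<phi> \<and> 0 < cover_degree \<phi>"

definition branch_point ::
    "('k::alg_closed_field \<Rightarrow> 'x::field) \<Rightarrow> ('k \<Rightarrow> 'y::field) \<Rightarrow> ('x \<Rightarrow> 'y) \<Rightarrow> ('x \<Rightarrow> int) \<Rightarrow> bool" where
  "branch_point cX cY \<phi> P \<longleftrightarrow> P \<in> points cX \<and>
     (\<exists>R\<in>points cY. lies_over \<phi> R P \<and> 1 < ram_index \<phi> R P)"

definition fully_ramified_over ::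
    "('k::alg_closed_field \<Rightarrow> 'x::field) \<Rightarrow> ('k \<Rightarrow> 'y::field) \<Rightarrow> ('x \<Rightarrow> 'y) \<Rightarrow> ('x \<Rightarrow> int) \<Rightarrow> bool" where
  "fully_ramified_over cX cY \<phi> P \<longleftrightarrow> P \<in> points cX \<and>
     (\<exists>R. {R' \<in> points cY. lies_over \<phi> R' P} = {R} \<and> ram_index \<phi> R P = cover_degree \<phi>)"

definition is_parshin_cover ::
    "('k::alg_closed_field \<Rightarrow> 'x::field) \<Rightarrow> ('k \<Rightarrow> 'y::field) \<Rightarrow> ('x \<Rightarrow> 'y) \<Rightarrow> bool" where
  "is_parshin_cover cX cY \<phi> \<longleftrightarrow> is_cover cX cY \<phi> \<and> cover_degree \<phi> = 3 \<and>
     (\<exists>P. fully_ramified_over cX cY \<phi> P \<and> (\<forall>P'. branch_point cX cY \<phi> P' \<longrightarrow> P' = P))"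

text \<open>
  \<open>'y\<close> is obtained from \<open>'x\<close> by adjoining a root \<open>z\<close> of \<open>F\<close>; for irreducible \<open>F\<close> it is
  isomorphic to the quotient of the polynomial ring over \<open>'x\<close> by \<open>F\<close>.
\<close>
definition adjoins_root :: "('x::field \<Rightarrow> 'y::field) \<Rightarrow> 'x poly \<Rightarrow> 'y \<Rightarrow> bool" where
  "adjoins_root \<phi> F z \<longleftrightarrow> field_hom \<phi> \<and> poly (map_poly \<phi> F) z = 0 \<and>
     generated_subfield (insert z (range \<phi>)) = UNIV"

end

theory Submission
  imports Defs
begin

text \<open>
  Over \<open>W\<close> Cardano's formula \<open>z = s + \<lambda>/s\<close>, \<open>s\<^sup>3 = g\<close>, solves the cubic, so the ramification of the cover is
  governed by the divisor of \<open>g\<close> modulo \<open>3\<close>. Genus two forces \<open>a\<^sub>0 \<noteq> 0\<close>, since otherwise \<open>X\<close> has the equation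
  \<open>(y/x)\<^sup>2 = cubic(x)\<close> and Riemann's inequality bounds its genus by one. Hence \<open>x\<close> has even order everywhere,
  \<open>u = \<surd>x\<close> lies in the completion of \<open>k(X)\<close> at every point \<open>T\<close>, and \<open>W \<rightarrow> X\<close> is etale.
  At \<open>T \<noteq> P\<close> the order of \<open>g\<close> above \<open>T\<close> is divisible by \<open>3\<close>, so \<open>g\<close> is a cube in the completion and all three
  roots of the cubic lie there: the cover is unramified. At \<open>P\<close> the order of \<open>\<alpha>\<close> is negative and prime to \<open>3\<close>,
  so the norm of \<open>a + b z + c z\<^sup>2\<close> is dominated by exactly one of \<open>a\<^sup>3\<close>, \<open>b\<^sup>3 \<alpha>\<close>, \<open>c\<^sup>3 \<alpha>\<^sup>2\<close>; this yields the
  irreducibility of the cubic and the unique, totally ramified point above \<open>P\<close>.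
\<close>

section \<open>Valuations at a point\<close>

text \<open>No completion is ever formed: its elements appear as Cauchy sequences in k(X), or as one
  approximation of sufficient precision. Newton iteration inside k(X) requires that every residue
  field be k. Points are bare valuations, so this is derived from [K : k(t)] \<le> 2, in the form
  that any three functions satisfy a linear relation over k[t]. Splitting of the cubic excludes
  ramification for this reason: if z is approximated arbitrarily well by functions on X, so is every
  function on Y, and a uniformizer of Y then has the same order as some function pulled back from X,
  which is a multiple of the ramification index. The factor in \<open>g = cW l * f\<close> makes the
  product of \<open>g\<close> and \<open>\<sigma> g\<close> the cube of \<open>cW l\<close>. Cube
  roots of the two can then be chosen with product \<lambda>, as Cardano's formula for z^3 = 3
  \<lambda> z + \<alpha> demands.\<close>

definition vge :: "('f::field \<Rightarrow> int) \<Rightarrow> int \<Rightarrow> 'f \<Rightarrow> bool" where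
  "vge P n a \<longleftrightarrow> a = 0 \<or> n \<le> P a"

locale curve_point =
  fixes c :: "'k::alg_closed_field \<Rightarrow> 'f::field" and P :: "'f \<Rightarrow> int"
  assumes hom: "field_hom c" and point: "P \<in> points c"
begin

sublocale c: field_hom c by (rule hom)
sublocale mp: map_poly_inj_idom_hom c ..

lemma const_of_nat [simp]: "c (of_nat n) = of_nat n"
  by (induction n) (simp_all add: c.hom_add)

lemma val_0 [simp]: "P 0 = 0"
  and val_mult: "a \<noteq> 0 \<Longrightarrow> b \<noteq> 0 \<Longrightarrow> P (a * b) = P a + P b"
  and val_add: "a \<noteq> 0 \<Longrightarrow> b \<noteq> 0 \<Longrightarrow> a + b \<noteq> 0 \<Longrightarrow> min (P a) (P b) \<le> P (a + b)"
  and val_const [simp]: "P (c r) = 0"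
  using point by (auto simp: points_def)

lemma uniformizer: obtains t where "P t = 1" "t \<noteq> 0"
proof -
  obtain t where "P t = 1" using point by (auto simp: points_def)
  then show ?thesis using that[of t] by (cases "t = 0") auto
qed

lemma val_1 [simp]: "P 1 = 0"
  using val_const[of 1] by simp

lemma val_uminus [simp]: "P (- a) = P a"
proof (cases "a = 0")
  case False
  have "P (-1) = 0" using val_const[of "-1"] by (simp add: c.hom_uminus)
  then show ?thesis using val_mult[of "-1" a] False by simp
qed auto

lemma val_power: "a \<noteq> 0 \<Longrightarrow> P (a ^ n) = int n * P a"
  by (induction n) (auto simp: val_mult algebra_simps)

lemma val_inverse [simp]: "P (inverse a) = - P a"
proof (cases "a = 0")
  case False
  then show ?thesis using val_mult[of a "inverse a"] by simp
qed auto

lemma val_divide: "a \<noteq> 0 \<Longrightarrow> b \<noteq> 0 \<Longrightarrow> P (a / b) = P a - P b"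
  by (simp add: divide_inverse val_mult)

lemma val_power_int: "a \<noteq> 0 \<Longrightarrow> P (a powi n) = n * P a"
  by (cases n rule: int_cases4) (auto simp: val_power power_int_minus)

lemma exists_val: obtains t where "P t = n" "t \<noteq> 0"
proof -
  obtain t where "P t = 1" "t \<noteq> 0" by (rule uniformizer)
  then show ?thesis using that[of "t powi n"] by (simp add: val_power_int)
qed

lemma vge_0 [simp]: "vge P n 0"
  and vge_self [simp]: "vge P (P a) a"
  and vge_mono: "vge P n a \<Longrightarrow> m \<le> n \<Longrightarrow> vge P m a"
  and vge_const [simp]: "vge P 0 (c r)"
  by (auto simp: vge_def)

lemma vge_1 [simp]: "vge P 0 1"
  by (simp add: vge_def)

text \<open>Points give the zero function order 0, so the plain condition \<open>n \<le> P a\<close>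
  would break when a sum cancels. The disjunct \<open>a = 0\<close> in \<open>vge\<close> stands for
  infinite order.\<close>

lemma vge_add: "vge P n a \<Longrightarrow> vge P n b \<Longrightarrow> vge P n (a + b)"
  using val_add[of a b] by (cases "a = 0"; cases "b = 0"; cases "a + b = 0") (auto simp: vge_def)

lemma vge_uminus [simp]: "vge P n (- a) = vge P n a"
  by (simp add: vge_def)

lemma vge_diff: "vge P n a \<Longrightarrow> vge P n b \<Longrightarrow> vge P n (a - b)"
  using vge_add[of n a "- b"] by simp

lemma vge_mult: "vge P n a \<Longrightarrow> vge P m b \<Longrightarrow> vge P (n + m) (a * b)"
  by (cases "a = 0 \<or> b = 0") (auto simp: vge_def val_mult)

lemma vge_mult_le: "vge P n a \<Longrightarrow> vge P m b \<Longrightarrow> k \<le> n + m \<Longrightarrow> vge P k (a * b)"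
  using vge_mult vge_mono by blast

lemma vge_power: "vge P n a \<Longrightarrow> vge P (int k * n) (a ^ k)"
  by (induction k) (auto simp: algebra_simps intro: vge_mult)

lemma vge_sum: "(\<And>i. i \<in> A \<Longrightarrow> vge P n (h i)) \<Longrightarrow> vge P n (sum h A)"
  by (induction A rule: infinite_finite_induct) (auto intro: vge_add)

text \<open>The reverse inequality comes from writing \<open>a\<close> as
  \<open>(a + b) - b\<close>. Strictness takes the form \<open>+ 1\<close> because orders are
  integers.\<close>

lemma val_add_eq:
  assumes "a \<noteq> 0" "vge P (P a + 1) b"
  shows "a + b \<noteq> 0" "P (a + b) = P a"
proof -
  show nz: "a + b \<noteq> 0"
  proof
    assume "a + b = 0"
    then have "b = - a" by (simp add: eq_neg_iff_add_eq_0 add.commute)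
    then show False using assms by (simp add: vge_def)
  qed
  show "P (a + b) = P a"
  proof (cases "b = 0")
    case False
    then have b: "P b > P a" using assms by (simp add: vge_def)
    have "P (a + b) \<ge> P a" using val_add[of a b] nz False assms b by auto
    moreover have "P a \<ge> min (P (a + b)) (P b)"
      using val_add[of "a + b" "- b"] nz False assms by auto
    ultimately show ?thesis using b by auto
  qed auto
qed

lemma val_eqI: "a \<noteq> 0 \<Longrightarrow> vge P (P a + 1) (b - a) \<Longrightarrow> b \<noteq> 0 \<and> P b = P a"
  using val_add_eq[of a "b - a"] by simp

text \<open>A dominating term cannot be cancelled; linear relations are refuted this way in
  \<open>finite_value_exists\<close> and \<open>sum_zeros_le_two\<close>.\<close>

lemma sum_unique_min:
  assumes "finite A" "i \<in> A" "h i \<noteq> 0" "\<And>j. j \<in> A \<Longrightarrow> j \<noteq> i \<Longrightarrow> vge P (P (h i) + 1) (h j)"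
  shows "sum h A \<noteq> 0" "P (sum h A) = P (h i)"
proof -
  have "vge P (P (h i) + 1) (sum h (A - {i}))"
    using assms by (intro vge_sum) auto
  moreover have "sum h A = h i + sum h (A - {i})"
    using assms by (simp add: sum.remove)
  ultimately show "sum h A \<noteq> 0" "P (sum h A) = P (h i)"
    using val_add_eq[of "h i" "sum h (A - {i})"] assms by auto
qed

lemma vge_poly: "vge P 0 t \<Longrightarrow> vge P 0 (poly (map_poly c p) t)"
  by (induction p) (auto simp: c.map_poly_pCons_hom intro!: vge_add vge_mult_le)

lemma vge_poly_sub_coeff_0: 
  assumes "vge P 1 t"
  shows "vge P 1 (poly (map_poly c p) t - c (coeff p 0))"
proof (cases p)
  case (pCons a q)
  have "vge P 1 (t * poly (map_poly c q) t)"
    using assms by (intro vge_mult_le[OF assms vge_poly]) (auto intro: vge_mono)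
  then show ?thesis using pCons by (simp add: c.map_poly_pCons_hom)
qed

lemma val_poly_unit:
  assumes "vge P 1 t" "coeff p 0 \<noteq> 0"
  shows "poly (map_poly c p) t \<noteq> 0" "P (poly (map_poly c p) t) = 0"
  using val_eqI[of "c (coeff p 0)" "poly (map_poly c p) t"] vge_poly_sub_coeff_0[OF assms(1), of p] assms(2)
  by auto

text \<open>Horner's scheme: at a pole of \<open>t\<close>, the product of \<open>t\<close> with a
  nonzero polynomial value has a pole again, which a constant cannot cancel.\<close>

lemma val_poly_pole:
  assumes "p \<noteq> 0" "P t < 0"
  shows "P (poly (map_poly c p) t) = int (degree p) * P t \<and> poly (map_poly c p) t \<noteq> 0"
  using assms(1)
proof (induction p)
  case (pCons a p)
  have t: "t \<noteq> 0" using assms by auto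
  show ?case
  proof (cases "p = 0")
    case False
    let ?h = "t * poly (map_poly c p) t"
    have h: "?h \<noteq> 0" "P ?h = int (Suc (degree p)) * P t"
      using pCons False t by (auto simp: val_mult algebra_simps)
    moreover have "int (Suc (degree p)) * P t < 0" using assms by (intro mult_pos_neg) auto
    ultimately have "vge P (P ?h + 1) (c a)" by (simp add: vge_def)
    from val_add_eq[OF h(1) this] h(2) False show ?thesis
      by (simp add: c.map_poly_pCons_hom add.commute)
  qed (use pCons in \<open>auto simp: c.map_poly_pCons_hom\<close>)
qed simp

lemma poly_split:
  fixes p :: "'k poly"
  assumes "p \<noteq> 0"
  obtains A where "poly (map_poly c p) h = c (lead_coeff p) * (\<Prod>a\<in>#A. h - c a)"
proof -
  obtain A where A: "p = Polynomial.smult (lead_coeff p) (\<Prod>x\<in>#A. [:-x, 1:])"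
    using alg_closed_imp_factorization[OF assms] by blast
  have "poly (map_poly c (\<Prod>x\<in>#A. [:-x, 1:])) h = (\<Prod>a\<in>#A. h - c a)"
  proof (induction A)
    case (add a A)
    have "poly (map_poly c ([:-a, 1:] * (\<Prod>x\<in>#A. [:-x, 1:]))) h = (h - c a) * (\<Prod>a\<in>#A. h - c a)"
      unfolding mp.hom_mult poly_mult add by (simp add: c.map_poly_pCons_hom c.hom_uminus)
    then show ?case by simp
  qed auto
  then have "poly (map_poly c p) h = c (lead_coeff p) * (\<Prod>a\<in>#A. h - c a)"
    by (subst A) (simp add: c.map_poly_hom_smult)
  then show ?thesis by (rule that)
qed

text \<open>The polynomial splits over k, and a product of factors \<open>h - c a\<close> vanishes
  at the point only if one factor does.\<close>

lemma residue_root: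
  fixes p :: "'k poly"
  assumes "p \<noteq> 0" "vge P 1 (poly (map_poly c p) h)"
  shows "\<exists>a. vge P 1 (h - c a)"
proof (rule ccontr)
  assume neg: "\<nexists>a. vge P 1 (h - c a)"
  obtain A where A: "poly (map_poly c p) h = c (lead_coeff p) * (\<Prod>a\<in>#A. h - c a)"
    by (rule poly_split[OF assms(1)])
  have "(\<Prod>a\<in>#A. h - c a) \<noteq> 0 \<and> P (\<Prod>a\<in>#A. h - c a) \<le> 0"
  proof (induction A)
    case (add a A)
    then show ?case using neg by (auto simp: vge_def val_mult) (smt (verit, best))
  qed auto
  then show False using A assms by (auto simp: vge_def val_mult)
qed

end

section \<open>Subfields and function fields of degree two over a rational one\<close>

abbreviation ev :: "('k::field \<Rightarrow> 'f::field) \<Rightarrow> 'k poly \<Rightarrow> 'f \<Rightarrow> 'f" where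
  "ev c p t \<equiv> poly (map_poly c p) t"

lemma is_subfield_generated: "is_subfield (generated_subfield A)"
  unfolding generated_subfield_def is_subfield_def by blast

lemma generated_subfield_superset: "A \<subseteq> generated_subfield A"
  unfolding generated_subfield_def by blast

lemma generated_subfield_minimal: "is_subfield S \<Longrightarrow> A \<subseteq> S \<Longrightarrow> generated_subfield A \<subseteq> S"
  unfolding generated_subfield_def by blast

lemma is_subfieldD:
  assumes "is_subfield S"
  shows "0 \<in> S" "1 \<in> S" "a \<in> S \<Longrightarrow> - a \<in> S" "a \<in> S \<Longrightarrow> inverse a \<in> S"
    "a \<in> S \<Longrightarrow> b \<in> S \<Longrightarrow> a + b \<in> S" "a \<in> S \<Longrightarrow> b \<in> S \<Longrightarrow> a * b \<in> S"
    "a \<in> S \<Longrightarrow> b \<in> S \<Longrightarrow> a - b \<in> S" "a \<in> S \<Longrightarrow> b \<in> S \<Longrightarrow> a / b \<in> S"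
  using assms unfolding is_subfield_def
  by (auto simp: divide_inverse) (metis add_uminus_conv_diff)

lemma is_subfield_range:
  assumes "field_hom \<phi>"
  shows "is_subfield (range \<phi>)"
proof -
  interpret field_hom \<phi> by fact
  show ?thesis
    unfolding is_subfield_def
    by (auto simp flip: hom_add hom_mult hom_uminus hom_inverse)
qed

text \<open>Inverses come from rationalising the denominator. Since \<open>w\<close> may already lie
  in \<open>S\<close>, the norm can vanish although the element does not; in that case the element
  itself lies in \<open>S\<close>.\<close>

lemma is_subfield_adjoin_sqrt:
  fixes w :: "'f::field"
  assumes S: "is_subfield S" and w: "w\<^sup>2 \<in> S"
  shows "is_subfield {a + b * w | a b. a \<in> S \<and> b \<in> S}" (is "is_subfield ?T")
proof -
  note S' = is_subfieldD[OF S]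
  have I: "h \<in> ?T" if "h = a + b * w" "a \<in> S" "b \<in> S" for h a b using that by blast
  have inv: "inverse (a + b * w) \<in> ?T" if ab: "a \<in> S" "b \<in> S" for a b
  proof (cases "a\<^sup>2 - b\<^sup>2 * w\<^sup>2 = 0")
    case True
    have "a + b * w \<in> S"
    proof (cases "b = 0")
      case False
      from True have "(a - b * w) * (a + b * w) = 0" by (simp add: algebra_simps power2_eq_square)
      then have "b * w = a \<or> b * w = - a" by (auto simp: eq_neg_iff_add_eq_0 add.commute)
      then have "w = a / b \<or> w = - (a / b)" using False
        by (metis minus_divide_left nonzero_mult_div_cancel_left)
      then have "w \<in> S" using S'(3,8) ab by metis
      then show ?thesis using ab by (intro S'(5,6))
    qed (use ab in auto)
    then have "inverse (a + b * w) \<in> S" by (rule S'(4))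
    then show ?thesis by (intro I[of _ "inverse (a + b * w)" 0]) (auto simp: S'(1))
  next
    case False
    have mem: "a\<^sup>2 - b\<^sup>2 * w\<^sup>2 \<in> S"
      using S'(6,7) ab w by (metis power2_eq_square)
    have "(a + b * w) * (a - b * w) = a\<^sup>2 - b\<^sup>2 * w\<^sup>2" by (simp add: algebra_simps power2_eq_square)
    then have "inverse (a + b * w) = (a - b * w) / (a\<^sup>2 - b\<^sup>2 * w\<^sup>2)"
      using False by (metis inverse_unique mult_1_right nonzero_mult_div_cancel_left times_divide_eq_right divide_self_if)
    also have "\<dots> = a / (a\<^sup>2 - b\<^sup>2 * w\<^sup>2) + (- b / (a\<^sup>2 - b\<^sup>2 * w\<^sup>2)) * w"
      by (simp add: diff_divide_distrib)
    finally show ?thesis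
      by (rule I) (use mem ab S'(3,8) in blast)+
  qed
  show ?thesis
    unfolding is_subfield_def
  proof (intro conjI ballI)
    show "0 \<in> ?T" by (rule I[of _ 0 0]) (auto simp: S'(1))
    show "1 \<in> ?T" by (rule I[of _ 1 0]) (auto simp: S'(1,2))
  next
    fix h assume "h \<in> ?T"
    then obtain a b where h: "h = a + b * w" "a \<in> S" "b \<in> S" by blast
    show "- h \<in> ?T" by (rule I[of _ "- a" "- b"]) (auto simp: h S'(3))
    show "inverse h \<in> ?T" using inv h by simp
    fix h' assume "h' \<in> ?T"
    then obtain a' b' where h': "h' = a' + b' * w" "a' \<in> S" "b' \<in> S" by blast
    show "h + h' \<in> ?T"
      by (rule I[of _ "a + a'" "b + b'"]) (auto simp: h h' S'(5) algebra_simps)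
    show "h * h' \<in> ?T"
      by (rule I[of _ "a * a' + b * b' * w\<^sup>2" "a * b' + b * a'"])
        ((simp add: h h' algebra_simps power2_eq_square; fail) | (use h h' w in \<open>intro S'(5,6)\<close>))+
  qed
qed

text \<open>This is k(t) in explicit form: unlike an intersection of subfields, quotients allow
  denominators to be cleared.\<close>

definition rational_values :: "('k::field \<Rightarrow> 'f::field) \<Rightarrow> 'f \<Rightarrow> 'f set" where
  "rational_values c t = {ev c p t / ev c q t | p q. ev c q t \<noteq> 0}"

lemma is_subfield_rational_values:
  assumes "field_hom c"
  shows "is_subfield (rational_values c t)" "t \<in> rational_values c t" "range c \<subseteq> rational_values c t"
proof -
  interpret c: field_hom c by fact
  interpret mp: map_poly_inj_idom_hom c ..
  have I: "h \<in> rational_values c t" if "h = ev c p t / ev c q t" "ev c q t \<noteq> 0" for h p q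
    using that unfolding rational_values_def by blast
  have C: "c r \<in> rational_values c t" for r
    by (rule I[of _ "[:r:]" 1]) (auto simp: c.map_poly_pCons_hom)
  then show "range c \<subseteq> rational_values c t" by blast
  show "t \<in> rational_values c t"
    by (rule I[of _ "[:0, 1:]" 1]) (auto simp: c.map_poly_pCons_hom)
  show "is_subfield (rational_values c t)"
    unfolding is_subfield_def
  proof (intro conjI ballI)
    show "0 \<in> rational_values c t" "1 \<in> rational_values c t" using C[of 0] C[of 1] by auto
  next
    fix h assume "h \<in> rational_values c t"
    then obtain p q where h: "h = ev c p t / ev c q t" "ev c q t \<noteq> 0"
      unfolding rational_values_def by blast
    show "- h \<in> rational_values c t" by (rule I[of _ "- p" q]) (auto simp: h mp.hom_uminus)
    show "inverse h \<in> rational_values c t"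
      using C[of 0] I[of "inverse h" q p] h by (cases "ev c p t = 0") auto
    fix h' assume "h' \<in> rational_values c t"
    then obtain p' q' where h': "h' = ev c p' t / ev c q' t" "ev c q' t \<noteq> 0"
      unfolding rational_values_def by blast
    show "h + h' \<in> rational_values c t"
      by (rule I[of _ "p * q' + p' * q" "q * q'"])
        (use h h' in \<open>auto simp: mp.hom_mult mp.hom_add add_frac_eq\<close>)
    show "h * h' \<in> rational_values c t"
      by (rule I[of _ "p * p'" "q * q'"]) (use h h' in \<open>auto simp: mp.hom_mult\<close>)
  qed
qed

text \<open>Any three elements are linearly dependent over \<open>k[t]\<close>, that is \<open>[K : k(t)] \<le> 2\<close>.\<close>
definition rank_le_two :: "('k::field \<Rightarrow> 'f::field) \<Rightarrow> 'f \<Rightarrow> bool" where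
  "rank_le_two c t \<longleftrightarrow>
     (\<forall>h::nat \<Rightarrow> 'f. \<exists>p. (\<exists>i<3. p i \<noteq> 0) \<and> (\<Sum>i<3. ev c (p i) t * h i) = 0)"

lemma sum_lessThan_3: "(\<Sum>i<3. f i) = f 0 + f 1 + f (2::nat)"
  by (simp add: numeral_3_eq_3 numeral_2_eq_2)

lemma ex_less_3: "(\<exists>i<3. Q i) \<longleftrightarrow> Q 0 \<or> Q 1 \<or> Q (2::nat)"
  unfolding numeral_3_eq_3 numeral_2_eq_2 One_nat_def Ex_less_Suc by auto

text \<open>Three vectors in a plane are dependent: division by \<open>h 0\<close> turns the first
  into 1, then \<open>w\<close> is eliminated from the other two, and multiplying by the
  denominators brings the coefficients into k[t].\<close>

lemma rank_le_twoI:
  fixes c :: "'k::field \<Rightarrow> 'f::field"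
  assumes hom: "field_hom c"
    and span: "\<And>h. \<exists>a\<in>rational_values c t. \<exists>b\<in>rational_values c t. h = a + b * w"
  shows "rank_le_two c t"
  unfolding rank_le_two_def
proof
  fix h :: "nat \<Rightarrow> 'f"
  interpret c: field_hom c by fact
  interpret mp: map_poly_inj_idom_hom c ..
  let ?S = "rational_values c t"
  note S = is_subfieldD[OF is_subfield_rational_values(1)[OF hom, of t]]
  have "\<exists>s0 s1 s2. s0 \<in> ?S \<and> s1 \<in> ?S \<and> s2 \<in> ?S \<and> (s0 \<noteq> 0 \<or> s1 \<noteq> 0 \<or> s2 \<noteq> 0) \<and>
    s0 * h 0 + s1 * h 1 + s2 * h 2 = 0"
  proof (cases "h 0 = 0")
    case True
    then show ?thesis using S(1,2) by (intro exI[of _ 1] exI[of _ 0]) simp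
  next
    case False
    obtain a1 b1 where 1: "a1 \<in> ?S" "b1 \<in> ?S" "h 1 / h 0 = a1 + b1 * w" using span by blast
    obtain a2 b2 where 2: "a2 \<in> ?S" "b2 \<in> ?S" "h 2 / h 0 = a2 + b2 * w" using span by blast
    have h: "h 1 = (a1 + b1 * w) * h 0" "h 2 = (a2 + b2 * w) * h 0"
      using 1 2 False by (auto simp: field_simps)
    show ?thesis
    proof (cases "b1 = 0")
      case True
      then show ?thesis using S(1,2) S(3)[OF 1(1)] h
        by (intro exI[of _ "- a1"] exI[of _ 1] exI[of _ 0]) simp
    next
      case b1: False
      have "(b1 * a2 - b2 * a1) * h 0 + b2 * h 1 + (- b1) * h 2 = 0"
        unfolding h by (simp add: algebra_simps)
      moreover have "b1 * a2 - b2 * a1 \<in> ?S" "- b1 \<in> ?S" using 1 2 by (auto intro!: S(3,6,7))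
      ultimately show ?thesis using 2(2) b1
        by (intro exI[of _ "b1 * a2 - b2 * a1"] exI[of _ b2] exI[of _ "- b1"]) simp
    qed
  qed
  then obtain s0 s1 s2 where s: "s0 \<in> ?S" "s1 \<in> ?S" "s2 \<in> ?S" "s0 \<noteq> 0 \<or> s1 \<noteq> 0 \<or> s2 \<noteq> 0"
    "s0 * h 0 + s1 * h 1 + s2 * h 2 = 0" by auto
  then obtain p0 q0 p1 q1 p2 q2 where pq: "s0 = ev c p0 t / ev c q0 t" "ev c q0 t \<noteq> 0"
    "s1 = ev c p1 t / ev c q1 t" "ev c q1 t \<noteq> 0" "s2 = ev c p2 t / ev c q2 t" "ev c q2 t \<noteq> 0"
    unfolding rational_values_def by blast
  define p where "p i = (if i = 0 then p0 * q1 * q2 else if i = 1 then p1 * q0 * q2 else p2 * q0 * q1)" for i :: nat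
  have s_mult: "ev c p0 t = s0 * ev c q0 t" "ev c p1 t = s1 * ev c q1 t" "ev c p2 t = s2 * ev c q2 t"
    using pq by auto
  have "(\<Sum>i<3. ev c (p i) t * h i) = ev c q0 t * ev c q1 t * ev c q2 t * (s0 * h 0 + s1 * h 1 + s2 * h 2)"
    by (simp add: sum_lessThan_3 p_def mp.hom_mult s_mult algebra_simps)
  then have "(\<Sum>i<3. ev c (p i) t * h i) = 0" using s by simp
  moreover have "p 0 \<noteq> 0 \<or> p 1 \<noteq> 0 \<or> p 2 \<noteq> 0" using s(4) pq by (auto simp: p_def)
  then have "\<exists>i<3. p i \<noteq> 0" by (simp add: ex_less_3)
  ultimately show "\<exists>p. (\<exists>i<3. p i \<noteq> 0) \<and> (\<Sum>i<3. ev c (p i) t * h i) = 0" by (intro exI[of _ p]) simp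
qed

text \<open>A relation whose coefficients all vanish at 0 can be divided by \<open>t\<close>, so one
  of least total degree is primitive. Only a primitive relation stays nontrivial when reduced modulo
  \<open>t\<close>.\<close>

lemma rank_le_two_primitive:
  assumes hom: "field_hom c" and r: "rank_le_two c t" and t: "t \<noteq> 0"
  obtains p where "\<exists>i<3. coeff (p i) 0 \<noteq> 0" "(\<Sum>i<3::nat. ev c (p i) t * h i) = 0"
proof -
  interpret c: field_hom c by fact
  define R where "R p \<longleftrightarrow> (\<exists>i<3. p i \<noteq> 0) \<and> (\<Sum>i<3::nat. ev c (p i) t * h i) = 0" for p
  define d where "d p = (\<Sum>i<3::nat. degree (p i))" for p :: "nat \<Rightarrow> 'a poly"
  obtain p0 where "R p0" using r[unfolded rank_le_two_def, rule_format, of h] unfolding R_def by auto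
  then obtain p where p: "R p" "\<And>q. R q \<Longrightarrow> d p \<le> d q"
    using ex_has_least_nat[of R p0 d] by auto
  have "\<exists>i<3. coeff (p i) 0 \<noteq> 0"
  proof (rule ccontr)
    assume neg: "\<not> (\<exists>i<3. coeff (p i) 0 \<noteq> 0)"
    have "\<exists>q. i < 3 \<longrightarrow> p i = pCons 0 q" for i
      using neg by (cases "p i") auto
    then have "\<forall>i. \<exists>q. i < 3 \<longrightarrow> p i = pCons 0 q" ..
    from choice[OF this] obtain q where q: "\<And>i. i < 3 \<Longrightarrow> p i = pCons 0 (q i)" by auto
    have "(\<Sum>i<3. ev c (p i) t * h i) = t * (\<Sum>i<3. ev c (q i) t * h i)"
      unfolding sum_distrib_left by (rule sum.cong) (auto simp: q c.map_poly_pCons_hom)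
    then have "R q" using p(1) t q unfolding R_def by auto
    moreover have "d q < d p"
    proof -
      obtain i where i: "i < 3" "p i \<noteq> 0" using p(1) unfolding R_def by auto
      show ?thesis unfolding d_def
        by (rule sum_strict_mono_ex1) (use i q in \<open>auto simp: degree_pCons_eq_if\<close>)
    qed
    ultimately show False using p(2)[of q] by simp
  qed
  then show ?thesis by (rule that) (use p(1) R_def in auto)
qed

section \<open>Residues at a point are constants\<close>

context curve_point
begin

text \<open>Modulo \<open>t\<close>, the relation among 1, \<open>h\<close>, \<open>h ^ 2\<close>
  becomes a nonzero polynomial over k that vanishes at the residue of \<open>h\<close>; as k is
  algebraically closed, this residue is a constant.\<close>

lemma residue_exists:
  assumes r: "rank_le_two c t" and t: "vge P 1 t" "t \<noteq> 0" and h: "vge P 0 h"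
  shows "\<exists>a. vge P 1 (h - c a)"
proof -
  obtain p where p: "\<exists>i<3. coeff (p i) 0 \<noteq> 0" "(\<Sum>i<3::nat. ev c (p i) t * h ^ i) = 0"
    by (rule rank_le_two_primitive[OF hom r t(2), of "\<lambda>i. h ^ i"])
  define q where "q = [:coeff (p 0) 0, coeff (p 1) 0, coeff (p 2) 0:]"
  have "q \<noteq> 0" using p(1) by (simp add: q_def ex_less_3)
  moreover have "vge P 1 (\<Sum>i<3. (ev c (p i) t - c (coeff (p i) 0)) * h ^ i)"
    using vge_power[OF h] by (intro vge_sum vge_mult_le[OF vge_poly_sub_coeff_0[OF t(1)]]) auto
  moreover have "(\<Sum>i<3. (ev c (p i) t - c (coeff (p i) 0)) * h ^ i) = - ev c q h"
  proof -
    have "ev c q h = (\<Sum>i<3. c (coeff (p i) 0) * h ^ i)"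
      by (simp add: q_def sum_lessThan_3 c.map_poly_pCons_hom algebra_simps power2_eq_square)
    then show ?thesis using p(2) by (simp add: left_diff_distrib sum_subtractf)
  qed
  ultimately show ?thesis using residue_root[of q h] by simp
qed

text \<open>If the residue of \<open>x\<close> were not a constant, every nonzero polynomial in
  \<open>x\<close> would be a unit at \<open>P\<close>. For a uniformizer \<open>t\<close>, the
  functions 1, \<open>t\<close>, \<open>t ^ 2\<close> would then keep distinct orders under nonzero
  coefficients and be independent over k[x].\<close>

lemma finite_value_exists:
  assumes r: "rank_le_two c x" and x: "vge P 0 x"
  shows "\<exists>a. vge P 1 (x - c a)"
proof (rule ccontr)
  assume neg: "\<nexists>a. vge P 1 (x - c a)"
  have pv: "P (ev c p x) = 0 \<and> ev c p x \<noteq> 0" if nz: "p \<noteq> 0" for p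
  proof -
    obtain A where A: "ev c p x = c (lead_coeff p) * (\<Prod>a\<in>#A. x - c a)"
      by (rule poly_split[OF nz])
    have "P (x - c a) = 0 \<and> x - c a \<noteq> 0" for a
    proof -
      have "\<not> vge P 1 (x - c a)" using neg by blast
      moreover have "vge P 0 (x - c a)" using x by (intro vge_diff) auto
      ultimately show ?thesis by (auto simp: vge_def)
    qed
    then have "P (\<Prod>a\<in>#A. x - c a) = 0 \<and> (\<Prod>a\<in>#A. x - c a) \<noteq> 0"
      by (induction A) (auto simp: val_mult)
    then show ?thesis using A nz by (simp add: val_mult)
  qed
  obtain t where t: "P t = 1" "t \<noteq> 0" by (rule uniformizer)
  obtain p where p: "\<exists>i<3. p i \<noteq> 0" "(\<Sum>i<3::nat. ev c (p i) x * t ^ i) = 0"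
    using r[unfolded rank_le_two_def, rule_format, of "\<lambda>i. t ^ i"] by auto
  define A where "A = {i. i < 3 \<and> p i \<noteq> 0}"
  have A: "finite A" "A \<noteq> {}" using p(1) by (auto simp: A_def)
  have v: "P (ev c (p i) x * t ^ i) = int i" if "i \<in> A" for i
    using pv[of "p i"] that t by (simp add: A_def val_mult val_power)
  have "(\<Sum>i\<in>A. ev c (p i) x * t ^ i) \<noteq> 0"
  proof (rule sum_unique_min(1)[where i = "Min A"])
    show "finite A" "Min A \<in> A" using A by auto
    then show "ev c (p (Min A)) x * t ^ Min A \<noteq> 0" using pv t by (auto simp: A_def)
    fix j assume j: "j \<in> A" "j \<noteq> Min A"
    then have "Min A < j" using A by (simp add: le_neq_implies_less)
    then show "vge P (P (ev c (p (Min A)) x * t ^ Min A) + 1) (ev c (p j) x * t ^ j)"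
      using v[OF \<open>Min A \<in> A\<close>] v[OF j(1)] by (simp add: vge_def)
  qed
  moreover have "(\<Sum>i\<in>A. ev c (p i) x * t ^ i) = (\<Sum>i<3. ev c (p i) x * t ^ i)"
    by (rule sum.mono_neutral_left) (auto simp: A_def)
  ultimately show False using p(2) by simp
qed

end

section \<open>Weak approximation\<close>

lemma (in curve_point) vge_poly_coeff_0:
  assumes "coeff p 0 = 0" "vge P 0 t"
  shows "vge P (P t) (ev c p t)"
proof (cases p)
  case (pCons a q)
  then show ?thesis
    using assms vge_mult[OF vge_self[of t] vge_poly[OF assms(2), of q]] by (simp add: c.map_poly_pCons_hom)
qed

text \<open>An inclusion of valuation rings carries units to units, so one valuation is a multiple
  of the other; both are normalised, hence equal.\<close>

lemma valuation_ring_not_subset: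
  assumes hom: "field_hom c" and S: "S \<in> points c" and S': "S' \<in> points c" and ne: "S \<noteq> S'"
  shows "\<exists>a. a \<noteq> 0 \<and> 0 \<le> S a \<and> S' a < 0"
proof (rule ccontr)
  assume "\<not> ?thesis"
  then have sub: "0 \<le> S' a" if "a \<noteq> 0" "0 \<le> S a" for a using that by force
  interpret S: curve_point c S by (rule curve_point.intro) (fact hom S)+
  interpret S': curve_point c S' by (rule curve_point.intro) (fact hom S')+
  have unit: "S' a = 0" if "a \<noteq> 0" "S a = 0" for a
    using sub[of a] sub[of "inverse a"] that by simp
  obtain t where t: "S t = 1" "t \<noteq> 0" by (rule S.uniformizer)
  obtain t' where t': "S' t' = 1" "t' \<noteq> 0" by (rule S'.uniformizer)
  have eq: "S' a = S a * S' t" if "a \<noteq> 0" for a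
  proof -
    have "S (a / t powi S a) = 0" using that t by (simp add: S.val_divide S.val_power_int)
    then have "S' (a / t powi S a) = 0" using that t by (intro unit) auto
    then show ?thesis using that t by (simp add: S'.val_divide S'.val_power_int)
  qed
  have "S t' * S' t = 1" using eq[of t'] t' by simp
  moreover have "0 \<le> S' t" using sub t by simp
  ultimately have "S' t = 1" by (auto simp: zmult_eq_1_iff)
  then have "S' a = S a" for a using eq[of a] by (cases "a = 0") auto
  then show False using ne by auto
qed

lemma separate_two_points:
  assumes hom: "field_hom c" and S: "S \<in> points c" and S': "S' \<in> points c" and ne: "S \<noteq> S'"
  shows "\<exists>h. h \<noteq> 0 \<and> 0 < S h \<and> S' h < 0"
proof -
  interpret S: curve_point c S by (rule curve_point.intro) (fact hom S)+
  interpret S': curve_point c S' by (rule curve_point.intro) (fact hom S')+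
  obtain a where a: "a \<noteq> 0" "0 \<le> S a" "S' a < 0"
    using valuation_ring_not_subset[OF hom S S' ne] by blast
  obtain b where b: "b \<noteq> 0" "0 \<le> S' b" "S b < 0"
    using valuation_ring_not_subset[OF hom S' S] ne by blast
  show ?thesis
    by (rule exI[of _ "a / b"]) (use a b in \<open>simp add: S.val_divide S'.val_divide\<close>)
qed

text \<open>In the induction \<open>h + h' ^ m\<close> works once \<open>m\<close> exceeds all
  orders of \<open>h\<close> in absolute value: where \<open>h'\<close> has a pole the power
  dominates, and at the remaining points the pole of \<open>h\<close> survives.\<close>

lemma separate_points:
  assumes hom: "field_hom c" and A: "finite A" "A \<subseteq> points c" and S: "S \<in> points c" "S \<notin> A"
  shows "\<exists>h. h \<noteq> 0 \<and> 0 < S h \<and> (\<forall>S'\<in>A. S' h < 0)"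
  using A S
proof (induction A rule: finite_induct)
  case empty
  interpret S: curve_point c S by (rule curve_point.intro) (use hom empty in auto)
  obtain t where "S t = 1" "t \<noteq> 0" by (rule S.uniformizer)
  then show ?case by (intro exI[of _ t]) simp
next
  case (insert S1 A)
  interpret S: curve_point c S by (rule curve_point.intro) (use hom insert in auto)
  obtain h where h: "h \<noteq> 0" "0 < S h" "\<forall>S'\<in>A. S' h < 0" using insert by auto
  obtain h' where h': "h' \<noteq> 0" "0 < S h'" "S1 h' < 0"
    using separate_two_points[OF hom] insert by (metis insert_iff subset_eq)
  define m where "m = nat (1 + (\<Sum>S'\<in>insert S1 A. \<bar>S' h\<bar>))"
  have m: "int m > \<bar>S' h\<bar>" if "S' \<in> insert S1 A" for S'
  proof -
    have "\<bar>S' h\<bar> \<le> (\<Sum>S'\<in>insert S1 A. \<bar>S' h\<bar>)"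
      using that insert.hyps by (intro member_le_sum) auto
    then show ?thesis by (simp add: m_def)
  qed
  have neg: "h + h' ^ m \<noteq> 0 \<and> S' (h + h' ^ m) < 0" if S': "S' \<in> insert S1 A" for S'
  proof -
    interpret S': curve_point c S' by (rule curve_point.intro) (use hom insert S' in auto)
    have v: "S' (h' ^ m) = int m * S' h'" using h' by (simp add: S'.val_power)
    show ?thesis
    proof (cases "S' h' < 0")
      case True
      then have "int m * S' h' \<le> int m * (-1)" by (intro mult_left_mono) auto
      then have lt: "S' (h' ^ m) < S' h" using m[OF S'] v by linarith
      moreover have "int m * S' h' < 0" using True m[OF S'] by (intro mult_pos_neg) auto
      ultimately show ?thesis using S'.val_add_eq[of "h' ^ m" h] h' v by (auto simp: vge_def add.commute)
    next
      case False
      then have "S' \<in> A" using S' h' by auto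
      then have "S' h < 0" using h by blast
      moreover have "0 \<le> S' (h' ^ m)" using False v by simp
      ultimately show ?thesis using S'.val_add_eq[of h "h' ^ m"] h by (auto simp: vge_def)
    qed
  qed
  have "vge S 1 (h' ^ m)"
  proof -
    have "0 < int m * S h'" using m[of S1] h' by (intro mult_pos_pos) auto
    then show ?thesis using h' by (simp add: vge_def S.val_power)
  qed
  then have "vge S 1 (h + h' ^ m)" using h by (intro S.vge_add) (auto simp: vge_def)
  then show ?case using neg by (intro exI[of _ "h + h' ^ m"]) (auto simp: vge_def)
qed

text \<open>If \<open>h\<close> vanishes at \<open>S\<close> and has poles on \<open>A\<close>, then
  \<open>inverse (1 + h ^ N)\<close> has value 1 at \<open>S\<close> and vanishes to order at least
  \<open>N\<close> on \<open>A\<close>.\<close>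

lemma approximate_idempotent:
  assumes hom: "field_hom c" and A: "finite A" "A \<subseteq> points c" and S: "S \<in> points c" "S \<notin> A"
  shows "\<exists>e. e \<noteq> 0 \<and> S e = 0 \<and> (\<forall>S'\<in>A. n \<le> S' e)"
proof -
  interpret S: curve_point c S by (rule curve_point.intro) (use hom S in auto)
  obtain h where h: "h \<noteq> 0" "0 < S h" "\<forall>S'\<in>A. S' h < 0" using separate_points[OF assms] by blast
  define N where "N = nat (max n 1)"
  have N: "n \<le> int N" "1 \<le> N" by (auto simp: N_def)
  have "0 < int N * S h" using h N by (intro mult_pos_pos) auto
  then have "vge S 1 (h ^ N)" using h by (simp add: vge_def S.val_power)
  then have 1: "1 + h ^ N \<noteq> 0" "S (1 + h ^ N) = 0" using S.val_add_eq[of 1 "h ^ N"] by auto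
  have "n \<le> S' (inverse (1 + h ^ N))" if S': "S' \<in> A" for S'
  proof -
    interpret S': curve_point c S' by (rule curve_point.intro) (use hom A S' in auto)
    have neg: "S' h \<le> -1" using h S' by force
    then have "int N * S' h \<le> int N * (-1)" by (intro mult_left_mono) auto
    then have v: "S' (h ^ N) \<le> - int N" using h by (simp add: S'.val_power)
    then have "S' (h ^ N + 1) = S' (h ^ N)" using S'.val_add_eq[of "h ^ N" 1] h N by (auto simp: vge_def)
    then show ?thesis using v N by (simp add: add.commute)
  qed
  then show ?thesis using 1 by (intro exI[of _ "inverse (1 + h ^ N)"]) auto
qed

text \<open>A power of a uniformizer at \<open>S\<close> times an approximate idempotent, whose
  order \<open>n\<close> elsewhere pays both for \<open>S' t\<close> and for poles of the
  power.\<close>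

lemma exists_localized_element:
  assumes hom: "field_hom c" and A: "finite A" "A \<subseteq> points c" and S: "S \<in> A"
  shows "\<exists>h. h \<noteq> 0 \<and> S h = int j \<and> (\<forall>S'\<in>A - {S}. S' t \<le> S' h)"
proof -
  interpret S: curve_point c S by (rule curve_point.intro) (use hom S A in auto)
  obtain u where u: "S u = 1" "u \<noteq> 0" by (rule S.uniformizer)
  define n where "n = (\<Sum>S'\<in>A. \<bar>S' t\<bar> + int j * \<bar>S' u\<bar>)"
  obtain e where e: "e \<noteq> 0" "S e = 0" "\<forall>S'\<in>A - {S}. n \<le> S' e"
    using approximate_idempotent[OF hom, of "A - {S}" S n] A S by auto
  have "S' t \<le> S' (e * u ^ j)" if S': "S' \<in> A - {S}" for S'
  proof -
    interpret S': curve_point c S' by (rule curve_point.intro) (use hom A S' in auto)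
    have "\<bar>S' t\<bar> + int j * \<bar>S' u\<bar> \<le> n"
      unfolding n_def using S' A by (intro member_le_sum) auto
    moreover have "int j * S' u \<ge> - (int j * \<bar>S' u\<bar>)"
      by (metis abs_ge_minus_self abs_mult abs_of_nat minus_le_iff)
    moreover have "S' (e * u ^ j) = S' e + int j * S' u"
      using e u by (simp add: S'.val_mult S'.val_power)
    moreover have "n \<le> S' e" using e S' by blast
    ultimately show ?thesis by linarith
  qed
  then show ?thesis using e u by (intro exI[of _ "e * u ^ j"]) (auto simp: S.val_mult S.val_power)
qed

text \<open>The classical bound of a sum of ramification indices by the degree
  \<open>[K : k(t)]\<close>. Each pair \<open>(S, i)\<close> with \<open>i < S t\<close> yields a
  function of order \<open>i\<close> at \<open>S\<close> and of order at least \<open>S' t\<close>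
  at every other \<open>S'\<close> in \<open>A\<close>. These functions are independent over k[t],
  so three pairs are impossible.\<close>

lemma sum_zeros_le_two:
  assumes hom: "field_hom c" and r: "rank_le_two c t" and A: "finite A" "A \<subseteq> points c"
    and pos: "\<And>S. S \<in> A \<Longrightarrow> 0 < S t"
  shows "(\<Sum>S\<in>A. S t) \<le> 2"
proof (rule ccontr)
  assume big: "\<not> ?thesis"
  define B where "B = Sigma A (\<lambda>S. {..<nat (S t)})"
  have finB: "finite B" using A by (simp add: B_def)
  have "int (card B) = (\<Sum>S\<in>A. S t)"
    using A pos by (simp add: B_def card_SigmaI)
      (intro sum.cong, auto dest: pos less_imp_le)
  then have "3 \<le> card B" using big by linarith
  then obtain B' where B': "B' \<subseteq> B" "card B' = 3" "finite B'"
    using obtain_subset_with_card_n by metis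
  obtain s where s: "bij_betw s {0..<3::nat} B'" using ex_bij_betw_nat_finite[OF B'(3)] B'(2) by auto
  have s_mem: "fst (s i) \<in> A" "int (snd (s i)) < fst (s i) t" if "i < 3" for i
  proof -
    have "s i \<in> B" using bij_betwE[OF s] B'(1) that by auto
    then show "fst (s i) \<in> A" "int (snd (s i)) < fst (s i) t" by (auto simp: B_def)
  qed
  have s_inj: "s i = s j \<Longrightarrow> i = j" if "i < 3" "j < 3" for i j
    using bij_betw_imp_inj_on[OF s] that by (auto simp: inj_on_def)
  have "\<forall>i. \<exists>h. i < 3 \<longrightarrow> h \<noteq> 0 \<and> fst (s i) h = int (snd (s i)) \<and> (\<forall>S'\<in>A - {fst (s i)}. S' t \<le> S' h)"
    using exists_localized_element[OF hom A s_mem(1)] by auto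
  from choice[OF this] obtain h where h: "\<And>i. i < 3 \<Longrightarrow> h i \<noteq> 0 \<and> fst (s i) (h i) = int (snd (s i)) \<and>
    (\<forall>S'\<in>A - {fst (s i)}. S' t \<le> S' (h i))" by auto
  have t0: "t \<noteq> 0"
  proof
    assume "t = 0"
    interpret S: curve_point c "fst (s 0)" by (rule curve_point.intro) (use hom A s_mem[of 0] in auto)
    show False using pos[OF s_mem(1)[of 0]] \<open>t = 0\<close> by simp
  qed
  obtain p where p: "\<exists>i<3. coeff (p i) 0 \<noteq> 0" "(\<Sum>i<3::nat. ev c (p i) t * h i) = 0"
    by (rule rank_le_two_primitive[OF hom r t0, of h])
  then obtain i1 where i1: "i1 < 3" "coeff (p i1) 0 \<noteq> 0" by auto
  define S where "S = fst (s i1)"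
  define I where "I i \<longleftrightarrow> i < 3 \<and> coeff (p i) 0 \<noteq> 0 \<and> fst (s i) = S" for i
  \<comment> \<open>Among the terms belonging to \<open>S\<close> whose coefficient is a unit there,
    the one of least order dominates: its order is below \<open>S t\<close>, while functions of
    other points, and coefficients without constant term, contribute order at least
    \<open>S t\<close>.\<close>
  obtain i0 where i0: "I i0" "\<And>i. I i \<Longrightarrow> snd (s i0) \<le> snd (s i)"
    using ex_has_least_nat[of I i1 "\<lambda>i. snd (s i)"] i1 by (auto simp: I_def S_def)
  have SA: "S \<in> A" using s_mem(1) i1 by (simp add: S_def)
  interpret S: curve_point c S by (rule curve_point.intro) (use hom A SA in auto)
  have t1: "vge S 1 t" using pos[OF SA] by (simp add: vge_def)
  then have t0': "vge S 0 t" by (rule S.vge_mono) simp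
  have v0: "S (ev c (p i0) t * h i0) = int (snd (s i0))" "ev c (p i0) t * h i0 \<noteq> 0"
    using S.val_poly_unit[OF t1, of "p i0"] i0(1) h[of i0] by (auto simp: I_def S.val_mult)
  have bound: "int (snd (s i0)) < S t" using s_mem(2)[of i0] i0(1) by (auto simp: I_def)
  have "(\<Sum>i<3. ev c (p i) t * h i) \<noteq> 0"
  proof (rule S.sum_unique_min(1)[where i = i0])
    show "finite {..<3::nat}" "i0 \<in> {..<3}" "ev c (p i0) t * h i0 \<noteq> 0"
      using i0 v0 by (auto simp: I_def)
    fix i assume i: "i \<in> {..<3}" "i \<noteq> i0"
    have pv: "vge S 0 (ev c (p i) t)" by (rule S.vge_poly[OF t0'])
    consider "fst (s i) \<noteq> S" | "fst (s i) = S" "coeff (p i) 0 = 0" | "I i"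
      using i by (auto simp: I_def)
    then show "vge S (S (ev c (p i0) t * h i0) + 1) (ev c (p i) t * h i)"
    proof cases
      case 1
      then have "vge S (S t) (h i)" using h[of i] i SA by (auto simp: vge_def)
      then show ?thesis using bound v0 by (intro S.vge_mult_le[OF pv]) auto
    next
      case 2
      then have "vge S 0 (h i)" using h[of i] i by (auto simp: vge_def)
      then show ?thesis using bound v0 by (intro S.vge_mult_le[OF S.vge_poly_coeff_0[OF 2(2) t0']]) auto
    next
      case 3
      then have "snd (s i0) \<noteq> snd (s i)" using s_inj[of i i0] i i0(1) by (auto simp: I_def prod_eq_iff)
      then have "int (snd (s i0)) + 1 \<le> int (snd (s i))" using i0(2)[OF 3] by simp
      then have "vge S (int (snd (s i0)) + 1) (h i)" using h[of i] 3 by (auto simp: vge_def I_def)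
      then show ?thesis using v0 by (intro S.vge_mult_le[OF pv]) auto
    qed
  qed
  then show False using p(2) by simp
qed

lemma ev_in_subfield:
  assumes hom: "field_hom c" and S: "is_subfield S" "t \<in> S" "range c \<subseteq> S"
  shows "ev c p t \<in> S"
proof -
  interpret c: field_hom c by fact
  show ?thesis
  proof (induction p)
    case 0
    then show ?case using is_subfieldD(1)[OF S(1)] by simp
  next
    case (pCons a p)
    have "c a + t * ev c p t \<in> S"
      using S pCons by (intro is_subfieldD(5,6)) auto
    then show ?case by (simp add: c.map_poly_pCons_hom)
  qed
qed

lemma zeros_finite_sum_le_two:
  assumes hom: "field_hom c" and r: "rank_le_two c t"
  shows "finite {S \<in> points c. 0 < S t}" "(\<Sum>S\<in>{S \<in> points c. 0 < S t}. S t) \<le> 2"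
proof -
  show fin: "finite {S \<in> points c. 0 < S t}"
  proof (rule ccontr)
    assume "infinite {S \<in> points c. 0 < S t}"
    then obtain A where A: "A \<subseteq> {S \<in> points c. 0 < S t}" "card A = 3" "finite A"
      using infinite_arbitrarily_large by blast
    have "(\<Sum>S\<in>A. 1) \<le> (\<Sum>S\<in>A. S t)" using A by (intro sum_mono) auto
    moreover have "(\<Sum>S\<in>A. S t) \<le> 2" using A by (intro sum_zeros_le_two[OF hom r]) auto
    ultimately show False using A by simp
  qed
  show "(\<Sum>S\<in>{S \<in> points c. 0 < S t}. S t) \<le> 2"
    using fin by (intro sum_zeros_le_two[OF hom r]) auto
qed

section \<open>Function fields of y^2 = Q(x), for both X and W\<close>

locale quadratic_function_field =
  fixes c :: "'k::alg_closed_field \<Rightarrow> 'f::field" and x y :: 'f and Q :: "'k poly"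
  assumes model: "is_plane_curve_model c [:- Q, 0, 1:] x y"
begin

lemma hom: "field_hom c"
  and vanish_iff: "poly (map_poly (\<lambda>p. ev c p x) H) y = 0 \<longleftrightarrow> [:- Q, 0, 1:] dvd H"
  and generates: "generated_subfield (insert x (insert y (range c))) = UNIV"
  using model unfolding is_plane_curve_model_def by auto

sublocale c: field_hom c by (rule hom)
sublocale mp: map_poly_inj_idom_hom c ..

lemma map_poly_ev_pCons:
  "map_poly (\<lambda>p. ev c p x) (pCons A H) = pCons (ev c A x) (map_poly (\<lambda>p. ev c p x) H)"
  by (rule poly_eqI) (simp add: coeff_map_poly coeff_pCons split: nat.split)

lemma y_sq: "y\<^sup>2 = ev c Q x"
proof -
  have "poly (map_poly (\<lambda>p. ev c p x) [:- Q, 0, 1:]) y = 0"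
    unfolding vanish_iff by (rule dvd_refl)
  then have "y * y - ev c Q x = 0"
    unfolding map_poly_ev_pCons by (simp add: mp.hom_uminus)
  then show ?thesis by (simp add: power2_eq_square)
qed

lemma independent_1_y:
  assumes "ev c A x + ev c B x * y = 0"
  shows "A = 0 \<and> B = 0"
proof -
  have "poly (map_poly (\<lambda>p. ev c p x) [:A, B:]) y = 0"
    unfolding map_poly_ev_pCons using assms by (simp add: mult.commute)
  then have "[:- Q, 0, 1:] dvd [:A, B:]" using vanish_iff by simp
  then have "[:A, B:] = 0"
  proof (rule contrapos_pp)
    assume "[:A, B:] \<noteq> 0"
    moreover have "degree [:A, B:] < degree [:- Q, 0, 1:]" by simp
    ultimately show "\<not> [:- Q, 0, 1:] dvd [:A, B:]" using dvd_imp_degree_le by (metis not_less)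
  qed
  then show ?thesis by simp
qed

lemma transcendental: "ev c A x = 0 \<Longrightarrow> A = 0"
  using independent_1_y[of A 0] by simp

lemma x_neq_const: "x - c a \<noteq> 0"
  using transcendental[of "[:- a, 1:]"] by (auto simp: c.map_poly_pCons_hom c.hom_uminus)

lemma x_neq_0: "x \<noteq> 0"
  using x_neq_const[of 0] by simp

text \<open>Over any field containing k(x), \<open>y\<close> is quadratic. The field is left
  arbitrary because the lemma serves \<open>rational_values\<close> for several generators as well
  as a \<open>generated_subfield\<close>.\<close>

lemma span_1_y:
  assumes S: "is_subfield S" "x \<in> S" "range c \<subseteq> S"
  shows "\<exists>a\<in>S. \<exists>b\<in>S. h = a + b * y"
proof -
  have "y\<^sup>2 \<in> S" unfolding y_sq by (rule ev_in_subfield[OF hom S])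
  then have sub: "is_subfield {a + b * y | a b. a \<in> S \<and> b \<in> S}"
    by (rule is_subfield_adjoin_sqrt[OF S(1)])
  have inS: "s \<in> {a + b * y | a b. a \<in> S \<and> b \<in> S}" if "s \<in> S" for s
    using that is_subfieldD(1)[OF S(1)] by (intro CollectI exI[of _ s] exI[of _ 0]) simp
  have "y \<in> {a + b * y | a b. a \<in> S \<and> b \<in> S}"
    using is_subfieldD(1,2)[OF S(1)] by (intro CollectI exI[of _ 0] exI[of _ 1]) simp
  then have "generated_subfield (insert x (insert y (range c))) \<subseteq> {a + b * y | a b. a \<in> S \<and> b \<in> S}"
    using inS S by (intro generated_subfield_minimal[OF sub]) blast
  then show ?thesis using generates by blast
qed

lemma rank_le_two_if_generator:
  assumes "x \<in> rational_values c t"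
  shows "rank_le_two c t"
  by (rule rank_le_twoI[OF hom, of t y], rule span_1_y)
    (use is_subfield_rational_values[OF hom] assms in auto)

lemma rank_le_two_x: "rank_le_two c x"
  and rank_le_two_shift: "rank_le_two c (x - c a)"
  and rank_le_two_inverse: "rank_le_two c (inverse x)"
proof -
  note R = is_subfield_rational_values[OF hom]
  show "rank_le_two c x" by (rule rank_le_two_if_generator, rule R)
  have "x - c a + c a \<in> rational_values c (x - c a)"
    by (rule is_subfieldD(5)[OF R(1) R(2) subsetD[OF R(3) rangeI]])
  then show "rank_le_two c (x - c a)" by (intro rank_le_two_if_generator) simp
  have "inverse (inverse x) \<in> rational_values c (inverse x)"
    by (rule is_subfieldD(4)[OF R(1) R(2)])
  then show "rank_le_two c (inverse x)" by (intro rank_le_two_if_generator) simp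
qed

text \<open>Some \<open>x - c a\<close> vanishes at a point where \<open>x\<close> is finite, and
  \<open>inverse x\<close> vanishes at a pole; each generates the same field k(x), so
  \<open>residue_exists\<close> applies.\<close>

lemma residue:
  assumes P: "P \<in> points c" and h: "vge P 0 h"
  shows "\<exists>a. vge P 1 (h - c a)"
proof -
  interpret P: curve_point c P by (rule curve_point.intro) (fact hom P)+
  show ?thesis
  proof (cases "vge P 0 x")
    case True
    then obtain a where "vge P 1 (x - c a)" using P.finite_value_exists[OF rank_le_two_x] by blast
    then show ?thesis using P.residue_exists[OF rank_le_two_shift _ _ h] x_neq_const by blast
  next
    case False
    then have "vge P 1 (inverse x)" by (simp add: vge_def)
    then show ?thesis using P.residue_exists[OF rank_le_two_inverse _ _ h] x_neq_0 by simp
  qed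
qed

lemma is_curve: "is_curve c"
  unfolding is_curve_def
proof (intro conjI exI[of _ x])
  show "field_hom c" by (rule hom)
  show "transcendental_over c x"
    using transcendental by (auto simp: transcendental_over_def)
  let ?S = "generated_subfield (insert x (range c))"
  have "\<exists>r. (\<forall>b\<in>{1, y}. r b \<in> ?S) \<and> h = (\<Sum>b\<in>{1, y}. r b * b)" for h
  proof -
    \<comment> \<open>The spanning family is a set, so its two members have to be distinct for the
      sum to have two terms.\<close>
    have ne: "y \<noteq> 1" using independent_1_y[of 1 "-1"] by (auto simp: mp.hom_uminus)
    obtain a b where "a \<in> ?S" "b \<in> ?S" "h = a + b * y"
      using span_1_y[of ?S h] is_subfield_generated generated_subfield_superset[of "insert x (range c)"] by auto
    then show ?thesis using ne by (intro exI[of _ "\<lambda>s. if s = y then b else a"]) auto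
  qed
  then show "finite_over ?S" unfolding finite_over_def by (intro exI[of _ "{1, y}"]) simp
qed

end

section \<open>Riemann's inequality for double covers of the line branched over a cubic\<close>

lemma divisor_degree_superset:
  assumes "finite A" "Poly_Mapping.keys D \<subseteq> A"
  shows "divisor_degree D = (\<Sum>S\<in>A. Poly_Mapping.lookup D S)"
  unfolding divisor_degree_def
  by (rule sum.mono_neutral_left) (use assms in \<open>auto simp: in_keys_iff\<close>)

lemma divisor_degree_add: "divisor_degree (D + E) = divisor_degree D + divisor_degree E"
proof -
  let ?A = "Poly_Mapping.keys D \<union> Poly_Mapping.keys E"
  have "finite ?A" by simp
  then show ?thesis
    using divisor_degree_superset[of ?A "D + E"] divisor_degree_superset[of ?A D]
      divisor_degree_superset[of ?A E] Poly_Mapping.keys_add[of D E]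
    by (simp add: lookup_add sum.distrib)
qed

lemma divisor_degree_frag_of: "divisor_degree (frag_of S) = 1"
  using divisor_degree_superset[of "{S}" "frag_of S"] by simp

lemma (in vector_space) independent_family:
  assumes I: "finite I"
    and zero: "\<And>r. (\<Sum>i\<in>I. scale (r i) (g i)) = 0 \<Longrightarrow> \<forall>i\<in>I. r i = 0"
  shows "inj_on g I" "independent (g ` I)"
proof -
  show inj: "inj_on g I"
  proof (rule inj_onI, rule ccontr)
    fix i j assume ij: "i \<in> I" "j \<in> I" "g i = g j" "i \<noteq> j"
    define r where "r k = (if k = i then 1 else if k = j then - 1 else 0 :: 'a)" for k
    have "(\<Sum>k\<in>I. scale (r k) (g k)) = (\<Sum>k\<in>{i, j}. scale (r k) (g k))"
      by (rule sum.mono_neutral_right) (use I ij in \<open>auto simp: r_def\<close>)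
    also have "\<dots> = 0" using ij by (simp add: r_def)
    finally have "r i = 0" using zero ij by blast
    then show False by (simp add: r_def)
  qed
  show "independent (g ` I)"
  proof (rule independent_if_scalars_zero)
    show "finite (g ` I)" using I by simp
    fix f v assume "(\<Sum>v\<in>g ` I. scale (f v) v) = 0" "v \<in> g ` I"
    then show "f v = 0" using zero[of "f \<circ> g"] inj by (auto simp: sum.reindex)
  qed
qed

section \<open>Riemann-Roch spaces and the effect of adding a point\<close>

context quadratic_function_field
begin

sublocale vs: vector_space "\<lambda>a f. c a * f"
  by unfold_locales (auto simp: algebra_simps hom_distribs)

text \<open>The Riemann-Roch space for an arbitrary integer function on the points, so that
  \<open>E\<close> can be given by a formula without first proving its support finite.\<close>

definition sections :: "(('f \<Rightarrow> int) \<Rightarrow> int) \<Rightarrow> 'f set" where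
  "sections E = {f. \<forall>P\<in>points c. vge P (- E P) f}"

lemma riemann_roch_space_eq_sections: "riemann_roch_space c D = sections (Poly_Mapping.lookup D)"
  unfolding riemann_roch_space_def sections_def vge_def by fastforce

text \<open>If a section \<open>b\<close> has the extra pole at \<open>S\<close>, every
  \<open>h\<close> becomes a section of \<open>E\<close> after subtracting \<open>c a * b\<close>,
  where \<open>a\<close> is the residue of \<open>h / b\<close>. Spanning sets are used instead of
  dimensions because they certify finiteness too.\<close>

lemma sections_add_point:
  assumes S: "S \<in> points c" and B: "finite B" "sections E \<subseteq> vs.span B"
  shows "\<exists>B'. finite B' \<and> card B' \<le> card B + 1 \<and> sections (E(S := E S + 1)) \<subseteq> vs.span B'"
proof (cases "sections (E(S := E S + 1)) \<subseteq> sections E")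
  case True
  then show ?thesis using B by (intro exI[of _ B]) auto
next
  case False
  interpret S: curve_point c S by (rule curve_point.intro) (fact hom S)+
  obtain b where b: "b \<in> sections (E(S := E S + 1))" "b \<notin> sections E" using False by blast
  have b_other: "vge P (- E P) b" if "P \<in> points c" "P \<noteq> S" for P
    using b(1) that by (auto simp: sections_def)
  then have "\<not> vge S (- E S) b" using b(2) by (auto simp: sections_def)
  moreover have "vge S (- E S - 1) b" using b(1) S by (auto simp: sections_def)
  ultimately have bS: "b \<noteq> 0" "S b = - E S - 1" by (auto simp: vge_def)
  have "h \<in> vs.span (insert b B)" if h: "h \<in> sections (E(S := E S + 1))" for h
  proof -
    have "vge S (- E S - 1) h" using h S by (auto simp: sections_def)
    then have "vge S 0 (h / b)" using bS by (cases "h = 0") (auto simp: vge_def S.val_divide)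
    then obtain a where a: "vge S 1 (h / b - c a)" using residue[OF S] by blast
    have eq: "h - c a * b = b * (h / b - c a)" using bS by (simp add: algebra_simps)
    have "vge P (- E P) (h - c a * b)" if P: "P \<in> points c" for P
    proof (cases "P = S")
      case True
      show ?thesis unfolding True eq using bS by (intro S.vge_mult_le[OF S.vge_self a]) simp
    next
      case False
      interpret P: curve_point c P by (rule curve_point.intro) (fact hom P)+
      have "vge P (- E P) h" using h P False by (auto simp: sections_def)
      moreover have "vge P (- E P) (c a * b)"
        by (rule P.vge_mult_le[OF P.vge_const b_other[OF P False]]) simp
      ultimately show ?thesis by (rule P.vge_diff)
    qed
    then have "h - c a * b \<in> vs.span B" using B by (auto simp: sections_def)
    then have "h - c a * b \<in> vs.span (insert b B)" by (rule subsetD[OF vs.span_mono, rotated]) auto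
    then have "h - c a * b + c a * b \<in> vs.span (insert b B)"
      by (rule vs.span_add[OF _ vs.span_scale[OF vs.span_base]]) simp
    then show ?thesis by simp
  qed
  then show ?thesis using B by (intro exI[of _ "insert b B"]) (auto simp: card_insert_if)
qed

lemma sections_mono_span:
  assumes A: "finite A" "A \<subseteq> points c"
    and le: "\<And>S. S \<in> points c \<Longrightarrow> E S \<le> E' S" and eq: "\<And>S. S \<in> points c - A \<Longrightarrow> E S = E' S"
    and B: "finite B" "sections E \<subseteq> vs.span B"
  shows "\<exists>B'. finite B' \<and> int (card B') \<le> int (card B) + (\<Sum>S\<in>A. E' S - E S) \<and> sections E' \<subseteq> vs.span B'"
  using le eq B
proof (induction "nat (\<Sum>S\<in>A. E' S - E S)" arbitrary: E B rule: less_induct)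
  case less
  have nonneg: "0 \<le> (\<Sum>S\<in>A. E' S - E S)" using less.prems(1) A by (intro sum_nonneg) auto
  show ?case
  proof (cases "\<forall>S\<in>A. E S = E' S")
    case True
    then have "E S = E' S" if "S \<in> points c" for S using less.prems(2) that by blast
    then have "sections E' = sections E" by (auto simp: sections_def)
    then show ?thesis using less.prems nonneg by (intro exI[of _ B]) auto
  next
    case False
    then obtain S where S: "S \<in> A" "E S \<noteq> E' S" by blast
    then have lt: "E S < E' S" using less.prems(1)[of S] A by auto
    define F where "F = E(S := E S + 1)"
    obtain B1 where B1: "finite B1" "card B1 \<le> card B + 1" "sections F \<subseteq> vs.span B1"
      using sections_add_point[of S B E] S A less.prems unfolding F_def by blast
    have "(\<Sum>S\<in>A. E' S - F S) = (\<Sum>T\<in>A. (E' T - E T) - (if T = S then 1 else 0))"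
      by (rule sum.cong) (auto simp: F_def)
    also have "\<dots> = (\<Sum>S\<in>A. E' S - E S) - 1" using A S by (simp add: sum_subtractf)
    finally have sum: "(\<Sum>S\<in>A. E' S - F S) = (\<Sum>S\<in>A. E' S - E S) - 1" .
    have le': "F T \<le> E' T" if "T \<in> points c" for T using less.prems(1)[OF that] lt by (auto simp: F_def)
    then have "0 \<le> (\<Sum>S\<in>A. E' S - F S)" using A by (intro sum_nonneg) auto
    then have "nat (\<Sum>S\<in>A. E' S - F S) < nat (\<Sum>S\<in>A. E' S - E S)" using sum by linarith
    moreover have "F T = E' T" if "T \<in> points c - A" for T
      using less.prems(2)[OF that] that S by (auto simp: F_def)
    ultimately obtain B' where "finite B'" "int (card B') \<le> int (card B1) + (\<Sum>S\<in>A. E' S - F S)"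
      "sections E' \<subseteq> vs.span B'"
      using less.hyps[of F B1] le' B1 by blast
    then show ?thesis using B1 sum by (intro exI[of _ B']) auto
  qed
qed

text \<open>
  The library dimension of an infinite-dimensional space is \<open>0\<close>, so that adding a point to such a \<open>D\<close>
  would violate the maximality in the definition of the genus.
\<close>
lemma riemann_roch_space_basis:
  assumes g: "has_genus c n" and D: "is_divisor c D" "divisor_degree D - int (ell c D) + 1 = int n" "1 < n"
  obtains B where "finite B" "riemann_roch_space c D \<subseteq> vs.span B" "card B = ell c D"
proof -
  let ?L = "riemann_roch_space c"
  obtain B where B: "B \<subseteq> ?L D" "vs.independent B" "?L D \<subseteq> vs.span B" "card B = vs.dim (?L D)"
    by (rule vs.basis_exists)
  have "finite B"
  proof (rule ccontr)
    assume inf: "infinite B"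
    then have "ell c D = 0" using B by (simp add: ell_def)
    then have deg: "divisor_degree D = int n - 1" using D by simp
    \<comment> \<open>As \<open>1 < n\<close>, the degree is positive, so the support of
      \<open>D\<close> itself supplies a point to add.\<close>
    then have "Poly_Mapping.keys D \<noteq> {}" using D by (auto simp: divisor_degree_def)
    then obtain S where "S \<in> Poly_Mapping.keys D" by blast
    then have S: "S \<in> points c" using D by (auto simp: is_divisor_def)
    let ?D = "D + frag_of S"
    have "Poly_Mapping.keys ?D \<subseteq> points c"
      using Poly_Mapping.keys_add[of D "frag_of S"] D S by (auto simp: is_divisor_def)
    then have D': "is_divisor c ?D" by (simp add: is_divisor_def)
    have "?L D \<subseteq> ?L ?D" by (auto simp: riemann_roch_space_def lookup_add)
    obtain B' where B': "B' \<subseteq> ?L ?D" "vs.independent B'" "?L ?D \<subseteq> vs.span B'" "card B' = vs.dim (?L ?D)"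
      by (rule vs.basis_exists)
    have "infinite B'"
    proof
      assume "finite B'"
      then have "finite B"
        using vs.independent_span_bound[of B' B] B B' \<open>?L D \<subseteq> ?L ?D\<close> by blast
      then show False using inf by simp
    qed
    then have "ell c ?D = 0" using B' by (simp add: ell_def)
    moreover have "divisor_degree ?D = int n" using deg by (simp add: divisor_degree_add divisor_degree_frag_of)
    ultimately show False using g D' unfolding has_genus_def by force
  qed
  then show ?thesis using that B by (simp add: ell_def)
qed

end

context quadratic_function_field
begin

text \<open>With \<open>n = M * (1 + card C)\<close>, division by \<open>H\<close> leaves room at
  each pole of \<open>x\<close> for \<open>n\<close> times the pole order of \<open>x\<close>. Of
  this, \<open>x ^ i\<close> uses the multiple \<open>i\<close>, and \<open>w * x ^ j\<close> at
  most the multiple \<open>j + 2\<close>, because \<open>w\<close> squares to a cubic in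
  \<open>x\<close>. This admits \<open>n + 1\<close> functions of the first kind and
  \<open>n - 1\<close> of the second.\<close>

lemma sections_dim_lower_bound:
  fixes C :: "'k set" and q :: "'k poly" and M :: nat
  assumes w: "(y / x)\<^sup>2 = ev c q x" and q: "degree q = 3" and C: "finite C" and M: "2 \<le> M"
    and B: "finite B" "sections (\<lambda>S. int M * (max 0 (S (inverse x)) + (\<Sum>a\<in>C. max 0 (S (x - c a))))) \<subseteq> vs.span B"
      (is "sections ?E \<subseteq> _")
  shows "2 * (M * (1 + card C)) \<le> card B"
proof -
  define n where "n = M * (1 + card C)"
  have n: "2 \<le> n" using M by (simp add: n_def)
  define w where "w = y / x"
  define H where "H = (\<Prod>a\<in>C. x - c a) ^ M"
  have H0: "H \<noteq> 0" using C x_neq_const by (simp add: H_def)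
  have q0: "q \<noteq> 0" using q by auto
  then have w2: "w\<^sup>2 = ev c q x" "w \<noteq> 0" using assms(1) transcendental[of q] by (auto simp: w_def)
  define g where "g i = (if i \<le> n then x ^ i / H else w * x ^ (i - (n + 1)) / H)" for i
  have mem: "f / H \<in> sections ?E"
    if f0: "f \<noteq> 0" and f1: "\<And>S. S \<in> points c \<Longrightarrow> 0 \<le> S x \<Longrightarrow> 0 \<le> S f"
      and f2: "\<And>S. S \<in> points c \<Longrightarrow> S x < 0 \<Longrightarrow> int n * S x \<le> S f" for f
    unfolding sections_def
  proof (intro CollectI ballI)
    fix S assume S: "S \<in> points c"
    interpret S: curve_point c S by (rule curve_point.intro) (fact hom S)+
    have prod: "S (\<Prod>a\<in>C. x - c a) = (\<Sum>a\<in>C. S (x - c a))"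
      using C x_neq_const by (induction C rule: finite_induct) (auto simp: S.val_mult)
    have SH: "S H = int M * (\<Sum>a\<in>C. S (x - c a))"
      using C x_neq_const prod by (simp add: H_def S.val_power)
    have SfH: "S (f / H) = S f - S H" using f0 H0 by (simp add: S.val_divide)
    have "- ?E S \<le> S f - S H"
    proof (cases "0 \<le> S x")
      case True
      have "S (x - c a) = max 0 (S (x - c a))" for a
        using S.vge_diff[of 0 x "c a"] True x_neq_const[of a] by (auto simp: vge_def)
      then have "(\<Sum>a\<in>C. max 0 (S (x - c a))) = (\<Sum>a\<in>C. S (x - c a))" by metis
      then show ?thesis using f1[OF S True] True SH by simp
    next
      case False
      have "S (x - c a) = S x" for a
        using S.val_add_eq[of x "- c a"] False x_neq_0 by (simp add: vge_def)
      then have "S H = int (M * card C) * S x" "(\<Sum>a\<in>C. max 0 (S (x - c a))) = 0"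
        using False SH by auto
      moreover from this(2) have "?E S = - int M * S x" using False by simp
      moreover have "int n * S x \<le> S f" using f2[OF S] False by simp
      moreover have "int n * S x = int M * S x + int (M * card C) * S x"
        by (simp add: n_def algebra_simps)
      ultimately show ?thesis by linarith
    qed
    then show "vge S (- ?E S) (f / H)" using SfH by (simp add: vge_def)
  qed
  have "x ^ i / H \<in> sections ?E" if i: "i \<le> n" for i
  proof (rule mem)
    show "x ^ i \<noteq> 0" using x_neq_0 by simp
    fix S assume S: "S \<in> points c"
    interpret S: curve_point c S by (rule curve_point.intro) (fact hom S)+
    show "0 \<le> S (x ^ i)" if "0 \<le> S x" using that x_neq_0 by (simp add: S.val_power)
    show "int n * S x \<le> S (x ^ i)" if "S x < 0"
      using that i x_neq_0 by (simp add: S.val_power mult_right_mono_neg)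
  qed
  moreover have "w * x ^ j / H \<in> sections ?E" if j: "j + 2 \<le> n" for j
  proof (rule mem)
    show "w * x ^ j \<noteq> 0" using x_neq_0 w2 by simp
    fix S assume S: "S \<in> points c"
    interpret S: curve_point c S by (rule curve_point.intro) (fact hom S)+
    have Sw: "2 * S w = S (ev c q x)" using S.val_power[OF w2(2), of 2] w2(1) by simp
    have Swx: "S (w * x ^ j) = S w + int j * S x" using x_neq_0 w2 by (simp add: S.val_mult S.val_power)
    show "0 \<le> S (w * x ^ j)" if "0 \<le> S x"
    proof -
      have "vge S 0 (ev c q x)" using that by (intro S.vge_poly) (simp add: vge_def)
      then have "0 \<le> S (ev c q x)" by (auto simp: vge_def)
      then show ?thesis using Swx Sw that by simp
    qed
    show "int n * S x \<le> S (w * x ^ j)" if "S x < 0"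
    proof -
      have "S (ev c q x) = 3 * S x"
        using S.val_poly_pole[OF q0 that] q q0 by simp
      \<comment> \<open>\<open>2 * S w = 3 * S x \<ge> 4 * S x\<close>, because \<open>S x\<close>
        is negative.\<close>
      then have "2 * S x \<le> S w" using Sw that by linarith
      moreover have "int n * S x \<le> int (j + 2) * S x"
        using j that by (intro mult_right_mono_neg) auto
      ultimately show ?thesis using Swx by (simp add: algebra_simps)
    qed
  qed
  ultimately have gmem: "g i \<in> sections ?E" if "i < 2 * n" for i using that n by (auto simp: g_def)
  have zero: "\<forall>i\<in>{..<2 * n}. r i = 0" if r: "(\<Sum>i<2 * n. c (r i) * g i) = 0" for r
  proof -
    define A where "A = (\<Sum>i\<le>n. monom (r i) i)"
    define B where "B = (\<Sum>j<n - 1. monom (r (n + 1 + j)) j)"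
    have "(\<Sum>i<2 * n. c (r i) * g i) = (\<Sum>i<n + 1. c (r i) * g i) + (\<Sum>j<n - 1. c (r (n + 1 + j)) * g (n + 1 + j))"
    proof -
      have two_n: "2 * n = n + 1 + (n - 1)" using n by simp
      have split: "(\<Sum>i<n + 1 + k. f i) = (\<Sum>i<n + 1. f i) + (\<Sum>j<k. f (n + 1 + j))" for f :: "nat \<Rightarrow> 'f" and k
        by (induction k) (simp_all add: add.assoc)
      show ?thesis unfolding two_n by (rule split)
    qed
    also have "(\<Sum>i<n + 1. c (r i) * g i) = ev c A x / H"
      unfolding A_def by (simp add: g_def lessThan_Suc_atMost mp.hom_sum poly_sum poly_monom sum_divide_distrib)
    also have "(\<Sum>j<n - 1. c (r (n + 1 + j)) * g (n + 1 + j)) = ev c B x * w / H"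
      unfolding B_def
      by (simp add: g_def mp.hom_sum poly_sum poly_monom sum_divide_distrib sum_distrib_left mult.assoc mult.commute mult.left_commute)
    finally have "ev c A x / H + ev c B x * w / H = 0" using r by simp
    then have "(ev c A x + ev c B x * w) / H = 0" by (simp add: add_divide_distrib)
    then have "ev c A x + ev c B x * w = 0" using H0 by simp
    then have "x * ev c A x + ev c B x * y = 0"
      using x_neq_0 unfolding w_def by (simp add: field_simps)
    then have "pCons 0 A = 0 \<and> B = 0" using independent_1_y[of "pCons 0 A" B]
      by (simp add: c.map_poly_pCons_hom)
    then have AB: "A = 0" "B = 0" by auto
    show ?thesis
    proof
      fix i assume i: "i \<in> {..<2 * n}"
      show "r i = 0"
      proof (cases "i \<le> n")
        case True
        have "coeff A i = r i" using True by (simp add: A_def coeff_sum)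
        then show ?thesis using AB by simp
      next
        case False
        then have "coeff B (i - (n + 1)) = r i" using i by (simp add: B_def coeff_sum)
        then show ?thesis using AB by simp
      qed
    qed
  qed
  have "inj_on g {..<2 * n}" "vs.independent (g ` {..<2 * n})"
    using vs.independent_family[of "{..<2 * n}" g] zero by auto
  moreover have "g ` {..<2 * n} \<subseteq> vs.span B" using gmem B by auto
  ultimately show ?thesis using vs.independent_span_bound[OF B(1)] by (fastforce simp: card_image n_def)
qed

text \<open>
  Any divisor \<open>D\<close> is dominated by a divisor \<open>E\<close> of degree at most \<open>2 n\<close>, supported on poles of \<open>x\<close> and
  zeros of \<open>H\<close>, whose space contains the \<open>2 n\<close> independent functions \<open>x\<^sup>i / H\<close>, \<open>i \<le> n\<close>, and \<open>(y / x) x\<^sup>j / H\<close>,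
  \<open>j \<le> n - 2\<close>; passing from \<open>D\<close> to \<open>E\<close> raises the dimension by at most \<open>deg E - deg D\<close>.
\<close>
lemma not_genus_two_if_cubic:
  fixes q :: "'k poly"
  assumes w: "(y / x)\<^sup>2 = ev c q x" and q: "degree q = 3"
  shows "\<not> has_genus c 2"
proof
  assume g: "has_genus c 2"
  then obtain D where D: "is_divisor c D" "divisor_degree D - int (ell c D) + 1 = int 2"
    unfolding has_genus_def by blast
  obtain B where B: "finite B" "riemann_roch_space c D \<subseteq> vs.span B" "card B = ell c D"
    by (rule riemann_roch_space_basis[OF g D]) auto
  define d where "d = Poly_Mapping.lookup D"
  define K where "K = Poly_Mapping.keys D"
  have K: "finite K" "K \<subseteq> points c" using D by (auto simp: K_def is_divisor_def)
  have "\<exists>a. 0 < S (x - c a)" if S: "S \<in> points c" "0 \<le> S x" for S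
  proof -
    interpret S: curve_point c S by (rule curve_point.intro) (fact hom S)+
    obtain a where "vge S 1 (x - c a)"
      using S.finite_value_exists[OF rank_le_two_x] S by (auto simp: vge_def)
    then show ?thesis using x_neq_const by (intro exI[of _ a]) (simp add: vge_def)
  qed
  then have "\<forall>S. \<exists>a. S \<in> points c \<longrightarrow> 0 \<le> S x \<longrightarrow> 0 < S (x - c a)"
    by blast
  from choice[OF this] obtain v where v: "\<And>S. S \<in> points c \<Longrightarrow> 0 \<le> S x \<Longrightarrow> 0 < S (x - c (v S))"
    by blast
  \<comment> \<open>The values of \<open>x\<close> at those points of the support of
    \<open>D\<close> where it is finite: each such point is a zero of \<open>x - c a\<close> for
    some \<open>a \<in> C\<close>.\<close>
  define C where "C = v ` {S \<in> K. 0 \<le> S x}"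
  have C: "finite C" using K by (simp add: C_def)
  \<comment> \<open>A bound for all coefficients of \<open>D\<close>, so that \<open>E\<close>
    dominates \<open>D\<close>; the summand 2 secures the condition \<open>2 \<le> M\<close> of the
    lower bound.\<close>
  define M where "M = nat (\<Sum>S\<in>K. \<bar>d S\<bar>) + 2"
  have M: "d S \<le> int M" if "S \<in> K" for S
  proof -
    have "\<bar>d S\<bar> \<le> (\<Sum>S\<in>K. \<bar>d S\<bar>)" using that K by (intro member_le_sum) auto
    then show ?thesis by (simp add: M_def)
  qed
  define E where "E S = int M * (max 0 (S (inverse x)) + (\<Sum>a\<in>C. max 0 (S (x - c a))))" for S
  define Z where "Z t = {S \<in> points c. 0 < S t}" for t
  have Z: "finite (Z t)" "(\<Sum>S\<in>Z t. S t) \<le> 2" if "rank_le_two c t" for t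
    using zeros_finite_sum_le_two[OF hom that] by (auto simp: Z_def)
  define A where "A = K \<union> Z (inverse x) \<union> (\<Union>a\<in>C. Z (x - c a))"
  have A: "finite A" "A \<subseteq> points c"
    using K C Z rank_le_two_inverse rank_le_two_shift by (auto simp: A_def Z_def)
  have sumZ: "(\<Sum>S\<in>A. max 0 (S t)) \<le> 2" if "Z t \<subseteq> A" "rank_le_two c t" for t
  proof -
    have "(\<Sum>S\<in>A. max 0 (S t)) = (\<Sum>S\<in>Z t. max 0 (S t))"
      by (rule sum.mono_neutral_right) (use A that in \<open>auto simp: Z_def\<close>)
    also have "\<dots> = (\<Sum>S\<in>Z t. S t)" by (rule sum.cong) (auto simp: Z_def)
    finally show ?thesis using Z that by simp
  qed
  have "(\<Sum>S\<in>A. E S) = int M * ((\<Sum>S\<in>A. max 0 (S (inverse x))) + (\<Sum>a\<in>C. \<Sum>S\<in>A. max 0 (S (x - c a))))"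
    unfolding E_def sum_distrib_left[symmetric] sum.distrib by (subst sum.swap) simp
  \<comment> \<open>Each of \<open>inverse x\<close> and \<open>x - c a\<close> has at most two
    zeros, counted with multiplicity.\<close>
  also have "\<dots> \<le> int M * (2 + (\<Sum>a\<in>C. 2))"
    by (intro mult_left_mono add_mono sum_mono sumZ rank_le_two_inverse rank_le_two_shift) (auto simp: A_def)
  finally have sumE: "(\<Sum>S\<in>A. E S) \<le> 2 * (int M * (1 + int (card C)))" by (simp add: algebra_simps)
  have E0: "0 \<le> E S" for S unfolding E_def by (intro mult_nonneg_nonneg add_nonneg_nonneg sum_nonneg) auto
  have le: "d S \<le> E S" if S: "S \<in> points c" for S
  proof (cases "S \<in> K")
    case True
    interpret S: curve_point c S by (rule curve_point.intro) (fact hom S)+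
    have "1 \<le> max 0 (S (inverse x)) + (\<Sum>a\<in>C. max 0 (S (x - c a)))"
    proof (cases "0 \<le> S x")
      case nn: True
      then have "max 0 (S (x - c (v S))) \<le> (\<Sum>a\<in>C. max 0 (S (x - c a)))"
        using True C by (intro member_le_sum) (auto simp: C_def)
      then show ?thesis using v[OF S nn] by simp
    next
      case False
      have "0 \<le> (\<Sum>a\<in>C. max 0 (S (x - c a)))" by (intro sum_nonneg) auto
      then show ?thesis using False by simp
    qed
    then have "int M * 1 \<le> E S" unfolding E_def by (intro mult_left_mono) auto
    then show ?thesis using M[OF True] by simp
  next
    case False
    then show ?thesis using E0[of S] by (simp add: d_def K_def in_keys_iff)
  qed
  have eq: "d S = E S" if S: "S \<in> points c - A" for S
  proof -
    have "S (inverse x) \<le> 0" "\<And>a. a \<in> C \<Longrightarrow> S (x - c a) \<le> 0"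
      using S by (auto simp: A_def Z_def not_less)
    then have "max 0 (S (inverse x)) = 0" "\<And>a. a \<in> C \<Longrightarrow> max 0 (S (x - c a)) = 0"
      by (auto simp: max.absorb1)
    then have "E S = 0" by (simp add: E_def)
    then show ?thesis using S by (simp add: d_def A_def K_def in_keys_iff)
  qed
  have "sections d \<subseteq> vs.span B" using B by (simp add: riemann_roch_space_eq_sections d_def)
  then obtain B' where B': "finite B'" "int (card B') \<le> int (card B) + (\<Sum>S\<in>A. E S - d S)"
    "sections E \<subseteq> vs.span B'"
    using sections_mono_span[of A d E B, OF A le eq B(1)] by auto
  have "2 * (M * (1 + card C)) \<le> card B'"
    using B' unfolding E_def by (intro sections_dim_lower_bound[OF w q C]) (auto simp: M_def)
  then have "2 * (int M * (1 + int (card C))) \<le> int (card B')"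
    by (metis of_nat_1 of_nat_add of_nat_le_iff of_nat_mult of_nat_numeral)
  moreover have "(\<Sum>S\<in>A. E S - d S) = (\<Sum>S\<in>A. E S) - divisor_degree D"
  proof -
    have "Poly_Mapping.keys D \<subseteq> A" by (auto simp: A_def K_def)
    then show ?thesis using divisor_degree_superset[OF A(1), of D] by (simp add: sum_subtractf d_def)
  qed
  \<comment> \<open>With \<open>n = M * (1 + card C)\<close>: the genus gives
    \<open>card B = deg D - 1\<close>, hence
    \<open>card B' \<le> (deg D - 1) + (2 * n - deg D) = 2 * n - 1\<close>, against the lower bound
    \<open>2 * n\<close>.\<close>
  ultimately show False using B'(2) B(3) D(2) sumE by linarith
qed

end

section \<open>Approximation of roots\<close>

text \<open>The Taylor remainder of the power is quadratic in \<open>d\<close>. The bound is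
  relative to the order \<open>j\<close> of \<open>s\<close>, which may be negative. Passing to the
  next exponent multiplies the remainder by \<open>s + d\<close> and adds
  \<open>of_nat (Suc m) * (s ^ m * (d * d))\<close>.\<close>

lemma (in curve_point) power_add_linear_approx:
  assumes s: "vge P j s" and d: "vge P (j + n) d" and n: "0 \<le> n"
  shows "vge P (int (Suc m) * j + 2 * n) ((s + d) ^ Suc m - s ^ Suc m - of_nat (Suc m) * s ^ m * d)"
proof (induction m)
  case (Suc m)
  have sd: "vge P j (s + d)" using n by (intro vge_add s vge_mono[OF d]) simp
  have k: "vge P 0 (of_nat (Suc m))" using vge_const[of "of_nat (Suc m)"] by (simp only: const_of_nat)
  have eq: "(s + d) ^ Suc (Suc m) - s ^ Suc (Suc m) - of_nat (Suc (Suc m)) * s ^ Suc m * d =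
    (s + d) * ((s + d) ^ Suc m - s ^ Suc m - of_nat (Suc m) * s ^ m * d) + of_nat (Suc m) * (s ^ m * (d * d))"
    by (simp add: algebra_simps)
  have "vge P (int m * j + ((j + n) + (j + n))) (s ^ m * (d * d))"
    by (intro vge_mult vge_power s d)
  then have "vge P (0 + (int m * j + ((j + n) + (j + n)))) (of_nat (Suc m) * (s ^ m * (d * d)))"
    by (rule vge_mult[OF k])
  moreover have "vge P (j + (int (Suc m) * j + 2 * n)) ((s + d) * ((s + d) ^ Suc m - s ^ Suc m - of_nat (Suc m) * s ^ m * d))"
    by (rule vge_mult[OF sd Suc])
  ultimately show ?case unfolding eq by (intro vge_add) (auto elim!: vge_mono simp: algebra_simps)
qed simp

text \<open>\<open>T'\<close> restricts to \<open>T\<close> with index one and has residue field k,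
  so both fields have the same completion. This is why roots of an element of the upper field can be
  approximated by elements of the lower one.\<close>

locale unramified_point =
  fixes cK :: "'k::alg_closed_field \<Rightarrow> 'x::field" and cL :: "'k \<Rightarrow> 'w::field" and \<pi> :: "'x \<Rightarrow> 'w"
    and T :: "'x \<Rightarrow> int" and T' :: "'w \<Rightarrow> int"
  assumes hom_K: "field_hom cK" and hom_L: "field_hom cL" and comorphism: "comorphism cK cL \<pi>"
    and T: "T \<in> points cK" and T': "T' \<in> points cL" and T'_\<pi>: "T' (\<pi> a) = T a"
    and residue_T': "vge T' 0 h \<Longrightarrow> \<exists>a. vge T' 1 (h - cL a)"
begin

sublocale T: curve_point cK T by (rule curve_point.intro) (fact hom_K T)+
sublocale T': curve_point cL T' by (rule curve_point.intro) (fact hom_L T')+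

sublocale \<pi>: field_hom \<pi>
  using comorphism by (simp add: comorphism_def)

lemma \<pi>_const [simp]: "\<pi> (cK a) = cL a"
  using comorphism by (simp add: comorphism_def)

text \<open>Dividing by \<open>\<pi> t ^ m\<close> makes \<open>g\<close> a unit; an
  \<open>m\<close>-th root in k of its residue gives the leading coefficient.\<close>

lemma root_start:
  assumes g: "g \<noteq> 0" "T' g = int m * j" and m: "0 < m"
  shows "\<exists>s. s \<noteq> 0 \<and> T s = j \<and> vge T' (int m * j + 1) (\<pi> s ^ m - g)"
proof -
  obtain t where t: "T t = j" "t \<noteq> 0" by (rule T.exists_val)
  define w where "w = \<pi> t ^ m"
  have w: "w \<noteq> 0" "T' w = int m * j" using t by (auto simp: w_def T'.val_power T'_\<pi>)
  have gw: "g / w \<noteq> 0" "T' (g / w) = 0" using g w by (auto simp: T'.val_divide)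
  obtain a where a: "vge T' 1 (g / w - cL a)" using residue_T'[of "g / w"] gw by (auto simp: vge_def)
  have "a \<noteq> 0" using a gw by (auto simp: vge_def)
  obtain d where d: "d ^ m = a" using nth_root_exists[OF m] by blast
  have "d \<noteq> 0" using d \<open>a \<noteq> 0\<close> m by (auto simp: zero_power)
  have eq: "\<pi> (cK d * t) ^ m - g = - (w * (g / w - cL a))"
    using w d by (simp add: \<pi>.hom_mult w_def power_mult_distrib right_diff_distrib T'.c.hom_power[symmetric])
  have "vge T' (int m * j + 1) (\<pi> (cK d * t) ^ m - g)"
    unfolding eq T'.vge_uminus using w by (intro T'.vge_mult_le[OF T'.vge_self a]) simp
  then show ?thesis using t \<open>d \<noteq> 0\<close> by (intro exI[of _ "cK d * t"]) (simp add: T.val_mult)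
qed

text \<open>One Newton step with correction \<open>- (cK b * t)\<close>; \<open>b\<close> is chosen
  to cancel the leading coefficient of the error, and the quadratic remainder is small enough
  because \<open>1 \<le> n\<close>.\<close>

lemma root_step:
  assumes s: "s \<noteq> 0" "T s = j" and m: "of_nat m \<noteq> (0::'k)" and n: "1 \<le> n"
    and approx: "vge T' (int m * j + n) (\<pi> s ^ m - g)"
  shows "\<exists>s'. s' \<noteq> 0 \<and> T s' = j \<and> vge T (j + n) (s' - s) \<and> vge T' (int m * j + n + 1) (\<pi> s' ^ m - g)"
proof -
  obtain m' where m': "m = Suc m'" using m by (cases m) auto
  obtain t where t: "T t = j + n" "t \<noteq> 0" by (rule T.exists_val)
  \<comment> \<open>The derivative of the \<open>m\<close>-th power at \<open>\<pi> s\<close>, times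
    the direction \<open>\<pi> t\<close>; it has exactly the order of the error bound since
    \<open>m\<close> is invertible in k.\<close>
  define w where "w = of_nat m * \<pi> s ^ m' * \<pi> t"
  have "of_nat m = cL (of_nat m)" by simp
  then have k: "(of_nat m :: 'w) \<noteq> 0" "T' (of_nat m) = 0" using m T'.val_const by (metis T'.c.hom_0_iff, metis)
  have "w \<noteq> 0" "T' w = int m' * j + (j + n)"
    using s t k by (auto simp: w_def T'.val_mult T'.val_power T'_\<pi>)
  then have w: "w \<noteq> 0" "T' w = int m * j + n" by (auto simp: m' algebra_simps)
  have "vge T' 0 ((\<pi> s ^ m - g) / w)"
    using approx w by (cases "\<pi> s ^ m - g = 0") (auto simp: vge_def T'.val_divide)
  then obtain b where b: "vge T' 1 ((\<pi> s ^ m - g) / w - cL b)" using residue_T' by blast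
  define d where "d = - (cK b * t)"
  have d: "vge T (j + n) d" unfolding d_def T.vge_uminus
    by (rule T.vge_mult_le[OF T.vge_const T.vge_self]) (simp add: t)
  have s': "s + d \<noteq> 0" "T (s + d) = j"
    using T.val_add_eq[of s d] s T.vge_mono[OF d, of "j + 1"] n by auto
  have \<pi>d: "\<pi> d = - (cL b * \<pi> t)" by (simp add: d_def \<pi>.hom_uminus \<pi>.hom_mult)
  have E: "vge T' (int m * j + 2 * n) ((\<pi> s + \<pi> d) ^ m - \<pi> s ^ m - of_nat m * \<pi> s ^ m' * \<pi> d)"
    unfolding m' using s d n
    by (intro T'.power_add_linear_approx) (auto simp: vge_def T'_\<pi>)
  have eq: "\<pi> (s + d) ^ m - g =
    ((\<pi> s + \<pi> d) ^ m - \<pi> s ^ m - of_nat m * \<pi> s ^ m' * \<pi> d) + w * ((\<pi> s ^ m - g) / w - cL b)"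
  proof -
    have "of_nat m * \<pi> s ^ m' * \<pi> d = - (w * cL b)" by (simp add: w_def \<pi>d algebra_simps)
    moreover have "w * ((\<pi> s ^ m - g) / w - cL b) = (\<pi> s ^ m - g) - w * cL b"
      using w by (simp add: right_diff_distrib[of w "(\<pi> s ^ m - g) / w"])
    ultimately show ?thesis by (simp add: \<pi>.hom_add)
  qed
  have "vge T' (int m * j + n + 1) (\<pi> (s + d) ^ m - g)"
    unfolding eq using w n
    by (intro T'.vge_add T'.vge_mult_le[OF T'.vge_self b] T'.vge_mono[OF E]) auto
  then show ?thesis using s' d by (intro exI[of _ "s + d"]) simp
qed

text \<open>Used twice: for square roots of \<open>x\<close> with \<open>id\<close> as comorphism,
  and for cube roots of \<open>g\<close> along W \<rightarrow> X.\<close>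

lemma root_sequence:
  assumes g: "g \<noteq> 0" "T' g = int m * j" and m: "of_nat m \<noteq> (0::'k)"
  shows "\<exists>s. \<forall>n. (s n \<noteq> 0 \<and> T (s n) = j \<and> vge T' (int m * j + 1 + int n) (\<pi> (s n) ^ m - g)) \<and>
    vge T (j + 1 + int n) (s (Suc n) - s n)"
proof -
  have "0 < m" using m by (cases m) auto
  then have "\<exists>s. s \<noteq> 0 \<and> T s = j \<and> vge T' (int m * j + 1 + int 0) (\<pi> s ^ m - g)"
    using root_start[OF g] by simp
  moreover have "\<exists>s'. (s' \<noteq> 0 \<and> T s' = j \<and> vge T' (int m * j + 1 + int (Suc n)) (\<pi> s' ^ m - g)) \<and>
      vge T (j + 1 + int n) (s' - s)"
    if "s \<noteq> 0 \<and> T s = j \<and> vge T' (int m * j + 1 + int n) (\<pi> s ^ m - g)" for s n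
    using root_step[of s j m "1 + int n" g] that m by (auto simp: add_ac)
  ultimately show ?thesis by (rule dependent_nat_choice)
qed

end

section \<open>Points on the double cover\<close>

locale double_cover =
  fixes cX :: "'k::alg_closed_field \<Rightarrow> 'x::field" and cW :: "'k \<Rightarrow> 'w::field"
    and \<pi> :: "'x \<Rightarrow> 'w" and \<sigma> :: "'w \<Rightarrow> 'w" and x :: 'x and u :: 'w
  assumes hom_X: "field_hom cX" and hom_W: "field_hom cW" and char_2: "(2::'k) \<noteq> 0"
    and comorphism_\<pi>: "comorphism cX cW \<pi>" and comorphism_\<sigma>: "comorphism cW cW \<sigma>"
    and \<sigma>_\<pi> [simp]: "\<sigma> (\<pi> a) = \<pi> a" and \<sigma>_u [simp]: "\<sigma> u = - u" and u_sq: "u\<^sup>2 = \<pi> x"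
    and u_neq_0: "u \<noteq> 0" and spanned: "\<exists>a b. h = \<pi> a + \<pi> b * u"
begin

sublocale cX: field_hom cX by (rule hom_X)
sublocale cW: field_hom cW by (rule hom_W)
sublocale \<pi>: field_hom \<pi> using comorphism_\<pi> by (simp add: comorphism_def)
sublocale \<sigma>: field_hom \<sigma> using comorphism_\<sigma> by (simp add: comorphism_def)

lemma \<pi>_const [simp]: "\<pi> (cX a) = cW a" and \<sigma>_const [simp]: "\<sigma> (cW a) = cW a"
  using comorphism_\<pi> comorphism_\<sigma> by (simp_all add: comorphism_def)

lemma two_neq_0: "(2::'w) \<noteq> 0"
proof
  assume "(2::'w) = 0"
  moreover have "cW 2 = 2" using cW.hom_add[of 1 1] by simp
  ultimately show False using char_2 by (metis cW.hom_0_iff)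
qed

lemma coordinates_unique:
  assumes "\<pi> a + \<pi> b * u = \<pi> a' + \<pi> b' * u"
  shows "a = a' \<and> b = b'"
proof -
  define p q where "p = \<pi> (a - a')" and "q = \<pi> (b - b')"
  have 1: "p + q * u = 0" using assms by (simp add: p_def q_def \<pi>.hom_minus algebra_simps)
  then have "\<sigma> (p + q * u) = 0" by simp
  then have 2: "p - q * u = 0" by (simp add: p_def q_def \<sigma>.hom_add \<sigma>.hom_mult)
  have "2 * p = (p + q * u) + (p - q * u)" "2 * (q * u) = (p + q * u) - (p - q * u)" by simp_all
  then have "2 * p = 0" "2 * (q * u) = 0" using 1 2 by simp_all
  then have "p = 0" "q = 0" using two_neq_0 u_neq_0 by auto
  then show ?thesis by (auto simp: p_def q_def)
qed

text \<open>Descent along the involution, by comparing coordinates with respect to 1 and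
  \<open>u\<close>; this is where \<alpha> comes from.\<close>

lemma fixed_imp_range: 
  assumes "\<sigma> h = h"
  shows "\<exists>a. h = \<pi> a"
proof -
  obtain a b where h: "h = \<pi> a + \<pi> b * u" using spanned by blast
  then have "\<pi> a + \<pi> b * u = \<pi> a + \<pi> (- b) * u"
    using assms by (simp add: \<sigma>.hom_add \<sigma>.hom_mult \<pi>.hom_uminus)
  then have "b = - b" using coordinates_unique by blast
  then have "\<pi> b = - \<pi> b" by (metis \<pi>.hom_uminus)
  then have "2 * \<pi> b = 0" by (simp add: eq_neg_iff_add_eq_0)
  then have "\<pi> b = 0" using two_neq_0 by simp
  then show ?thesis using h by auto
qed

definition coord0 where "coord0 h = (SOME a. \<exists>b. h = \<pi> a + \<pi> b * u)"
definition coord1 where "coord1 h = (SOME b. h = \<pi> (coord0 h) + \<pi> b * u)"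

lemma coords: "h = \<pi> (coord0 h) + \<pi> (coord1 h) * u"
proof -
  have "\<exists>b. h = \<pi> (coord0 h) + \<pi> b * u" unfolding coord0_def by (rule someI_ex) (rule spanned)
  then show ?thesis unfolding coord1_def by (rule someI_ex)
qed

lemma coordsI: "h = \<pi> a + \<pi> b * u \<Longrightarrow> coord0 h = a \<and> coord1 h = b"
  using coordinates_unique coords[of h] by metis

lemma coords_add: "coord0 (h + h') = coord0 h + coord0 h' \<and> coord1 (h + h') = coord1 h + coord1 h'"
  by (rule coordsI) (subst (1 2) coords, simp add: \<pi>.hom_add algebra_simps)

lemma coords_mult: "coord0 (h * h') = coord0 h * coord0 h' + coord1 h * coord1 h' * x \<and>
    coord1 (h * h') = coord0 h * coord1 h' + coord1 h * coord0 h'"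
proof (rule coordsI)
  define a b a' b' where "a = coord0 h" "b = coord1 h" "a' = coord0 h'" "b' = coord1 h'"
  have "h * h' = (\<pi> a + \<pi> b * u) * (\<pi> a' + \<pi> b' * u)"
    unfolding a_b_a'_b'_def by (simp flip: coords)
  also have "\<dots> = \<pi> (a * a' + b * b' * x) + \<pi> (a * b' + b * a') * u"
    by (simp add: \<pi>.hom_add \<pi>.hom_mult u_sq[symmetric] power2_eq_square algebra_simps)
  finally show "h * h' = \<pi> (coord0 h * coord0 h' + coord1 h * coord1 h' * x) +
    \<pi> (coord0 h * coord1 h' + coord1 h * coord0 h') * u" by (simp add: a_b_a'_b'_def)
qed

lemma coords_\<pi>: "coord0 (\<pi> a) = a \<and> coord1 (\<pi> a) = 0"
  by (rule coordsI) simp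

end

text \<open>
  If \<open>r\<^sub>n\<close> converges \<open>T\<close>-adically to a square root of \<open>x\<close>, then a point above \<open>T\<close> is obtained by
  substituting \<open>r\<^sub>n\<close> for \<open>u\<close>: the order of \<open>a + b r\<^sub>n\<close> at \<open>T\<close> is eventually constant.
\<close>
locale split_point = double_cover +
  fixes T :: "'b \<Rightarrow> int" and r :: "nat \<Rightarrow> 'b" and j :: int
  assumes T: "T \<in> points cX"
    and r_val: "T (r n) = j"
    and r_cauchy: "vge T (j + 1 + int n) (r (Suc n) - r n)"
    and r_sq: "vge T (2 * j + 1 + int n) (r n ^ 2 - x)"
begin

sublocale T: curve_point cX T by (rule curve_point.intro) (fact hom_X T)+

definition subst_u where "subst_u n h = coord0 h + coord1 h * r n"

lemma subst_u_add: "subst_u n (h + h') = subst_u n h + subst_u n h'"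
  by (simp add: subst_u_def coords_add algebra_simps)

text \<open>Substitution is multiplicative only in the limit; the defect is a multiple of
  \<open>r n ^ 2 - x\<close>, which tends to 0.\<close>

lemma subst_u_mult:
  "subst_u n (h * h') - subst_u n h * subst_u n h' = - (coord1 h * coord1 h' * (r n ^ 2 - x))"
  by (simp add: subst_u_def coords_mult algebra_simps power2_eq_square)

lemma subst_u_\<pi> [simp]: "subst_u n (\<pi> a) = a"
  by (simp add: subst_u_def coords_\<pi>)

text \<open>The product of \<open>a + b * r n\<close> with its conjugate tends to the nonzero norm
  \<open>N\<close>, and the order of the conjugate is bounded below by \<open>\<mu>\<close>. So the
  order of \<open>a + b * r n\<close> stays bounded above, and from some \<open>n\<close> on the
  Cauchy increments are too small to change it.\<close>

lemma eventually_constant: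
  assumes "h \<noteq> 0"
  shows "\<exists>v. \<forall>\<^sub>F n in sequentially. subst_u n h \<noteq> 0 \<and> T (subst_u n h) = v"
proof -
  define a b where "a = coord0 h" and "b = coord1 h"
  have h: "h = \<pi> a + \<pi> b * u" unfolding a_def b_def by (rule coords)
  define N where "N = a\<^sup>2 - b\<^sup>2 * x"
  have "\<pi> N = h * \<sigma> h"
    by (simp add: N_def h \<pi>.hom_minus \<pi>.hom_mult \<pi>.hom_power \<sigma>.hom_add \<sigma>.hom_mult u_sq[symmetric]
        power2_eq_square algebra_simps)
  then have N: "N \<noteq> 0" using assms by auto
  define \<mu> where "\<mu> = min (T a) (T b + j)"
  \<comment> \<open>A crude precision from which the error in the norm has order above
    \<open>T N\<close> and each increment has order above \<open>T N - \<mu>\<close>.\<close>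
  define k where "k = nat (\<bar>T N\<bar> + 2 * \<bar>T b\<bar> + 2 * \<bar>j\<bar> + \<bar>\<mu>\<bar> + 1)"
  have bounded: "subst_u n h \<noteq> 0 \<and> T (subst_u n h) \<le> T N - \<mu>" if n: "k \<le> n" for n
  proof -
    have eq: "(a + b * r n) * (a - b * r n) = N + - (b\<^sup>2 * (r n ^ 2 - x))"
      by (simp add: N_def algebra_simps power2_eq_square)
    have "vge T (2 * T b + (2 * j + 1 + int n)) (b\<^sup>2 * (r n ^ 2 - x))"
      by (intro T.vge_mult r_sq) (use T.vge_power[OF T.vge_self[of b], of 2] in simp)
    then have "vge T (T N + 1) (- (b\<^sup>2 * (r n ^ 2 - x)))"
      using n by (auto elim!: T.vge_mono simp: k_def)
    from T.val_add_eq[OF N this] have p: "(a + b * r n) * (a - b * r n) \<noteq> 0"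
      "T ((a + b * r n) * (a - b * r n)) = T N" unfolding eq by auto
    have "vge T \<mu> (a - b * r n)"
      by (intro T.vge_diff T.vge_mono[OF T.vge_self] T.vge_mult_le[OF T.vge_self T.vge_self])
        (auto simp: \<mu>_def r_val)
    then show ?thesis using p T.val_mult[of "a + b * r n" "a - b * r n"]
      by (auto simp: subst_u_def a_def[symmetric] b_def[symmetric] vge_def)
  qed
  have step: "T (subst_u (Suc n) h) = T (subst_u n h)" if n: "k \<le> n" for n
  proof -
    have "subst_u (Suc n) h - subst_u n h = b * (r (Suc n) - r n)"
      by (simp add: subst_u_def a_def[symmetric] b_def[symmetric] algebra_simps)
    moreover have "vge T (T b + (j + 1 + int n)) (b * (r (Suc n) - r n))"
      by (intro T.vge_mult T.vge_self r_cauchy)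
    moreover have "T (subst_u n h) + 1 \<le> T b + (j + 1 + int n)"
      using bounded[OF n] n by (auto simp: k_def)
    ultimately have "vge T (T (subst_u n h) + 1) (subst_u (Suc n) h - subst_u n h)"
      using T.vge_mono by metis
    then show ?thesis using T.val_eqI bounded[OF n] by blast
  qed
  have "T (subst_u n h) = T (subst_u k h)" if "k \<le> n" for n
    using that by (induction n rule: dec_induct) (auto simp: step)
  then show ?thesis
    using bounded by (intro exI[of _ "T (subst_u k h)"] eventually_sequentiallyI[of k]) blast
qed

definition lift_val where
  "lift_val h = (if h = 0 then 0 else SOME v. \<forall>\<^sub>F n in sequentially. subst_u n h \<noteq> 0 \<and> T (subst_u n h) = v)"

lemma lift_val_eventually:
  assumes "h \<noteq> 0"
  shows "\<forall>\<^sub>F n in sequentially. subst_u n h \<noteq> 0 \<and> T (subst_u n h) = lift_val h"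
  using someI_ex[OF eventually_constant[OF assms]] assms by (simp add: lift_val_def)

lemma lift_val_\<pi>: "lift_val (\<pi> a) = T a"
proof (cases "a = 0")
  case False
  then have "\<forall>\<^sub>F n in sequentially. T (subst_u n (\<pi> a)) = lift_val (\<pi> a)"
    using lift_val_eventually[of "\<pi> a"] by (auto elim: eventually_mono)
  then show ?thesis by simp
qed (simp add: lift_val_def)

text \<open>The orders of both factors are eventually fixed, while the order of the multiplicativity
  defect grows with \<open>n\<close>.\<close>

lemma lift_val_mult:
  assumes h: "h \<noteq> 0" "h' \<noteq> 0"
  shows "lift_val (h * h') = lift_val h + lift_val h'"
proof -
  have hh: "h * h' \<noteq> 0" using h by simp
  define K where "K = T (coord1 h) + T (coord1 h') + (2 * j + 1)"
  have "\<forall>\<^sub>F n in sequentially. nat (lift_val h + lift_val h' + 1 - K) \<le> n"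
    by (rule eventually_ge_at_top)
  then have "\<forall>\<^sub>F n in sequentially. lift_val (h * h') = lift_val h + lift_val h'"
    using lift_val_eventually[OF h(1)] lift_val_eventually[OF h(2)] lift_val_eventually[OF hh]
  proof eventually_elim
    case (elim n)
    have "vge T (K + int n) (coord1 h * coord1 h' * (r n ^ 2 - x))"
      by (rule T.vge_mult_le[OF T.vge_mult[OF T.vge_self T.vge_self] r_sq]) (simp add: K_def)
    then have "vge T (K + int n) (subst_u n (h * h') - subst_u n h * subst_u n h')"
      unfolding subst_u_mult T.vge_uminus .
    then have "vge T (T (subst_u n h * subst_u n h') + 1) (subst_u n (h * h') - subst_u n h * subst_u n h')"
      using elim by (auto elim!: T.vge_mono simp: T.val_mult)
    then have "T (subst_u n (h * h')) = T (subst_u n h * subst_u n h')"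
      using T.val_eqI elim by (metis mult_eq_0_iff)
    then show ?case using elim by (simp add: T.val_mult)
  qed
  then show ?thesis by simp
qed

lemma lift_val_add:
  assumes h: "h \<noteq> 0" "h' \<noteq> 0" "h + h' \<noteq> 0"
  shows "min (lift_val h) (lift_val h') \<le> lift_val (h + h')"
proof -
  have "\<forall>\<^sub>F n in sequentially. min (lift_val h) (lift_val h') \<le> lift_val (h + h')"
    using lift_val_eventually[OF h(1)] lift_val_eventually[OF h(2)] lift_val_eventually[OF h(3)]
  proof eventually_elim
    case (elim n)
    then show ?case using T.val_add[of "subst_u n h" "subst_u n h'"] by (simp add: subst_u_add)
  qed
  then show ?thesis by simp
qed

lemma lift_val_point: "lift_val \<in> points cW"
proof -
  obtain t where "T t = 1" "t \<noteq> 0" by (rule T.uniformizer)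
  then have "lift_val (\<pi> t) = 1" by (simp add: lift_val_\<pi>)
  moreover have "lift_val (cW a) = 0" for a using lift_val_\<pi>[of "cX a"] by simp
  ultimately show ?thesis
    unfolding points_def using lift_val_mult lift_val_add by (auto simp: lift_val_def[of 0])
qed

end

section \<open>Cubic extensions that are totally ramified at a point\<close>

text \<open>The norm of \<open>a + b z + c z ^ 2\<close> where \<open>z ^ 3 = p z + q\<close>. As a
  plain polynomial it is available before the cubic is known to be irreducible.\<close>

definition norm3 :: "'x::field \<Rightarrow> 'x \<Rightarrow> 'x \<Rightarrow> 'x \<Rightarrow> 'x \<Rightarrow> 'x" where
  "norm3 p q a b c = a ^ 3 + b ^ 3 * q + c ^ 3 * q ^ 2 - 3 * (a * b * c * q) + 2 * (p * a ^ 2 * c)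
     + p ^ 2 * a * c ^ 2 - p * a * b ^ 2 - p * b * c ^ 2 * q"

lemma norm3_mult:
  "norm3 p q (a * a' + q * (b * c' + c * b')) (a * b' + b * a' + p * (b * c' + c * b') + q * (c * c'))
     (a * c' + b * b' + c * a' + p * (c * c')) = norm3 p q a b c * norm3 p q a' b' c'"
  unfolding norm3_def by (simp add: algebra_simps power2_eq_square power3_eq_cube)

text \<open>The cofactor is the product of the other two conjugates, expressed in 1,
  \<open>z\<close>, \<open>z ^ 2\<close>.\<close>

lemma norm3_adjugate:
  fixes z :: "'y::field"
  assumes "z ^ 3 = p * z + q"
  shows "(a + b * z + c * z ^ 2) *
    (((a + c * p) ^ 2 - b * (c * q + b * p)) + (c * (c * q + b * p) - b * (a + c * p)) * z + (b ^ 2 - c * (a + c * p)) * z ^ 2)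
    = norm3 p q a b c"
proof -
  have z3: "z * (z * z) = p * z + q" using assms by (simp add: power3_eq_cube mult.assoc)
  \<comment> \<open>The same reduction with a trailing factor, to match the right-nested products
    that \<open>algebra_simps\<close> produces.\<close>
  have z4: "z * (z * (z * r)) = p * (z * r) + q * r" for r using z3 by (metis distrib_right mult.assoc)
  show ?thesis unfolding norm3_def by (simp add: algebra_simps power2_eq_square power3_eq_cube z3 z4)
qed

lemma cubic_mult:
  fixes z :: "'y::field"
  assumes "z ^ 3 = p * z + q"
  shows "(a + b * z + c * z ^ 2) * (a' + b' * z + c' * z ^ 2) = (a * a' + q * (b * c' + c * b')) +
    (a * b' + b * a' + p * (b * c' + c * b') + q * (c * c')) * z + (a * c' + b * b' + c * a' + p * (c * c')) * z ^ 2"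
proof -
  have z3: "z * (z * z) = p * z + q" using assms by (simp add: power3_eq_cube mult.assoc)
  have z4: "z * (z * (z * r)) = p * (z * r) + q * r" for r using z3 by (metis distrib_right mult.assoc)
  show ?thesis by (simp add: algebra_simps power2_eq_square z3 z4)
qed

lemma irreducible_cubic:
  fixes p :: "'x::field poly"
  assumes deg: "degree p = 3" and no_root: "\<And>z. poly p z \<noteq> 0"
  shows "irreducible p"
proof (rule irreducibleI)
  show "p \<noteq> 0" using deg by auto
  show "\<not> p dvd 1" using deg by (auto simp: is_unit_iff_degree)
  fix a b assume ab: "p = a * b"
  then have nz: "a \<noteq> 0" "b \<noteq> 0" using \<open>p \<noteq> 0\<close> by auto
  have no_linear: "degree f \<noteq> 1" if "f dvd p" for f
  proof
    assume "degree f = 1"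
    then obtain s t where f: "f = [:s, t:]" "t \<noteq> 0" by (rule degree1_coeffs)
    then have "poly f (- s / t) = 0" by simp
    then show False using no_root[of "- s / t"] that by (metis dvd_def mult_zero_left poly_mult)
  qed
  have "degree a + degree b = 3" using deg ab nz by (simp add: degree_mult_eq)
  moreover have "degree a \<noteq> 1" "degree b \<noteq> 1" using no_linear ab by auto
  ultimately have "degree a = 0 \<or> degree b = 0" by linarith
  then show "a dvd 1 \<or> b dvd 1" using nz by (auto simp: is_unit_iff_degree)
qed

lemma (in curve_point) numeral_vge [simp]: "vge P 0 (numeral k)"
  using vge_const[of "of_nat (numeral k)"] unfolding const_of_nat by simp

text \<open>A pole of \<open>q\<close> forces a pole of \<open>z\<close>, and there
  \<open>z ^ 3\<close> dominates \<open>p * z\<close>. Applied on X this excludes roots; applied on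
  Y it makes 3 divide the ramification index.\<close>

lemma (in curve_point) cubic_root_val:
  assumes z: "z ^ 3 = p * z + q" and p: "vge P 0 p" and q: "P q < 0"
  shows "z \<noteq> 0" "3 * P z = P q"
proof -
  have q0: "q \<noteq> 0" using q by auto
  show z0: "z \<noteq> 0" using z q0 by auto
  have q_eq: "q = z ^ 3 + - (p * z)" using z by simp
  have "P z < 0"
  proof (rule ccontr)
    assume "\<not> P z < 0"
    then have "vge P 0 z" by (simp add: vge_def)
    then have "vge P 0 (z ^ 3)" "vge P 0 (p * z)" using vge_power[of 0 z 3] vge_mult[OF p] by auto
    then have "vge P 0 q" unfolding q_eq by (intro vge_add) auto
    then show False using q q0 by (simp add: vge_def)
  qed
  moreover have v: "P (z ^ 3) = 3 * P z" using val_power[OF z0, of 3] by simp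
  ultimately have "vge P (P (z ^ 3) + 1) (- (p * z))"
    unfolding vge_uminus by (intro vge_mult_le[OF p vge_self]) simp
  from val_add_eq(2)[OF _ this] show "3 * P z = P q" using z0 v q_eq by simp
qed

section \<open>The norm and the valuation above P\<close>

locale totally_ramified_cubic =
  fixes cX :: "'k::alg_closed_field \<Rightarrow> 'x::field" and P :: "'x \<Rightarrow> int"
    and \<phi> :: "'x \<Rightarrow> 'y::field" and z :: 'y and p q :: 'x
  assumes hom_X: "field_hom cX" and P: "P \<in> points cX" and hom_\<phi>: "field_hom \<phi>"
    and z_cubic: "z ^ 3 = \<phi> p * z + \<phi> q"
    and generates: "generated_subfield (insert z (range \<phi>)) = UNIV"
    and p_vge: "vge P 0 p" and q_neg: "P q < 0" and q_3: "\<not> 3 dvd P q"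
begin

sublocale P: curve_point cX P by (rule curve_point.intro) (fact hom_X P)+
sublocale \<phi>: field_hom \<phi> by (rule hom_\<phi>)

abbreviation elt where "elt a b c \<equiv> \<phi> a + \<phi> b * z + \<phi> c * z ^ 2"
abbreviation "N \<equiv> norm3 p q"

lemma q_neq_0: "q \<noteq> 0" using q_neg by auto

text \<open>The order of \<open>a + b z + c z\<^sup>2\<close> above \<open>P\<close>, normalised so that \<open>z\<close> has order \<open>P q\<close>, is \<open>\<ge> \<mu>\<close>.\<close>
definition weight_ge where
  "weight_ge \<mu> a b c \<longleftrightarrow> (a = 0 \<or> \<mu> \<le> 3 * P a) \<and> (b = 0 \<or> \<mu> \<le> 3 * P b + P q) \<and> (c = 0 \<or> \<mu> \<le> 3 * P c + 2 * P q)"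

definition weight_eq where
  "weight_eq \<mu> a b c \<longleftrightarrow> weight_ge \<mu> a b c \<and>
     (a \<noteq> 0 \<and> \<mu> = 3 * P a \<or> b \<noteq> 0 \<and> \<mu> = 3 * P b + P q \<or> c \<noteq> 0 \<and> \<mu> = 3 * P c + 2 * P q)"

text \<open>As \<open>P q\<close> is prime to 3, the numbers 0, \<open>P q\<close> and
  \<open>2 * P q\<close> lie in different classes modulo 3.\<close>

lemma weights_distinct: "3 * i \<noteq> 3 * k + P q" "3 * i \<noteq> 3 * k + 2 * P q" "3 * i + P q \<noteq> 3 * k + 2 * P q"
  using q_3 by presburger+

lemma weight_exists:
  assumes "\<not> (a = 0 \<and> b = 0 \<and> c = 0)"
  shows "\<exists>\<mu>. weight_eq \<mu> a b c"
proof -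
  define A where "A = (if a = 0 then {} else {3 * P a}) \<union> (if b = 0 then {} else {3 * P b + P q}) \<union>
    (if c = 0 then {} else {3 * P c + 2 * P q})"
  have A: "finite A" "A \<noteq> {}" using assms by (auto simp: A_def)
  have "weight_ge (Min A) a b c" using Min_le[OF A(1)] by (auto simp: weight_ge_def A_def)
  moreover have "Min A \<in> A" using A by simp
  ultimately have "weight_eq (Min A) a b c" unfolding weight_eq_def by (auto simp: A_def split: if_splits)
  then show ?thesis ..
qed

lemma norm3_val:
  assumes w: "weight_eq \<mu> a b c"
  shows "N a b c \<noteq> 0" "P (N a b c) = \<mu>"
proof -
  have ge: "weight_ge \<mu> a b c" using w by (simp add: weight_eq_def)
  note vs = weight_ge_def vge_def P.val_mult P.val_power q_neq_0
  have p0: "p = 0 \<or> 0 \<le> P p" using p_vge by (simp add: vge_def)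
  \<comment> \<open>Three times this order is the sum of the weights of \<open>a\<close>,
    \<open>b z\<close> and \<open>c z ^ 2\<close>; each is at least \<open>\<mu>\<close>, and they
    are not all equal.\<close>
  have c1: "vge P (\<mu> + 1) (a * b * c * q)"
    using ge weights_distinct(1)[of "P a" "P b"] by (cases "a = 0 \<or> b = 0 \<or> c = 0") (auto simp: vs)
  \<comment> \<open>For this and the other terms containing \<open>p\<close>, three times the order
    exceeds \<open>3 * \<mu>\<close> by at least a positive multiple of
    \<open>- P q\<close>.\<close>
  have c2: "vge P (\<mu> + 1) (p * a ^ 2 * c)"
    using ge q_neg p0 by (cases "a = 0 \<or> p = 0 \<or> c = 0") (auto simp: vs)
  have c3: "vge P (\<mu> + 1) (p ^ 2 * a * c ^ 2)"
    using ge q_neg p0 by (cases "a = 0 \<or> p = 0 \<or> c = 0") (auto simp: vs)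
  have c4: "vge P (\<mu> + 1) (p * a * b ^ 2)"
    using ge q_neg p0 by (cases "a = 0 \<or> p = 0 \<or> b = 0") (auto simp: vs)
  have c5: "vge P (\<mu> + 1) (p * b * c ^ 2 * q)"
    using ge q_neg p0 by (cases "b = 0 \<or> p = 0 \<or> c = 0") (auto simp: vs)
  have m: "vge P (\<mu> + 1) (numeral k * h)" if "vge P (\<mu> + 1) h" for k h
    using P.vge_mult_le[OF P.numeral_vge that] by simp
  define R where "R = 2 * (p * a ^ 2 * c) + p ^ 2 * a * c ^ 2 - 3 * (a * b * c * q) - p * a * b ^ 2 - p * b * c ^ 2 * q"
  have R: "vge P (\<mu> + 1) R" unfolding R_def by (intro P.vge_add P.vge_diff m c1 c2 c3 c4 c5)
  have N_eq: "N a b c = a ^ 3 + b ^ 3 * q + c ^ 3 * q ^ 2 + R" by (simp add: norm3_def R_def)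
  have "N a b c \<noteq> 0 \<and> P (N a b c) = \<mu>"
    using w unfolding weight_eq_def
  proof (elim conjE disjE)
    assume a: "a \<noteq> 0" "\<mu> = 3 * P a"
    have "vge P (\<mu> + 1) (b ^ 3 * q)"
      using ge a weights_distinct(1)[of "P a" "P b"] by (cases "b = 0") (auto simp: vs)
    moreover have "vge P (\<mu> + 1) (c ^ 3 * q ^ 2)"
      using ge a weights_distinct(2)[of "P a" "P c"] by (cases "c = 0") (auto simp: vs)
    ultimately have "vge P (\<mu> + 1) (b ^ 3 * q + c ^ 3 * q ^ 2 + R)" using R by (intro P.vge_add)
    moreover have "P (a ^ 3) = \<mu>" using a by (simp add: P.val_power)
    ultimately show ?thesis using P.val_add_eq[of "a ^ 3" "b ^ 3 * q + c ^ 3 * q ^ 2 + R"] a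
      by (simp add: N_eq add.assoc)
  next
    assume b: "b \<noteq> 0" "\<mu> = 3 * P b + P q"
    have "vge P (\<mu> + 1) (a ^ 3)"
      using ge b weights_distinct(1)[of "P a" "P b"] by (cases "a = 0") (auto simp: vs)
    moreover have "vge P (\<mu> + 1) (c ^ 3 * q ^ 2)"
      using ge b weights_distinct(3)[of "P b" "P c"] by (cases "c = 0") (auto simp: vs)
    ultimately have "vge P (\<mu> + 1) (a ^ 3 + c ^ 3 * q ^ 2 + R)" using R by (intro P.vge_add)
    moreover have "P (b ^ 3 * q) = \<mu>" using b q_neq_0 by (simp add: P.val_power P.val_mult)
    ultimately show ?thesis using P.val_add_eq[of "b ^ 3 * q" "a ^ 3 + c ^ 3 * q ^ 2 + R"] b q_neq_0
      by (simp add: N_eq add_ac)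
  next
    assume c: "c \<noteq> 0" "\<mu> = 3 * P c + 2 * P q"
    have "vge P (\<mu> + 1) (a ^ 3)"
      using ge c weights_distinct(2)[of "P a" "P c"] by (cases "a = 0") (auto simp: vs)
    moreover have "vge P (\<mu> + 1) (b ^ 3 * q)"
      using ge c weights_distinct(3)[of "P b" "P c"] by (cases "b = 0") (auto simp: vs)
    ultimately have "vge P (\<mu> + 1) (a ^ 3 + b ^ 3 * q + R)" using R by (intro P.vge_add)
    moreover have "P (c ^ 3 * q ^ 2) = \<mu>" using c q_neq_0 by (simp add: P.val_power P.val_mult)
    ultimately show ?thesis using P.val_add_eq[of "c ^ 3 * q ^ 2" "a ^ 3 + b ^ 3 * q + R"] c q_neq_0
      by (simp add: N_eq add_ac)
  qed
  then show "N a b c \<noteq> 0" "P (N a b c) = \<mu>" by auto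
qed

lemma norm3_eq_0_iff: "N a b c = 0 \<longleftrightarrow> a = 0 \<and> b = 0 \<and> c = 0"
  using weight_exists[of a b c] norm3_val(1) by (auto simp: norm3_def)

text \<open>The norm is multiplicative but not additive, whereas coordinatewise bounds are additive;
  this equivalence yields the ultrametric inequality for \<open>upper_val\<close>.\<close>

lemma weight_ge_iff_norm3: "weight_ge \<mu> a b c \<longleftrightarrow> vge P \<mu> (N a b c)"
proof (cases "a = 0 \<and> b = 0 \<and> c = 0")
  case False
  then obtain \<nu> where \<nu>: "weight_eq \<nu> a b c" using weight_exists by blast
  have "vge P \<mu> (N a b c) \<longleftrightarrow> \<mu> \<le> \<nu>" using norm3_val[OF \<nu>] by (simp add: vge_def)
  then show ?thesis using \<nu> unfolding weight_eq_def weight_ge_def by auto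
qed (simp add: weight_ge_def norm3_def)

lemma \<phi>_numeral [simp]: "\<phi> (numeral k) = numeral k"
proof -
  have "\<phi> (of_nat n) = of_nat n" for n by (induction n) (simp_all add: \<phi>.hom_add)
  from this[of "numeral k"] show ?thesis by simp
qed

lemma \<phi>_norm3: "\<phi> (N a b c) = norm3 (\<phi> p) (\<phi> q) (\<phi> a) (\<phi> b) (\<phi> c)"
  by (simp add: norm3_def \<phi>.hom_add \<phi>.hom_minus \<phi>.hom_mult \<phi>.hom_power)

lemma elt_adjugate:
  "elt a b c * elt ((a + c * p) ^ 2 - b * (c * q + b * p)) (c * (c * q + b * p) - b * (a + c * p))
     (b ^ 2 - c * (a + c * p)) = \<phi> (N a b c)"
  using norm3_adjugate[OF z_cubic, of "\<phi> a" "\<phi> b" "\<phi> c"]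
  by (simp add: \<phi>_norm3 \<phi>.hom_add \<phi>.hom_minus \<phi>.hom_mult \<phi>.hom_power)

lemma elt_eq_0_iff: "elt a b c = 0 \<longleftrightarrow> a = 0 \<and> b = 0 \<and> c = 0"
proof
  assume "elt a b c = 0"
  then have "\<phi> (N a b c) = 0" using elt_adjugate[of a b c] by simp
  then show "a = 0 \<and> b = 0 \<and> c = 0" by (simp add: norm3_eq_0_iff)
qed simp

lemma elt_add: "elt a b c + elt a' b' c' = elt (a + a') (b + b') (c + c')"
  by (simp add: \<phi>.hom_add algebra_simps)

lemma elt_mult: "elt a b c * elt a' b' c' =
    elt (a * a' + q * (b * c' + c * b')) (a * b' + b * a' + p * (b * c' + c * b') + q * (c * c'))
     (a * c' + b * b' + c * a' + p * (c * c'))"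
  unfolding \<phi>.hom_add \<phi>.hom_mult by (rule cubic_mult[OF z_cubic])

lemma elt_unique:
  assumes "elt a b c = elt a' b' c'"
  shows "a = a' \<and> b = b' \<and> c = c'"
proof -
  have "elt (a - a') (b - b') (c - c') = 0" using assms by (simp add: \<phi>.hom_minus algebra_simps)
  then show ?thesis unfolding elt_eq_0_iff by simp
qed

text \<open>The expressions form a subfield because the adjugate divided by the norm is again such
  an expression.\<close>

lemma elt_surj: "\<exists>a b c. h = elt a b c"
proof -
  let ?S = "{elt a b c | a b c. True}"
  have I: "h \<in> ?S" if "h = elt a b c" for h a b c using that by blast
  have "is_subfield ?S"
    unfolding is_subfield_def
  proof (intro conjI ballI)
    show "0 \<in> ?S" by (rule I[of _ 0 0 0]) simp
    show "1 \<in> ?S" by (rule I[of _ 1 0 0]) simp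
  next
    fix h assume "h \<in> ?S"
    then obtain a b c where h: "h = elt a b c" by blast
    show "- h \<in> ?S" by (rule I[of _ "- a" "- b" "- c"]) (simp add: h \<phi>.hom_uminus)
    show "inverse h \<in> ?S"
    proof (cases "h = 0")
      case True
      then show ?thesis by (intro I[of _ 0 0 0]) simp
    next
      case False
      then have N: "\<phi> (N a b c) \<noteq> 0" using elt_eq_0_iff[of a b c] by (simp add: h norm3_eq_0_iff)
      obtain a' b' c' where h': "h * elt a' b' c' = \<phi> (N a b c)" unfolding h using elt_adjugate by blast
      have "inverse h = elt a' b' c' / \<phi> (N a b c)"
        using h' N False by (simp add: field_simps)
      also have "\<dots> = elt (a' / N a b c) (b' / N a b c) (c' / N a b c)"
        by (simp add: \<phi>.hom_div add_divide_distrib)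
      finally show ?thesis by (rule I)
    qed
    fix h' assume "h' \<in> ?S"
    then obtain a' b' c' where h': "h' = elt a' b' c'" by blast
    show "h + h' \<in> ?S" unfolding h h' elt_add by (rule I) (rule refl)
    show "h * h' \<in> ?S" unfolding h h' elt_mult by (rule I) (rule refl)
  qed
  moreover have "z \<in> ?S" by (rule I[of _ 0 1 0]) simp
  moreover have "range \<phi> \<subseteq> ?S"
  proof
    fix s assume "s \<in> range \<phi>"
    then obtain a where "s = \<phi> a" by blast
    then show "s \<in> ?S" by (intro I[of _ a 0 0]) simp
  qed
  ultimately have "generated_subfield (insert z (range \<phi>)) \<subseteq> ?S"
    by (intro generated_subfield_minimal) auto
  then have "h \<in> ?S" unfolding generates by (rule subsetD) (rule UNIV_I)
  then show ?thesis by blast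
qed

text \<open>With one point of residue degree one above \<open>P\<close>, the order of a function at
  that point is the order of its norm at \<open>P\<close>.\<close>

definition upper_val where
  "upper_val h = P (THE n. \<exists>a b c. h = elt a b c \<and> n = N a b c)"

lemma upper_val_elt: "upper_val (elt a b c) = P (N a b c)"
proof -
  have "(THE n. \<exists>a' b' c'. elt a b c = elt a' b' c' \<and> n = N a' b' c') = N a b c"
    by (rule the_equality) (blast dest: elt_unique)+
  then show ?thesis by (simp add: upper_val_def)
qed

lemma upper_val_\<phi>: "upper_val (\<phi> a) = 3 * P a"
proof -
  have "upper_val (\<phi> a) = P (a ^ 3)" using upper_val_elt[of a 0 0] by (simp add: norm3_def)
  then show ?thesis by (cases "a = 0") (auto simp: P.val_power)
qed

lemma vge_upper_val_iff: "vge upper_val \<mu> (elt a b c) \<longleftrightarrow> weight_ge \<mu> a b c"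
  unfolding weight_ge_iff_norm3 by (simp add: vge_def upper_val_elt elt_eq_0_iff norm3_eq_0_iff)

lemma upper_val_point: "upper_val \<in> points (\<phi> \<circ> cX)"
proof -
  have mult: "upper_val (h * h') = upper_val h + upper_val h'" if nz: "h \<noteq> 0" "h' \<noteq> 0" for h h'
  proof -
    obtain a b c where h: "h = elt a b c" using elt_surj by blast
    obtain a' b' c' where h': "h' = elt a' b' c'" using elt_surj by blast
    have "N a b c \<noteq> 0" "N a' b' c' \<noteq> 0"
      using nz elt_eq_0_iff[of a b c] elt_eq_0_iff[of a' b' c'] by (auto simp: h h' norm3_eq_0_iff)
    then show ?thesis unfolding h h' elt_mult upper_val_elt norm3_mult by (rule P.val_mult)
  qed
  have add: "min (upper_val h) (upper_val h') \<le> upper_val (h + h')" if nz: "h + h' \<noteq> 0" for h h'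
  proof -
    obtain a b c where h: "h = elt a b c" using elt_surj by blast
    obtain a' b' c' where h': "h' = elt a' b' c'" using elt_surj by blast
    define \<mu> where "\<mu> = min (upper_val h) (upper_val h')"
    have "vge upper_val \<mu> h" "vge upper_val \<mu> h'" by (auto simp: vge_def \<mu>_def)
    then have w: "weight_ge \<mu> a b c" "weight_ge \<mu> a' b' c'" unfolding h h' vge_upper_val_iff .
    have lin: "s + s' = 0 \<or> \<mu> \<le> 3 * P (s + s') + k"
      if "s = 0 \<or> \<mu> \<le> 3 * P s + k" "s' = 0 \<or> \<mu> \<le> 3 * P s' + k" for s s' k
    proof (cases "s = 0 \<or> s' = 0 \<or> s + s' = 0")
      case False
      then show ?thesis using P.val_add[of s s'] that by (auto simp: min_def split: if_splits)
    qed (use that in auto)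
    have "weight_ge \<mu> (a + a') (b + b') (c + c')"
      using w lin[of a 0 a'] lin[of b "P q" b'] lin[of c "2 * P q" c'] by (simp add: weight_ge_def)
    then have "vge upper_val \<mu> (h + h')" unfolding h h' elt_add vge_upper_val_iff .
    then show ?thesis using nz by (simp add: vge_def \<mu>_def)
  qed
  have "\<exists>t. upper_val t = 1"
  \<comment> \<open>One of \<open>z\<close>, \<open>z ^ 2\<close> has weight congruent to 1 modulo
    3, and a coefficient of suitable order brings it to exactly 1.\<close>
  proof (cases "P q mod 3 = 1")
    case True
    then have "P q = 3 * (P q div 3) + 1" by presburger
    moreover obtain b where b: "P b = - (P q div 3)" "b \<noteq> 0" by (rule P.exists_val)
    ultimately have "weight_eq 1 0 b 0" by (auto simp: weight_eq_def weight_ge_def)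
    from norm3_val(2)[OF this] show ?thesis by (metis upper_val_elt)
  next
    case False
    then have "P q mod 3 = 2" using q_3 by presburger
    then have "2 * P q = 3 * ((2 * P q) div 3) + 1" by presburger
    moreover obtain c where c: "P c = - ((2 * P q) div 3)" "c \<noteq> 0" by (rule P.exists_val)
    ultimately have "weight_eq 1 0 0 c" by (auto simp: weight_eq_def weight_ge_def)
    from norm3_val(2)[OF this] show ?thesis by (metis upper_val_elt)
  qed
  moreover have "upper_val 0 = 0" using upper_val_\<phi>[of 0] by simp
  moreover have "upper_val ((\<phi> \<circ> cX) r) = 0" for r by (simp add: upper_val_\<phi>)
  ultimately show ?thesis unfolding points_def using mult add by auto
qed

end

lemma (in curve_point) ram_index_eq:
  assumes "\<And>a. R (\<phi> a) = int e * P a"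
  shows "ram_index \<phi> R P = e"
  unfolding ram_index_def
proof (rule the_equality)
  show "\<forall>a. R (\<phi> a) = int e * P a" using assms by simp
  fix e' assume e': "\<forall>a. R (\<phi> a) = int e' * P a"
  obtain t where "P t = 1" by (rule uniformizer)
  then show "e' = e" using e' assms[of t] by (metis mult.right_neutral of_nat_eq_iff)
qed

text \<open>Products of basis elements may coincide, while \<open>finite_over\<close> asks for a
  set; coefficients of equal members are added up.\<close>

lemma finite_over_family:
  assumes S: "is_subfield S" and I: "finite I"
    and span: "\<And>h. \<exists>r. (\<forall>i\<in>I. r i \<in> S) \<and> h = (\<Sum>i\<in>I. r i * g i)"
  shows "finite_over S"
  unfolding finite_over_def
proof (intro exI[of _ "g ` I"] conjI allI)
  show "finite (g ` I)" using I by simp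
  fix h
  obtain r where r: "\<forall>i\<in>I. r i \<in> S" "h = (\<Sum>i\<in>I. r i * g i)" using span by blast
  define r' where "r' b = (\<Sum>i\<in>{i \<in> I. g i = b}. r i)" for b
  have sum_S: "sum r J \<in> S" if "J \<subseteq> I" for J
    using finite_subset[OF that I] that
    by (induction J rule: finite_induct) (use r is_subfieldD(1,5)[OF S] in auto)
  have "h = (\<Sum>b\<in>g ` I. \<Sum>i\<in>{i \<in> I. g i = b}. r i * g i)"
    using r(2) sum.image_gen[OF I, of "\<lambda>i. r i * g i" g] by simp
  also have "\<dots> = (\<Sum>b\<in>g ` I. r' b * b)"
    unfolding r'_def sum_distrib_right by (intro sum.cong) auto
  finally show "\<exists>r. (\<forall>b\<in>g ` I. r b \<in> S) \<and> h = (\<Sum>b\<in>g ` I. r b * b)"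
    using sum_S by (intro exI[of _ r']) (auto simp: r'_def)
qed

lemma is_curve_extension:
  fixes cX :: "'k::alg_closed_field \<Rightarrow> 'x::field" and \<phi> :: "'x \<Rightarrow> 'y::field" and z :: 'y
  assumes curve: "is_curve cX" and hom: "field_hom \<phi>"
    and span: "\<And>h. \<exists>a b c. h = \<phi> a + \<phi> b * z + \<phi> c * z ^ 2"
  shows "is_curve (\<phi> \<circ> cX)"
proof -
  interpret \<phi>: field_hom \<phi> by (rule hom)
  obtain t where t: "field_hom cX" "transcendental_over cX t"
    "finite_over (generated_subfield (insert t (range cX)))"
    using curve unfolding is_curve_def by blast
  interpret cX: field_hom cX by (rule t)
  define SX where "SX = generated_subfield (insert t (range cX))"
  define S where "S = generated_subfield (insert (\<phi> t) (range (\<phi> \<circ> cX)))"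
  have S: "is_subfield S" unfolding S_def by (rule is_subfield_generated)
  have "is_subfield {a. \<phi> a \<in> S}"
    unfolding is_subfield_def using is_subfieldD[OF S]
    by (auto simp: \<phi>.hom_add \<phi>.hom_mult \<phi>.hom_uminus \<phi>.hom_inverse)
  moreover have "insert t (range cX) \<subseteq> {a. \<phi> a \<in> S}"
    using generated_subfield_superset[of "insert (\<phi> t) (range (\<phi> \<circ> cX))"] by (auto simp: S_def)
  ultimately have SX: "SX \<subseteq> {a. \<phi> a \<in> S}" unfolding SX_def by (rule generated_subfield_minimal)
  obtain B where B: "finite B" "\<And>a. \<exists>r. (\<forall>b\<in>B. r b \<in> SX) \<and> a = (\<Sum>b\<in>B. r b * b)"
    using t(3) unfolding finite_over_def SX_def by blast
  have "finite_over S"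
  proof (rule finite_over_family[OF S, of "B \<times> {..<3::nat}" "\<lambda>(b, i). \<phi> b * z ^ i"])
    show "finite (B \<times> {..<3::nat})" using B by simp
    fix h
    obtain a0 a1 a2 where h: "h = \<phi> a0 + \<phi> a1 * z + \<phi> a2 * z ^ 2" using span by blast
    obtain r0 where r0: "\<forall>b\<in>B. r0 b \<in> SX" "a0 = (\<Sum>b\<in>B. r0 b * b)" using B(2) by blast
    obtain r1 where r1: "\<forall>b\<in>B. r1 b \<in> SX" "a1 = (\<Sum>b\<in>B. r1 b * b)" using B(2) by blast
    obtain r2 where r2: "\<forall>b\<in>B. r2 b \<in> SX" "a2 = (\<Sum>b\<in>B. r2 b * b)" using B(2) by blast
    define r where "r bi = \<phi> ((if snd bi = 0 then r0 else if snd bi = 1 then r1 else r2) (fst bi))" for bi :: "'x \<times> nat"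
    have "(\<Sum>bi\<in>B \<times> {..<3}. r bi * (case bi of (b, i) \<Rightarrow> \<phi> b * z ^ i)) =
        (\<Sum>b\<in>B. \<Sum>i<3. r (b, i) * (\<phi> b * z ^ i))"
      by (simp add: sum.cartesian_product split_def)
    also have "\<dots> = (\<Sum>b\<in>B. \<phi> (r0 b * b)) + (\<Sum>b\<in>B. \<phi> (r1 b * b)) * z + (\<Sum>b\<in>B. \<phi> (r2 b * b)) * z ^ 2"
      by (simp add: sum_lessThan_3 r_def \<phi>.hom_mult sum.distrib sum_distrib_right mult.assoc)
    also have "\<dots> = h" by (simp add: h r0 r1 r2 \<phi>.hom_sum)
    finally have "h = (\<Sum>bi\<in>B \<times> {..<3}. r bi * (case bi of (b, i) \<Rightarrow> \<phi> b * z ^ i))" ..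
    moreover have "\<forall>bi\<in>B \<times> {..<3}. r bi \<in> S" using r0 r1 r2 SX by (auto simp: r_def)
    ultimately show "\<exists>r. (\<forall>bi\<in>B \<times> {..<3}. r bi \<in> S) \<and>
        h = (\<Sum>bi\<in>B \<times> {..<3}. r bi * (case bi of (b, i) \<Rightarrow> \<phi> b * z ^ i))" by blast
  qed
  moreover have "transcendental_over (\<phi> \<circ> cX) (\<phi> t)"
    unfolding transcendental_over_def
  proof (intro allI impI)
    fix p assume "ev (\<phi> \<circ> cX) p (\<phi> t) = 0"
    moreover have "ev (\<phi> \<circ> cX) p (\<phi> t) = \<phi> (ev cX p t)"
      by (induction p) (auto simp: map_poly_pCons \<phi>.hom_add \<phi>.hom_mult)
    ultimately show "p = 0" using t(2) by (simp add: transcendental_over_def)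
  qed
  moreover have "field_hom (\<phi> \<circ> cX)"
    by unfold_locales (simp_all add: \<phi>.hom_add \<phi>.hom_mult cX.hom_add cX.hom_mult)
  ultimately show ?thesis unfolding is_curve_def S_def by blast
qed

section \<open>Degree of the cover and its ramification\<close>

context totally_ramified_cubic
begin

sublocale \<phi>_vs: vector_space "\<lambda>a b. \<phi> a * b"
  by unfold_locales (auto simp: algebra_simps \<phi>.hom_add \<phi>.hom_mult)

lemma cover_degree_eq_3: "cover_degree \<phi> = 3"
proof -
  define g where "g i = z ^ i" for i :: nat
  have "\<forall>i\<in>{..<3}. r i = 0" if "(\<Sum>i<3. \<phi> (r i) * g i) = 0" for r
  proof -
    have "elt (r 0) (r 1) (r 2) = 0" using that by (simp add: sum_lessThan_3 g_def)
    then show ?thesis unfolding elt_eq_0_iff by (auto simp: numeral_3_eq_3 less_Suc_eq numeral_2_eq_2)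
  qed
  then have g: "inj_on g {..<3}" "\<phi>_vs.independent (g ` {..<3})"
    using \<phi>_vs.independent_family[of "{..<3}" g] by auto
  have "h \<in> \<phi>_vs.span (g ` {..<3})" for h
  proof -
    obtain a b c where h: "h = elt a b c" using elt_surj by blast
    have "\<phi> a * g 0 + \<phi> b * g 1 + \<phi> c * g 2 \<in> \<phi>_vs.span (g ` {..<3})"
      by (intro \<phi>_vs.span_add \<phi>_vs.span_scale \<phi>_vs.span_base) auto
    then show ?thesis by (simp add: h g_def)
  qed
  then have "card (g ` {..<3}) = \<phi>_vs.dim UNIV"
    by (intro \<phi>_vs.basis_card_eq_dim) (use g in auto)
  then show ?thesis using g(1) by (simp add: cover_degree_def card_image)
qed

text \<open>The equation gives \<open>3 * R z = int e * P q\<close>, so 3 divides \<open>e\<close>.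
  With \<open>e = 3 k\<close>, the summands of \<open>elt a b c\<close> have \<open>k\<close> times
  their weights as orders, and one of them dominates; thus \<open>R\<close> is \<open>k\<close>
  times \<open>upper_val\<close>, and normalisation gives \<open>k = 1\<close>.\<close>

lemma point_above_unique:
  assumes R: "R \<in> points (\<phi> \<circ> cX)" and e: "0 < e" "\<And>a. R (\<phi> a) = int e * P a"
  shows "R = upper_val"
proof -
  have "field_hom (\<phi> \<circ> cX)"
    by unfold_locales (simp_all add: \<phi>.hom_add \<phi>.hom_mult P.c.hom_add P.c.hom_mult)
  then interpret R: curve_point "\<phi> \<circ> cX" R using R by (rule curve_point.intro)
  have "vge R 0 (\<phi> p)" using p_vge e by (auto simp: vge_def)
  moreover have "R (\<phi> q) < 0" using e q_neg by (simp add: mult_pos_neg)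
  ultimately have z: "z \<noteq> 0" "3 * R z = int e * P q"
    using R.cubic_root_val[OF z_cubic] e by auto
  have "3 dvd int e * P q" by (rule dvdI[of _ _ "R z"]) (simp add: z)
  then have "3 dvd int e" using q_3 by (simp add: prime_dvd_mult_iff)
  then obtain k where k: "int e = 3 * k" by (rule dvdE)
  then have k0: "0 < k" using e by linarith
  have Rz: "R z = k * P q" using z k by simp
  have main: "R h = k * upper_val h" if nz: "h \<noteq> 0" for h
  proof -
    obtain a b c where h: "h = elt a b c" using elt_surj by blast
    then have "\<not> (a = 0 \<and> b = 0 \<and> c = 0)" using nz elt_eq_0_iff by blast
    then obtain \<mu> where \<mu>: "weight_eq \<mu> a b c" using weight_exists by blast
    then have ge: "weight_ge \<mu> a b c" by (simp add: weight_eq_def)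
    have up: "upper_val h = \<mu>" unfolding h upper_val_elt by (rule norm3_val(2)[OF \<mu>])
    have strict: "k * \<mu> + 1 \<le> k * \<nu>" if "\<mu> < \<nu>" for \<nu>
      using that k0 by (smt (verit, best) mult_less_cancel_left_pos)
    have Ra: "R (\<phi> a) = k * (3 * P a)" using e k by simp
    have Rb: "b \<noteq> 0 \<Longrightarrow> R (\<phi> b * z) = k * (3 * P b + P q)" using e k z Rz
      by (simp add: R.val_mult algebra_simps)
    have Rc: "c \<noteq> 0 \<Longrightarrow> R (\<phi> c * z ^ 2) = k * (3 * P c + 2 * P q)" using e k z Rz
      by (simp add: R.val_mult R.val_power algebra_simps)
    have A: "vge R (k * \<mu> + 1) (\<phi> a)" if "a = 0 \<or> \<mu> < 3 * P a"
      using that strict by (auto simp: vge_def Ra)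
    have B: "vge R (k * \<mu> + 1) (\<phi> b * z)" if "b = 0 \<or> \<mu> < 3 * P b + P q"
      using that strict Rb by (auto simp: vge_def)
    have C: "vge R (k * \<mu> + 1) (\<phi> c * z ^ 2)" if "c = 0 \<or> \<mu> < 3 * P c + 2 * P q"
      using that strict Rc by (auto simp: vge_def)
    have "R h = k * \<mu>"
      using \<mu> unfolding weight_eq_def
    proof (elim conjE disjE)
      assume a: "a \<noteq> 0" "\<mu> = 3 * P a"
      have "vge R (k * \<mu> + 1) (\<phi> b * z + \<phi> c * z ^ 2)"
        by (intro R.vge_add B C) (use ge a weights_distinct[of "P a" "P b"] weights_distinct[of "P a" "P c"] in
          \<open>auto simp: weight_ge_def\<close>)
      then show ?thesis using R.val_add_eq(2)[of "\<phi> a"] a Ra by (simp add: h add.assoc)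
    next
      assume b: "b \<noteq> 0" "\<mu> = 3 * P b + P q"
      have "vge R (k * \<mu> + 1) (\<phi> a + \<phi> c * z ^ 2)"
        by (intro R.vge_add A C) (use ge b weights_distinct[of "P a" "P b"] weights_distinct[of "P b" "P c"] in
          \<open>auto simp: weight_ge_def\<close>)
      then have "R (\<phi> b * z + (\<phi> a + \<phi> c * z ^ 2)) = k * \<mu>"
        using R.val_add_eq(2)[of "\<phi> b * z"] b Rb z by simp
      then show ?thesis by (simp add: h add_ac)
    next
      assume c: "c \<noteq> 0" "\<mu> = 3 * P c + 2 * P q"
      have "vge R (k * \<mu> + 1) (\<phi> a + \<phi> b * z)"
        by (intro R.vge_add A B) (use ge c weights_distinct[of "P a" "P c"] weights_distinct[of "P b" "P c"] in
          \<open>auto simp: weight_ge_def\<close>)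
      then have "R (\<phi> c * z ^ 2 + (\<phi> a + \<phi> b * z)) = k * \<mu>"
        using R.val_add_eq(2)[of "\<phi> c * z ^ 2"] c Rc z by simp
      then show ?thesis by (simp add: h add_ac)
    qed
    then show ?thesis using up by simp
  qed
  obtain t where t: "R t = 1" "t \<noteq> 0" by (rule R.uniformizer)
  then have "k * upper_val t = 1" using main[of t] by simp
  then have "k = 1" using k0 by (auto simp: zmult_eq_1_iff)
  then have "R h = upper_val h" for h using main[of h] upper_val_\<phi>[of 0] by (cases "h = 0") auto
  then show ?thesis by (rule ext)
qed

lemma fully_ramified: "fully_ramified_over cX (\<phi> \<circ> cX) \<phi> P"
  and ram_index_upper_val: "ram_index \<phi> upper_val P = 3"
  and lies_over_upper_val: "lies_over \<phi> upper_val P"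
proof -
  have ram: "upper_val (\<phi> a) = int 3 * P a" for a by (simp add: upper_val_\<phi>)
  then show idx: "ram_index \<phi> upper_val P = 3" by (rule P.ram_index_eq)
  show lies: "lies_over \<phi> upper_val P" unfolding lies_over_def by (intro exI[of _ 3]) (simp add: upper_val_\<phi>)
  have "{R \<in> points (\<phi> \<circ> cX). lies_over \<phi> R P} = {upper_val}"
    using lies upper_val_point point_above_unique unfolding lies_over_def by blast
  then show "fully_ramified_over cX (\<phi> \<circ> cX) \<phi> P"
    unfolding fully_ramified_over_def using P idx cover_degree_eq_3 by auto
qed

text \<open>A uniformizer is a polynomial in \<open>z\<close>, so a good approximation of
  \<open>z\<close> by \<open>\<phi> s\<close> yields a pulled-back function of order exactly 1; but
  such orders are multiples of \<open>e\<close>.\<close>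

lemma ramification_trivial_if_approximable:
  assumes R: "R \<in> points (\<phi> \<circ> cX)" and e: "\<And>a. R (\<phi> a) = int e * T a"
    and approx: "\<And>M. \<exists>a. vge R M (z - \<phi> a)"
  shows "e = 1"
proof -
  have "field_hom (\<phi> \<circ> cX)"
    by unfold_locales (simp_all add: \<phi>.hom_add \<phi>.hom_mult P.c.hom_add P.c.hom_mult)
  then interpret R: curve_point "\<phi> \<circ> cX" R using R by (rule curve_point.intro)
  obtain t where t: "R t = 1" "t \<noteq> 0" by (rule R.uniformizer)
  obtain a b c where h: "t = elt a b c" using elt_surj by blast
  define \<mu> where "\<mu> = min 0 (R z)"
  define \<beta> where "\<beta> = min (R (\<phi> b)) (R (\<phi> c) + \<mu>)"
  \<comment> \<open>Replacing \<open>z\<close> by \<open>\<phi> s\<close> changes \<open>t\<close>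
    by \<open>z - \<phi> s\<close> times a factor of order at least \<open>\<beta>\<close>; the
    error must have order 2, one more than \<open>t\<close>. The maximum with 0 keeps
    \<open>\<phi> s\<close> at order at least \<open>\<mu>\<close>.\<close>
  obtain s where s: "vge R (max 0 (2 - \<beta>)) (z - \<phi> s)" using approx by blast
  have z: "vge R \<mu> z" by (rule R.vge_mono[OF R.vge_self]) (simp add: \<mu>_def)
  have "vge R \<mu> (z - \<phi> s)" by (rule R.vge_mono[OF s]) (simp add: \<mu>_def)
  from R.vge_diff[OF z this] have "vge R \<mu> (\<phi> s)" by simp
  then have "vge R \<mu> (z + \<phi> s)" using z by (intro R.vge_add)
  then have cz: "vge R \<beta> (\<phi> c * (z + \<phi> s))"
    by (rule R.vge_mult_le[OF R.vge_self]) (simp add: \<beta>_def)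
  have "vge R \<beta> (\<phi> b + \<phi> c * (z + \<phi> s))"
    by (rule R.vge_add[OF R.vge_mono[OF R.vge_self] cz]) (simp add: \<beta>_def)
  then have "vge R 2 ((z - \<phi> s) * (\<phi> b + \<phi> c * (z + \<phi> s)))"
    by (rule R.vge_mult_le[OF s]) simp
  moreover have "\<phi> (a + b * s + c * s ^ 2) - t = - ((z - \<phi> s) * (\<phi> b + \<phi> c * (z + \<phi> s)))"
  proof -
    have "A + B * S + C * S ^ 2 - (A + B * z + C * z ^ 2) = - ((z - S) * (B + C * (z + S)))" for A B C S :: 'y
      by (simp add: algebra_simps power2_eq_square)
    then show ?thesis unfolding h \<phi>.hom_add \<phi>.hom_mult \<phi>.hom_power .
  qed
  ultimately have "vge R (R t + 1) (\<phi> (a + b * s + c * s ^ 2) - t)" using t by simp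
  then have "R (\<phi> (a + b * s + c * s ^ 2)) = 1" using R.val_eqI[OF t(2)] t by simp
  then have "int e * T (a + b * s + c * s ^ 2) = 1" by (simp add: e)
  then show "e = 1" by (auto simp: zmult_eq_1_iff)
qed

end

text \<open>The three roots given by Cardano's formula, with \<open>w\<close> a cube root of
  unity.\<close>

lemma cardano_product:
  fixes z s b w :: "'y::field"
  assumes w: "1 + w + w ^ 2 = 0"
  shows "(z - (s + b)) * (z - (w * s + w ^ 2 * b)) * (z - (w ^ 2 * s + w * b)) =
    z ^ 3 - 3 * (s * b) * z - (s ^ 3 + b ^ 3)"
proof -
  have w2: "w * w = - 1 - w"
    using w by (metis add.commute add_diff_cancel_left' diff_0 diff_diff_add power2_eq_square uminus_add_conv_diff)
  have w3: "w * (w * r) = - r - w * r" for r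
    by (metis w2 left_diff_distrib mult.assoc mult_minus1)
  show ?thesis by (simp add: algebra_simps power2_eq_square power3_eq_cube w2 w3)
qed

text \<open>
  In the completion at a point with \<open>T' g = 3 j\<close> Cardano's formula \<open>z = s + \<lambda>/s\<close>, \<open>s\<^sup>3 = g\<close>,
  makes the cubic split; here \<open>s\<close> is a sufficiently good approximation to the cube root.
\<close>
lemma (in unramified_point) cardano_approximation:
  assumes char_3: "(3::'k) \<noteq> 0" and g: "g \<noteq> 0" "T' g = 3 * j"
    and \<alpha>: "\<pi> \<alpha> = g + cL l ^ 3 * inverse g"
  shows "\<exists>s. s \<noteq> 0 \<and> vge T M (s ^ 3 + (cK l / s) ^ 3 - \<alpha>)"
proof -
  have 3: "of_nat 3 \<noteq> (0::'k)" "T' g = int 3 * j" using char_3 g by simp_all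
  obtain r where r: "\<And>n. r n \<noteq> 0" "\<And>n. T (r n) = j"
    "\<And>n. vge T' (int 3 * j + 1 + int n) (\<pi> (r n) ^ 3 - g)"
    using root_sequence[OF g(1) 3(2,1)] by auto
  \<comment> \<open>Large enough to absorb the order \<open>3 * j\<close> of \<open>g\<close> and
    the possible loss \<open>- 6 * j\<close> from \<open>inverse (s * g)\<close>.\<close>
  define n where "n = nat (\<bar>M\<bar> + 6 * \<bar>j\<bar>)"
  define s where "s = \<pi> (r n) ^ 3"
  have s: "s \<noteq> 0" "T' s = 3 * j" using r by (auto simp: s_def T'.val_power T'_\<pi>)
  have eq: "\<pi> (r n ^ 3 + (cK l / r n) ^ 3 - \<alpha>) = (s - g) * (1 - cL l ^ 3 * inverse (s * g))"
  proof -
    have "\<pi> (r n ^ 3 + (cK l / r n) ^ 3 - \<alpha>) = s + cL l ^ 3 * inverse s - (g + cL l ^ 3 * inverse g)"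
      unfolding s_def \<alpha>[symmetric]
      by (simp add: \<pi>.hom_add \<pi>.hom_minus \<pi>.hom_power \<pi>.hom_mult \<pi>.hom_inverse
          power_mult_distrib power_inverse divide_inverse)
    also have "\<dots> = (s - g) * (1 - cL l ^ 3 * inverse (s * g))"
      using s(1) g(1) by (simp add: field_simps)
    finally show ?thesis .
  qed
  have "vge T' (- 6 * j) (cL l ^ 3 * inverse (s * g))"
    by (intro T'.vge_mult_le[OF T'.vge_power[OF T'.vge_const] T'.vge_self]) (use s g in \<open>simp add: T'.val_mult\<close>)
  then have "vge T' (min 0 (- 6 * j)) (1 - cL l ^ 3 * inverse (s * g))"
    by (intro T'.vge_diff T'.vge_mono[OF T'.vge_1]) (auto elim!: T'.vge_mono)
  then have "vge T' M (\<pi> (r n ^ 3 + (cK l / r n) ^ 3 - \<alpha>))"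
    unfolding eq by (intro T'.vge_mult_le[OF r(3)[of n, folded s_def]]) (auto simp: n_def)
  then show ?thesis using r(1) by (intro exI[of _ "r n"]) (auto simp: vge_def T'_\<pi>)
qed

section \<open>The Parshin cover\<close>

text \<open>Evaluated at \<open>z\<close>, the cubic with approximate Cardano roots
  \<open>a i\<close> has order at least \<open>3 * M'\<close>, so one of its three linear factors
  has order at least \<open>M'\<close>. Which root is approximated does not matter.\<close>

lemma (in totally_ramified_cubic) unramified_away:
  assumes up: "unramified_point cX cW \<pi> T T'" and char_3: "(3::'k) \<noteq> 0"
    and g: "g \<noteq> 0" "T' g = 3 * j" and p: "p = 3 * cX l" and q: "\<pi> q = g + cW l ^ 3 * inverse g"
    and R: "R \<in> points (\<phi> \<circ> cX)" and e: "0 < e" "\<And>a. R (\<phi> a) = int e * T a"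
  shows "e = 1"
proof (rule ramification_trivial_if_approximable[OF R e(2)])
  interpret up: unramified_point cX cW \<pi> T T' by (rule up)
  have "field_hom (\<phi> \<circ> cX)"
    by unfold_locales (simp_all add: \<phi>.hom_add \<phi>.hom_mult P.c.hom_add P.c.hom_mult)
  then interpret R: curve_point "\<phi> \<circ> cX" R using R by (rule curve_point.intro)
  obtain w :: 'k where w: "1 + w + w ^ 2 = 0"
  proof -
    obtain w where "poly [:1, 1, 1::'k:] w = 0" using alg_closed_imp_poly_has_root[of "[:1, 1, 1::'k:]"] by auto
    then show ?thesis using that[of w] by (simp add: power2_eq_square algebra_simps)
  qed
  fix M :: int
  \<comment> \<open>Nonnegativity matters when passing from \<open>T\<close> to \<open>R\<close>:
    multiplication by \<open>e\<close> must not lower the bound.\<close>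
  define M' where "M' = max 0 M"
  obtain s where s: "s \<noteq> 0" "vge T (3 * M') (s ^ 3 + (cX l / s) ^ 3 - q)"
    using up.cardano_approximation[OF char_3 g q] by blast
  define b where "b = cX l / s"
  define a where "a i = (if i = 0 then s + b else if i = 1 then cX w * s + cX w ^ 2 * b
    else cX w ^ 2 * s + cX w * b)" for i :: nat
  have sb: "s * b = cX l" using s by (simp add: b_def)
  have "cX (1 + w + w ^ 2) = 0" by (simp add: w)
  then have "\<phi> (cX (1 + w + w ^ 2)) = 0" by simp
  then have w': "1 + \<phi> (cX w) + \<phi> (cX w) ^ 2 = 0"
    by (simp add: P.c.hom_add P.c.hom_power \<phi>.hom_add \<phi>.hom_power)
  have "(z - \<phi> (a 0)) * (z - \<phi> (a 1)) * (z - \<phi> (a 2)) = z ^ 3 - 3 * (\<phi> s * \<phi> b) * z - (\<phi> s ^ 3 + \<phi> b ^ 3)"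
    using cardano_product[OF w', of z "\<phi> s" "\<phi> b"] by (simp add: a_def \<phi>.hom_add \<phi>.hom_mult \<phi>.hom_power)
  also have "\<dots> = - \<phi> (s ^ 3 + b ^ 3 - q)"
    by (simp add: z_cubic p \<phi>.hom_add \<phi>.hom_minus \<phi>.hom_mult \<phi>.hom_power flip: sb)
  finally have prod: "(z - \<phi> (a 0)) * (z - \<phi> (a 1)) * (z - \<phi> (a 2)) = - \<phi> (s ^ 3 + b ^ 3 - q)" .
  have "vge R (3 * M') (\<phi> (s ^ 3 + b ^ 3 - q))"
  proof (cases "s ^ 3 + b ^ 3 - q = 0")
    case False
    then have "3 * M' \<le> T (s ^ 3 + b ^ 3 - q)" using s(2) by (simp add: vge_def b_def)
    moreover have "1 * T (s ^ 3 + b ^ 3 - q) \<le> int e * T (s ^ 3 + b ^ 3 - q)"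
      by (rule mult_right_mono) (use e calculation in \<open>auto simp: M'_def\<close>)
    ultimately show ?thesis by (simp add: vge_def e)
  qed simp
  then have big: "vge R (3 * M') ((z - \<phi> (a 0)) * (z - \<phi> (a 1)) * (z - \<phi> (a 2)))"
    unfolding prod R.vge_uminus .
  have "\<exists>i. vge R M' (z - \<phi> (a i))"
  proof (rule ccontr)
    assume "\<nexists>i. vge R M' (z - \<phi> (a i))"
    then have lt: "z - \<phi> (a i) \<noteq> 0" "R (z - \<phi> (a i)) < M'" for i by (auto simp: vge_def not_le)
    then have "R ((z - \<phi> (a 0)) * (z - \<phi> (a 1)) * (z - \<phi> (a 2))) =
        R (z - \<phi> (a 0)) + R (z - \<phi> (a 1)) + R (z - \<phi> (a 2))"
      "(z - \<phi> (a 0)) * (z - \<phi> (a 1)) * (z - \<phi> (a 2)) \<noteq> 0"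
      by (simp_all add: R.val_mult)
    moreover have "R (z - \<phi> (a 0)) + R (z - \<phi> (a 1)) + R (z - \<phi> (a 2)) < 3 * M'"
      using lt(2)[of 0] lt(2)[of 1] lt(2)[of 2] by linarith
    ultimately show False using big unfolding vge_def by linarith
  qed
  then obtain i where "vge R M' (z - \<phi> (a i))" ..
  then have "vge R M (z - \<phi> (a i))" by (rule R.vge_mono) (simp add: M'_def)
  then show "\<exists>a. vge R M (z - \<phi> a)" by blast
qed

text \<open>The elements satisfying \<open>\<sigma> (\<pi> a) = \<pi> a\<close> form a subfield, so
  generators suffice. W is spanned by 1 and \<open>u\<close> over k(X) because \<open>v\<close>
  equals \<open>\<pi> (y / x) * u\<close>.\<close>

lemma double_coverI:
  fixes cX :: "'k::alg_closed_field \<Rightarrow> 'x::field" and cW :: "'k \<Rightarrow> 'w::field"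
  assumes X: "quadratic_function_field cX x y QX" and W: "quadratic_function_field cW u v QW"
    and char_2: "(2::'k) \<noteq> 0"
    and \<pi>: "comorphism cX cW \<pi>" "\<pi> x = u\<^sup>2" "\<pi> y = u * v"
    and \<sigma>: "comorphism cW cW \<sigma>" "\<sigma> u = - u" "\<sigma> v = - v"
  shows "double_cover cX cW \<pi> \<sigma> x u"
proof -
  interpret X: quadratic_function_field cX x y QX by (rule X)
  interpret W: quadratic_function_field cW u v QW by (rule W)
  interpret \<pi>: field_hom \<pi> using \<pi> by (simp add: comorphism_def)
  interpret \<sigma>: field_hom \<sigma> using \<sigma> by (simp add: comorphism_def)
  have const: "\<pi> (cX a) = cW a" "\<sigma> (cW a) = cW a" for a using \<pi> \<sigma> by (auto simp: comorphism_def)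
  have "is_subfield {a. \<sigma> (\<pi> a) = \<pi> a}"
    unfolding is_subfield_def
    by (auto simp: \<pi>.hom_add \<pi>.hom_mult \<pi>.hom_uminus \<pi>.hom_inverse \<sigma>.hom_add \<sigma>.hom_mult \<sigma>.hom_uminus \<sigma>.hom_inverse)
  then have "generated_subfield (insert x (insert y (range cX))) \<subseteq> {a. \<sigma> (\<pi> a) = \<pi> a}"
    by (rule generated_subfield_minimal) (auto simp: const \<pi> \<sigma> \<sigma>.hom_mult \<sigma>.hom_power)
  then have \<sigma>_\<pi>: "\<sigma> (\<pi> a) = \<pi> a" for a unfolding X.generates by blast
  have u0: "u \<noteq> 0" by (rule W.x_neq_0)
  let ?T = "{a + b * u | a b. a \<in> range \<pi> \<and> b \<in> range \<pi>}"
  have I: "h \<in> ?T" if "h = \<pi> a + \<pi> b * u" for h a b using that by blast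
  have "is_subfield ?T"
    by (rule is_subfield_adjoin_sqrt[OF is_subfield_range]) (use \<pi> in \<open>auto simp: comorphism_def simp flip: \<pi>(2)\<close>)
  moreover have "insert u (insert v (range cW)) \<subseteq> ?T"
  proof -
    have "u \<in> ?T" by (rule I[of _ 0 1]) simp
    moreover have "v \<in> ?T"
      by (rule I[of _ 0 "y / x"]) (use u0 in \<open>simp add: \<pi>.hom_div \<pi> power2_eq_square\<close>)
    moreover have "cW a \<in> ?T" for a by (rule I[of _ "cX a" 0]) (simp add: const)
    ultimately show ?thesis by blast
  qed
  ultimately have "generated_subfield (insert u (insert v (range cW))) \<subseteq> ?T"
    by (rule generated_subfield_minimal)
  then have span: "\<exists>a b. h = \<pi> a + \<pi> b * u" for h unfolding W.generates by blast
  show ?thesis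
    by (rule double_cover.intro)
      (fact X.hom W.hom char_2 \<pi>(1) \<sigma>(1) \<sigma>_\<pi> \<sigma>(2) \<pi>(2)[symmetric] u0 span)+
qed

text \<open>At a zero of \<open>x\<close> the quartic factor is a unit because
  \<open>a0 \<noteq> 0\<close>, so \<open>T x = 2 * T y\<close>; at a pole it has order
  \<open>4 * T x\<close>, so \<open>5 * T x = 2 * T y\<close>.\<close>

lemma (in quadratic_function_field) even_order_x:
  assumes Q: "Q = [:0, 1:] * [:a0, a1, a2, a3, 1:]" and a0: "a0 \<noteq> 0" and T: "T \<in> points c"
  shows "\<exists>j. T x = 2 * j"
proof -
  interpret T: curve_point c T by (rule curve_point.intro) (fact hom T)+
  let ?r = "[:a0, a1, a2, a3, 1:]"
  have y2: "y\<^sup>2 = x * ev c ?r x" unfolding y_sq Q mp.hom_mult poly_mult by (simp add: c.map_poly_pCons_hom)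
  have r0: "ev c ?r x \<noteq> 0" using transcendental[of ?r] by auto
  then have "y \<noteq> 0" using y2 x_neq_0 by auto
  then have "2 * T y = T (y\<^sup>2)" by (simp add: T.val_power)
  also have "\<dots> = T x + T (ev c ?r x)" unfolding y2 using x_neq_0 r0 by (rule T.val_mult)
  finally have eq: "2 * T y = T x + T (ev c ?r x)" .
  consider "T x = 0" | "0 < T x" | "T x < 0" by linarith
  then show ?thesis
  proof cases
    case 2
    then have "T (ev c ?r x) = 0" using a0 by (intro T.val_poly_unit) (auto simp: vge_def)
    then show ?thesis using eq by (intro exI[of _ "T y"]) simp
  next
    case 3
    then have "T (ev c ?r x) = 4 * T x" using T.val_poly_pole[of ?r x] by simp
    then show ?thesis using eq by presburger
  qed simp
qed

text \<open>Even order makes \<open>x\<close> a square in the completion at \<open>T\<close>; the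
  sequence of approximate roots feeds \<open>split_point\<close>, whose valuation has index one over
  \<open>T\<close>.\<close>

lemma (in double_cover) point_above_exists:
  assumes T: "T \<in> points cX" and j: "T x = 2 * j"
    and res: "\<And>h. vge T 0 h \<Longrightarrow> \<exists>a. vge T 1 (h - cX a)"
  shows "\<exists>T'\<in>points cW. \<forall>a. T' (\<pi> a) = T a"
proof -
  have "field_hom (id :: 'x \<Rightarrow> 'x)" by unfold_locales simp_all
  then have "comorphism cX cX id" by (simp add: comorphism_def)
  then have up: "unramified_point cX cX id T T"
    using hom_X T res by (simp add: unramified_point_def)
  have "x \<noteq> 0" using u_sq u_neq_0 by auto
  moreover have "T x = int 2 * j" using j by simp
  moreover have "of_nat 2 \<noteq> (0::'k)" using char_2 by simp
  ultimately obtain r where r: "\<forall>n. (r n \<noteq> 0 \<and> T (r n) = j \<and> vge T (int 2 * j + 1 + int n) (r n ^ 2 - x)) \<and>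
    vge T (j + 1 + int n) (r (Suc n) - r n)"
    using unramified_point.root_sequence[OF up, of x 2 j] by auto
  interpret split_point cX cW \<pi> \<sigma> x u T r j
    by unfold_locales (use T r in auto)
  show ?thesis using lift_val_point lift_val_\<pi> by blast
qed

text \<open>The unit \<open>u / t\<close> with \<open>2 T t = T x\<close> is anti-invariant, so its nonzero value changes sign under \<open>\<sigma>\<close>.\<close>
lemma (in double_cover) no_fixed_point:
  assumes S: "S \<in> points cW" and T: "T \<in> points cX" "lies_over \<pi> S T" and j: "T x = 2 * j"
    and res: "\<And>h. vge S 0 h \<Longrightarrow> \<exists>a. vge S 1 (h - cW a)"
  shows "aut_point \<sigma> S \<noteq> S"
proof
  assume fixed: "aut_point \<sigma> S = S"
  interpret S: curve_point cW S by (rule curve_point.intro) (fact hom_W S)+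
  interpret T: curve_point cX T by (rule curve_point.intro) (fact hom_X T(1))+
  obtain e where e: "\<And>a. S (\<pi> a) = int e * T a" using T(2) unfolding lies_over_def by blast
  obtain t where t: "T t = j" "t \<noteq> 0" by (rule T.exists_val)
  define h where "h = u / \<pi> t"
  have "2 * S u = S (\<pi> x)" using u_neq_0 by (simp flip: u_sq add: S.val_power)
  then have "S u = int e * j" by (simp add: e j)
  then have h: "h \<noteq> 0" "S h = 0" using u_neq_0 t by (auto simp: h_def S.val_divide e)
  obtain a where a: "vge S 1 (h - cW a)" using res[of h] h by (auto simp: vge_def)
  have inv: "vge S n (\<sigma> k) \<longleftrightarrow> vge S n k" for n k
    using fun_cong[OF fixed, of k] by (simp add: vge_def aut_point_def)
  have "vge S 1 (\<sigma> (h - cW a))" using a inv by blast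
  then have "vge S 1 (- h - cW a)" by (simp add: h_def \<sigma>.hom_minus \<sigma>.hom_div)
  from S.vge_diff[OF a this] have "vge S 1 (2 * h)" by simp
  moreover have "S 2 = 0" using S.val_const[of "of_nat 2"] unfolding S.const_of_nat by simp
  ultimately show False using two_neq_0 h by (simp add: vge_def S.val_mult)
qed

theorem theorem6p7:
  fixes a0 a1 a2 a3 l :: "'k::alg_closed_field"
    and cX :: "'k \<Rightarrow> 'x::field" and x y :: 'x
    and cW :: "'k \<Rightarrow> 'w::field" and u v f g :: 'w
    and \<pi> :: "'x \<Rightarrow> 'w" and \<sigma> :: "'w \<Rightarrow> 'w"
    and Qt Pt :: "'w \<Rightarrow> int" and P :: "'x \<Rightarrow> int"
  assumes char: "\<not> CHAR('k) dvd 6"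
    and X: "is_plane_curve_model cX [: - ([:0, 1:] * [:a0, a1, a2, a3, 1:]), 0, 1 :] x y"
    and genus_X: "has_genus cX 2"
    and W: "is_plane_curve_model cW [: - [:a0, 0, a1, 0, a2, 0, a3, 0, 1:], 0, 1 :] u v"
    and \<pi>: "comorphism cX cW \<pi>" "\<pi> x = u\<^sup>2" "\<pi> y = u * v"
    and \<sigma>: "comorphism cW cW \<sigma>" "\<sigma> u = - u" "\<sigma> v = - v"
    and Qt: "Qt \<in> points cW"
    and Pt: "Pt \<in> points cW"
    and equiv: "lin_equiv cW (frag_cmul 3 (frag_of Qt - frag_of (aut_point \<sigma> Qt)))
                             (frag_of (aut_point \<sigma> Pt) - frag_of Pt)"
    and P: "P \<in> points cX" "lies_over \<pi> Pt P"
    and f: "has_divisor cW f (frag_of (aut_point \<sigma> Pt) + frag_cmul 3 (frag_of (aut_point \<sigma> Qt))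
                              - frag_of Pt - frag_cmul 3 (frag_of Qt))"
    and l: "f * \<sigma> f = cW l"
    and g: "g = cW l * f"
  shows "\<exists>\<alpha>. \<pi> \<alpha> = g + \<sigma> g \<and>
             \<pi> \<alpha> = g + cW l ^ 3 * inverse g \<and>
             \<pi> \<alpha> = cW l * (f + cW l * inverse f) \<and>
             irreducible [: - \<alpha>, - (3 * cX l), 0, 1 :] \<and>
             (\<forall>(\<phi> :: 'x \<Rightarrow> 'y::field) z.
                adjoins_root \<phi> [: - \<alpha>, - (3 * cX l), 0, 1 :] z \<longrightarrow>
                is_parshin_cover cX (\<phi> \<circ> cX) \<phi> \<and> branch_point cX (\<phi> \<circ> cX) \<phi> P)"
proof -
  have two: "(2::'k) \<noteq> 0" and three: "(3::'k) \<noteq> 0"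
  proof -
    have "of_nat 6 \<noteq> (0::'k)" using char unfolding of_nat_eq_0_iff_char_dvd .
    then have "(2::'k) * 3 \<noteq> 0" by simp
    then show "(2::'k) \<noteq> 0" "(3::'k) \<noteq> 0" by (metis mult_zero_left, metis mult_zero_right)
  qed
  have qX: "quadratic_function_field cX x y ([:0, 1:] * [:a0, a1, a2, a3, 1:])"
    using X by (rule quadratic_function_field.intro)
  have qW: "quadratic_function_field cW u v [:a0, 0, a1, 0, a2, 0, a3, 0, 1:]"
    using W by (rule quadratic_function_field.intro)
  interpret X: quadratic_function_field cX x y "[:0, 1:] * [:a0, a1, a2, a3, 1:]" by (rule qX)
  interpret W: quadratic_function_field cW u v "[:a0, 0, a1, 0, a2, 0, a3, 0, 1:]" by (rule qW)
  have a0: "a0 \<noteq> 0"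
  proof
    assume "a0 = 0"
    then have "y\<^sup>2 = x\<^sup>2 * ev cX [:a1, a2, a3, 1:] x"
      using X.y_sq unfolding X.mp.hom_mult poly_mult
      by (simp add: X.c.map_poly_pCons_hom power2_eq_square mult.assoc)
    then have "(y / x)\<^sup>2 = ev cX [:a1, a2, a3, 1:] x" using X.x_neq_0 by (simp add: power_divide)
    then have "\<not> has_genus cX 2" by (rule X.not_genus_two_if_cubic) simp
    then show False using genus_X by blast
  qed
  interpret D: double_cover cX cW \<pi> \<sigma> x u by (rule double_coverI[OF qX qW two \<pi> \<sigma>])
  note even_x = X.even_order_x[OF refl a0]
  have f0: "f \<noteq> 0" using f by (simp add: has_divisor_def)
  have l0: "l \<noteq> 0"
  proof
    assume "l = 0"
    then have "f * \<sigma> f = 0" using l by simp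
    then show False using f0 by simp
  qed
  have g0: "g \<noteq> 0" using f0 l0 by (simp add: g)
  have \<sigma>f: "\<sigma> f = cW l * inverse f" using l f0 by (simp add: field_simps)
  have \<sigma>g: "\<sigma> g = cW l ^ 3 * inverse g"
    using f0 l0 by (simp add: g D.\<sigma>.hom_mult \<sigma>f power3_eq_cube W.c.hom_mult)
  have "\<sigma> (g + \<sigma> g) = g + \<sigma> g"
  proof -
    have "\<sigma> (\<sigma> g) = \<sigma> (cW l ^ 3 * inverse g)" by (simp only: \<sigma>g)
    also have "\<dots> = cW l ^ 3 * inverse (\<sigma> g)"
      by (simp add: D.\<sigma>.hom_mult D.\<sigma>.hom_power D.\<sigma>.hom_inverse)
    also have "\<dots> = g" using l0 g0 by (simp add: \<sigma>g)
    finally show ?thesis by (simp add: D.\<sigma>.hom_add add.commute)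
  qed
  then obtain \<alpha> where "g + \<sigma> g = \<pi> \<alpha>" using D.fixed_imp_range by blast
  then have \<alpha>: "\<pi> \<alpha> = g + \<sigma> g" by simp
  have \<alpha>': "\<pi> \<alpha> = g + cW l ^ 3 * inverse g" by (simp add: \<alpha> \<sigma>g)
  have \<alpha>'': "\<pi> \<alpha> = cW l * (f + cW l * inverse f)"
    by (simp add: \<alpha> g D.\<sigma>.hom_mult \<sigma>f algebra_simps)

  \<comment> \<open>Orders of f and of \<alpha>\<close>
  have order_f: "S f = (if S = aut_point \<sigma> Pt then 1 else 0) + 3 * (if S = aut_point \<sigma> Qt then 1 else 0)
      - (if S = Pt then 1 else 0) - 3 * (if S = Qt then 1 else 0)" if "S \<in> points cW" for S
  proof -
    have "S f = Poly_Mapping.lookup (frag_of (aut_point \<sigma> Pt) + frag_cmul 3 (frag_of (aut_point \<sigma> Qt))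
        - frag_of Pt - frag_cmul 3 (frag_of Qt)) S"
      using f that by (simp add: has_divisor_def)
    then show ?thesis by (simp add: lookup_add lookup_minus)
  qed
  interpret P: curve_point cX P by (rule curve_point.intro) (fact X.hom P(1))+
  interpret Pt: curve_point cW Pt by (rule curve_point.intro) (fact W.hom Pt)+
  obtain eP where eP: "0 < eP" "\<And>a. Pt (\<pi> a) = int eP * P a" using P(2) unfolding lies_over_def by blast
  obtain jP where jP: "P x = 2 * jP" using even_x[OF P(1)] by blast
  have "aut_point \<sigma> Pt \<noteq> Pt" by (rule D.no_fixed_point[OF Pt P jP W.residue[OF Pt]])
  \<comment> \<open>As \<open>Pt\<close> differs from its conjugate, the single coefficients
    contribute exactly -1; the \<open>Qt\<close> terms add multiples of 3, even if \<open>Qt\<close>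
    is \<open>Pt\<close> or its conjugate.\<close>
  then have Pt_f: "\<not> 3 dvd Pt f"
    using order_f[OF Pt] by (auto simp: dvd_def split: if_splits; presburger)
  have Pt_g: "Pt g = Pt f" using f0 l0 by (simp add: g Pt.val_mult)
  have Pt_\<sigma>g: "Pt (\<sigma> g) = - Pt f" "\<sigma> g \<noteq> 0"
    using g0 l0 Pt_g by (auto simp: \<sigma>g Pt.val_mult Pt.val_power)
  \<comment> \<open>\<open>g\<close> and \<open>\<sigma> g\<close> have opposite nonzero orders at
    \<open>Pt\<close>, so the pole of one of them survives in the sum.\<close>
  have Pt_\<alpha>: "Pt (\<pi> \<alpha>) = - \<bar>Pt f\<bar>"
  proof -
    have "Pt f \<noteq> 0" using Pt_f by auto
    then consider "Pt f < 0" | "0 < Pt f" by linarith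
    then show ?thesis
    proof cases
      case 1
      then show ?thesis using Pt.val_add_eq(2)[OF g0, of "\<sigma> g"] Pt_g Pt_\<sigma>g by (simp add: \<alpha> vge_def)
    next
      case 2
      then show ?thesis using Pt.val_add_eq(2)[OF Pt_\<sigma>g(2), of g] Pt_g Pt_\<sigma>g
        by (simp add: \<alpha> vge_def add.commute)
    qed
  qed
  have P\<alpha>: "P \<alpha> < 0" "\<not> 3 dvd P \<alpha>"
  proof -
    \<comment> \<open>Sign and indivisibility by 3 pass down to \<open>P\<close> whatever the index
      \<open>eP\<close> is.\<close>
    have eq: "int eP * P \<alpha> = - \<bar>Pt f\<bar>" using Pt_\<alpha> eP by simp
    have "Pt f \<noteq> 0" using Pt_f by auto
    then have "int eP * P \<alpha> < 0" using eq by simp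
    then show "P \<alpha> < 0" using eP(1) by (simp add: mult_less_0_iff)
    show "\<not> 3 dvd P \<alpha>"
    proof
      assume "3 dvd P \<alpha>"
      then have "3 dvd int eP * P \<alpha>" by (rule dvd_mult)
      then show False using Pt_f eq by simp
    qed
  qed
  have p_vge: "vge P 0 (3 * cX l)" using P.vge_mult[OF P.numeral_vge P.vge_const] by simp
  have irr: "irreducible [: - \<alpha>, - (3 * cX l), 0, 1 :]"
  proof (rule irreducible_cubic)
    fix z
    show "poly [: - \<alpha>, - (3 * cX l), 0, 1 :] z \<noteq> 0"
    proof
      assume "poly [: - \<alpha>, - (3 * cX l), 0, 1 :] z = 0"
      then have "z ^ 3 = 3 * cX l * z + \<alpha>" by (simp add: algebra_simps power3_eq_cube)
      from P.cubic_root_val(2)[OF this p_vge P\<alpha>(1)] show False using P\<alpha>(2) by (metis dvd_triv_left)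
    qed
  qed simp

  \<comment> \<open>Ramification of the cover\<close>
  have parshin: "is_parshin_cover cX (\<phi> \<circ> cX) \<phi> \<and> branch_point cX (\<phi> \<circ> cX) \<phi> P"
    if adj: "adjoins_root \<phi> [: - \<alpha>, - (3 * cX l), 0, 1 :] z" for \<phi> :: "'x \<Rightarrow> 'y" and z
  proof -
    have \<phi>: "field_hom \<phi>" and gen: "generated_subfield (insert z (range \<phi>)) = UNIV"
      and root: "poly (map_poly \<phi> [: - \<alpha>, - (3 * cX l), 0, 1 :]) z = 0"
      using adj by (auto simp: adjoins_root_def)
    interpret \<phi>: field_hom \<phi> by (rule \<phi>)
    have z3: "z ^ 3 = \<phi> (3 * cX l) * z + \<phi> \<alpha>"
    proof -
      have "- \<phi> \<alpha> + z * (- \<phi> (3 * cX l) + z * (z * 1)) = 0"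
        using root by (simp add: \<phi>.map_poly_pCons_hom \<phi>.hom_uminus)
      then show ?thesis by (simp add: algebra_simps power3_eq_cube)
    qed
    interpret Y: totally_ramified_cubic cX P \<phi> z "3 * cX l" \<alpha>
      by (rule totally_ramified_cubic.intro) (fact X.hom P(1) \<phi> z3 gen p_vge P\<alpha>)+
    have only: "T = P" if branch: "branch_point cX (\<phi> \<circ> cX) \<phi> T" for T
    proof (rule ccontr)
      assume TP: "T \<noteq> P"
      have T: "T \<in> points cX" using branch by (simp add: branch_point_def)
      interpret T: curve_point cX T by (rule curve_point.intro) (fact X.hom T)+
      obtain R where R: "R \<in> points (\<phi> \<circ> cX)" "lies_over \<phi> R T" "1 < ram_index \<phi> R T"
        using branch by (auto simp: branch_point_def)
      obtain e where e: "0 < e" "\<And>a. R (\<phi> a) = int e * T a" using R(2) unfolding lies_over_def by blast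
      obtain j where j: "T x = 2 * j" using even_x[OF T] by blast
      obtain T' where T': "T' \<in> points cW" "\<And>a. T' (\<pi> a) = T a"
        using D.point_above_exists[OF T j X.residue[OF T]] by blast
      have up: "unramified_point cX cW \<pi> T T'"
        by (rule unramified_point.intro) (fact X.hom W.hom \<pi>(1) T T' W.residue[OF T'(1)])+
      \<comment> \<open>If \<open>T'\<close> and \<open>Pt\<close> agreed on k(X), then
        \<open>T\<close> would be \<open>eP\<close> times \<open>P\<close>, and normalisation would
        give \<open>T = P\<close>. Since \<open>\<sigma>\<close> fixes k(X), this excludes the
        conjugate of \<open>Pt\<close> too, and only the \<open>Qt\<close> terms, with coefficients
        divisible by 3, remain in the order of \<open>f\<close>.\<close>
      have not_P: "\<exists>a. T' (\<pi> a) \<noteq> Pt (\<pi> a)"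
      proof (rule ccontr)
        assume "\<not> ?thesis"
        then have eq: "T a = int eP * P a" for a using T' eP by simp
        obtain t where "T t = 1" by (rule T.uniformizer)
        then have "int eP * P t = 1" using eq[of t] by simp
        then have "eP = 1" by (auto simp: zmult_eq_1_iff)
        then show False using TP eq by auto
      qed
      then have "T' \<noteq> Pt" by auto
      moreover have "T' \<noteq> aut_point \<sigma> Pt" using not_P by (auto simp: aut_point_def)
      ultimately have "T' f = 3 * ((if T' = aut_point \<sigma> Qt then 1 else 0) - (if T' = Qt then 1 else 0))"
        using order_f[OF T'(1)] by simp
      moreover have "T' g = T' f"
      proof -
        interpret T': curve_point cW T' by (rule curve_point.intro) (fact W.hom T'(1))+
        show ?thesis using f0 l0 by (simp add: g T'.val_mult)
      qed
      ultimately have "T' g = 3 * ((if T' = aut_point \<sigma> Qt then 1 else 0) - (if T' = Qt then 1 else 0))" by simp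
      then have "e = 1" by (rule Y.unramified_away[OF up three g0 _ refl \<alpha>' R(1) e])
      moreover have "ram_index \<phi> R T = e" by (rule T.ram_index_eq) (rule e)
      ultimately show False using R(3) by simp
    qed
    have "is_curve (\<phi> \<circ> cX)" by (rule is_curve_extension[OF X.is_curve \<phi> Y.elt_surj])
    then have "is_cover cX (\<phi> \<circ> cX) \<phi>"
      using X.is_curve \<phi> Y.cover_degree_eq_3 by (simp add: is_cover_def comorphism_def)
    moreover have "branch_point cX (\<phi> \<circ> cX) \<phi> P"
      unfolding branch_point_def using P(1) Y.upper_val_point Y.lies_over_upper_val Y.ram_index_upper_val
      by (intro conjI bexI[of _ Y.upper_val]) auto
    ultimately show ?thesis
      unfolding is_parshin_cover_def using Y.cover_degree_eq_3 Y.fully_ramified only by blast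
  qed
  show ?thesis using \<alpha> \<alpha>' \<alpha>'' irr parshin by blast
qed

end
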